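(* Let $1\le p\le\infty$ and let $X$ be an infinite-dimensional (real) space $L_p(\mu)=L_p(\Omega,\Sigma,\mu)$, where $(\Omega,\Sigma,\mu)$ is a positive measure space. Then: (a) $X$ satisfies (D) if and only if $p\ge2$; (b) $X$ satisfies (Cdc) if and only if $1<p\le2$; (c) $X$ satisfies (dc) if and only if $p>1$.
   Context: A function $q\colon X\to\mathbb{R}$ on a real Banach space is a continuous quadratic form if there is a continuous bilinear form $b\colon X\times X\to\mathbb{R}$ with $q(x)=b(x,x)$ for all $x$. It is delta-semidefinite if it is the difference of two nonnegative continuous quadratic forms on $X$. A function on $X$ is delta-convex if it is the difference of two continuous convex functions on $X$. A function $f\colon X\to\mathbb{R}$ is $C^{1,1}$ if its Fr\'echet derivative $f'(x)$ exists at each $x\in X$ and the mapping $f'\colon X\to X^*$ is Lipschitz. Properties of $X$: (D) each continuous quadratic form on $X$ is delta-semidefinite; (dc) each continuous quadratic form on $X$ is delta-convex; (Cdc) each $C^{1,1}$ function $f\colon X\to\mathbb{R}$ is delta-convex. *)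

theory Defs
  imports "HOL-Analysis.Analysis" "HOL-Probability.Essential_Supremum"
begin

section \<open>Classes of functions on a real Banach space\<close>

definition continuous_quadratic_form :: "('x::banach \<Rightarrow> real) \<Rightarrow> bool" where
  "continuous_quadratic_form q \<longleftrightarrow> (\<exists>b. bounded_bilinear b \<and> (\<forall>x. q x = b x x))"

definition delta_semidefinite :: "('x::banach \<Rightarrow> real) \<Rightarrow> bool" where
  "delta_semidefinite q \<longleftrightarrow>
    (\<exists>q1 q2. continuous_quadratic_form q1 \<and> (\<forall>x. 0 \<le> q1 x) \<and>
             continuous_quadratic_form q2 \<and> (\<forall>x. 0 \<le> q2 x) \<and>
             (\<forall>x. q x = q1 x - q2 x))"

definition delta_convex :: "('x::banach \<Rightarrow> real) \<Rightarrow> bool" where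
  "delta_convex f \<longleftrightarrow>
    (\<exists>g h. convex_on UNIV g \<and> continuous_on UNIV g \<and>
           convex_on UNIV h \<and> continuous_on UNIV h \<and>
           (\<forall>x. f x = g x - h x))"

text \<open>The dual space is the type of bounded linear functionals with the operator norm.\<close>

definition C11 :: "('x::banach \<Rightarrow> real) \<Rightarrow> bool" where
  "C11 f \<longleftrightarrow>
    (\<exists>f' :: 'x \<Rightarrow> ('x \<Rightarrow>\<^sub>L real).
       (\<forall>x. (f has_derivative blinfun_apply (f' x)) (at x)) \<and>
       (\<exists>L. L-lipschitz_on UNIV f'))"

definition property_D :: "'x::banach itself \<Rightarrow> bool" where
  "property_D _ \<longleftrightarrow>
    (\<forall>q :: 'x \<Rightarrow> real. continuous_quadratic_form q \<longrightarrow> delta_semidefinite q)"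

definition property_dc :: "'x::banach itself \<Rightarrow> bool" where
  "property_dc _ \<longleftrightarrow>
    (\<forall>q :: 'x \<Rightarrow> real. continuous_quadratic_form q \<longrightarrow> delta_convex q)"

definition property_Cdc :: "'x::banach itself \<Rightarrow> bool" where
  "property_Cdc _ \<longleftrightarrow> (\<forall>f :: 'x \<Rightarrow> real. C11 f \<longrightarrow> delta_convex f)"

definition infinite_dimensional :: "'x::real_vector itself \<Rightarrow> bool" where
  "infinite_dimensional _ \<longleftrightarrow> \<not> (\<exists>B :: 'x set. finite B \<and> span B = UNIV)"

section \<open>The spaces $L_p(\mu)$\<close>

definition Lp_functions :: "ennreal \<Rightarrow> 'a measure \<Rightarrow> ('a \<Rightarrow> real) set" where
  "Lp_functions p M =
    (if p = \<infinity> then {f \<in> borel_measurable M. esssup M (\<lambda>x. ennreal \<bar>f x\<bar>) < \<infinity>}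
     else {f \<in> borel_measurable M. integrable M (\<lambda>x. \<bar>f x\<bar> powr enn2real p)})"

definition Lp_norm :: "ennreal \<Rightarrow> 'a measure \<Rightarrow> ('a \<Rightarrow> real) \<Rightarrow> real" where
  "Lp_norm p M f =
    (if p = \<infinity> then enn2real (esssup M (\<lambda>x. ennreal \<bar>f x\<bar>))
     else (LINT x|M. \<bar>f x\<bar> powr enn2real p) powr (1 / enn2real p))"

text \<open>
  A type cannot depend on the measure \<open>M\<close>, so the quotient of \<open>Lp_functions p M\<close> by equality almost
  everywhere is given by its quotient map: \<open>is_Lp_space p M T\<close> says that the Banach space \<open>'x\<close>
  is $L_p(M)$, where \<open>T f\<close> is the class of \<open>f\<close>. The values of \<open>T\<close> outside
  \<open>Lp_functions p M\<close> are irrelevant.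
\<close>

definition is_Lp_space :: "ennreal \<Rightarrow> 'a measure \<Rightarrow> (('a \<Rightarrow> real) \<Rightarrow> 'x::banach) \<Rightarrow> bool" where
  "is_Lp_space p M T \<longleftrightarrow>
    T ` Lp_functions p M = UNIV \<and>
    (\<forall>f\<in>Lp_functions p M. \<forall>g\<in>Lp_functions p M. T f = T g \<longleftrightarrow> (AE x in M. f x = g x)) \<and>
    (\<forall>f\<in>Lp_functions p M. \<forall>g\<in>Lp_functions p M. T (\<lambda>x. f x + g x) = T f + T g) \<and>
    (\<forall>c. \<forall>f\<in>Lp_functions p M. T (\<lambda>x. c * f x) = c *\<^sub>R T f) \<and>
    (\<forall>f\<in>Lp_functions p M. norm (T f) = Lp_norm p M f)"

end

theory Submission
  imports Defs "HOL-Real_Asymp.Real_Asymp" "HOL-Library.Function_Algebras"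
begin

text \<open>
  A nonnegative continuous quadratic form is convex and a continuous quadratic form is \<open>C\<^sup>1\<^sup>,\<^sup>1\<close>, so (D)
  and (Cdc) both imply (dc). The theorem therefore follows from two positive results and three
  counterexamples.

  For \<open>p \<ge> 2\<close>, including \<open>p = \<infinity>\<close>, every continuous quadratic form \<open>q\<close> lies below a form
  \<open>f \<mapsto> \<Lambda> (f\<^sup>2)\<close> with a positive functional \<open>\<Lambda>\<close> on \<open>L\<^sub>p\<^sub>/\<^sub>2\<close> (\<open>property_D_if_ge_2\<close>). This is Maurey's
  argument: Grothendieck's inequality bounds \<open>\<Sum>i. q (f\<^sub>i)\<close> by a multiple of the norm of \<open>\<Sum>i. f\<^sub>i\<^sup>2\<close>
  in \<open>L\<^sub>p\<^sub>/\<^sub>2\<close>, and the Hahn--Banach theorem provides \<open>\<Lambda>\<close>. Then \<open>q = \<Lambda> (f\<^sup>2) - (\<Lambda> (f\<^sup>2) - q)\<close>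
  is a difference of nonnegative forms.

  For \<open>1 < p \<le> 2\<close>, the norm satisfies
  \<open>\<parallel>x + y\<parallel>\<^sup>2 + \<parallel>x - y\<parallel>\<^sup>2 \<ge> 2 \<parallel>x\<parallel>\<^sup>2 + 2 (p - 1) \<parallel>y\<parallel>\<^sup>2\<close>, so adding a large multiple of \<open>\<parallel>x\<parallel>\<^sup>2\<close> to a
  \<open>C\<^sup>1\<^sup>,\<^sup>1\<close> function makes it convex (\<open>property_Cdc_if_between\<close>).

  The counterexamples use normalized indicators of infinitely many disjoint sets together with
  biorthogonal functionals (\<open>coordinates_exist\<close>), which make finite-dimensional \<open>\<ell>\<^sub>p\<close> spaces of all dimensions
  available as disjoint blocks, and glue examples on these blocks.

  For \<open>p < 2\<close>, the form of a Hadamard matrix of size \<open>n\<close> has norm of smaller order than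
  \<open>\<surd>n\<close> on \<open>\<ell>\<^sub>p\<close>, but whenever it is written as a difference of nonnegative forms, the sum of these forms is
  at least \<open>\<surd>n\<close> at some unit vector (\<open>not_property_D\<close>).

  If \<open>f = g - h\<close> with convex \<open>g\<close> and \<open>h\<close>, then along a binary tree in a small ball the second differences of \<open>f\<close>
  at the vertices of some branch have a bounded sum (\<open>delta_convex_tree\<close>). On \<open>\<ell>\<^sub>1\<close>, the unit vectors at the
  leaves of a deep tree and their averages at the other vertices form a bounded tree with steps
  of length \<open>1\<close>, and there is a bounded kernel whose form is \<open>\<plusminus>1\<close> at every step (\<open>not_property_dc\<close>). For
  \<open>p > 2\<close>, the vectors \<open>\<plusminus>e\<^sub>1 \<plusminus> \<dots> \<plusminus> e\<^sub>n\<close> have norm \<open>n\<^sup>1\<^sup>/\<^sup>p\<close>, which is of smaller order than \<open>\<surd>n\<close>, and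
  there is a function with derivative bounded and Lipschitz independently of \<open>n\<close> that alternates between almost
  \<open>0\<close> and almost \<open>1\<close> along \<open>R (\<plusminus>e\<^sub>1 \<plusminus> \<dots> \<plusminus> e\<^sub>k)\<close>, \<open>k \<le> n\<close>, for some \<open>R\<close> of order
  \<open>log n\<close> (\<open>not_property_Cdc\<close>).
\<close>

section \<open>The Hahn--Banach theorem\<close>

definition sublinear :: "('v::real_vector \<Rightarrow> real) \<Rightarrow> bool" where
  "sublinear S \<longleftrightarrow> (\<forall>x y. S (x + y) \<le> S x + S y) \<and> (\<forall>c>0. \<forall>x. S (c *\<^sub>R x) \<le> c * S x)"

lemma sublinear_add: "sublinear S \<Longrightarrow> S (x + y) \<le> S x + S y"
  by (simp add: sublinear_def)

lemma sublinear_scale: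
  assumes "sublinear S" "0 < c"
  shows "S (c *\<^sub>R x) = c * S x"
proof (rule antisym)
  show "S (c *\<^sub>R x) \<le> c * S x" using assms by (simp add: sublinear_def)
  have "S (inverse c *\<^sub>R c *\<^sub>R x) \<le> inverse c * S (c *\<^sub>R x)"
    using assms unfolding sublinear_def by (meson positive_imp_inverse_positive)
  then show "c * S x \<le> S (c *\<^sub>R x)" using assms(2) by (simp add: field_simps)
qed

lemma sublinear_zero: "sublinear S \<Longrightarrow> S 0 = 0"
  using sublinear_scale[of S 2 0] by simp

lemma sublinear_minus: "sublinear S \<Longrightarrow> - S (- x) \<le> S x"
  using sublinear_add[of S x "-x"] sublinear_zero[of S] by simp

text \<open>
  A minimal sublinear functional \<open>S\<close> is linear: lowering it in the direction \<open>y\<close> to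
  \<open>\<lambda>x. INF t\<ge>0. S (x + t y) - t S y\<close> cannot change it, which gives
  \<open>S x + S y \<le> S (x + y)\<close>. Zorn's lemma provides a minimal functional below any given one.
\<close>

lemma minimal_sublinear_superadditive:
  assumes S: "sublinear S" and min: "\<And>S'. sublinear S' \<Longrightarrow> S' \<le> S \<Longrightarrow> S' = S"
  shows "S x + S y \<le> S (x + y)"
proof -
  define D where "D z = (\<lambda>t. S (z + t *\<^sub>R y) - t * S y) ` {0..}" for z
  define S' where "S' z = Inf (D z)" for z
  have low: "- S (- z) \<le> S (z + t *\<^sub>R y) - t * S y" if "0 \<le> t" for z t
  proof -
    have "t * S y = S (t *\<^sub>R y)"
      using that sublinear_scale[OF S, of t y] sublinear_zero[OF S] by (cases "t = 0") auto
    also have "\<dots> \<le> S (z + t *\<^sub>R y) + S (- z)"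
      using sublinear_add[OF S, of "z + t *\<^sub>R y" "- z"] by simp
    finally show ?thesis by simp
  qed
  have bdd: "bdd_below (D z)" for z
    unfolding D_def by (rule bdd_belowI[where m = "- S (- z)"]) (auto intro!: low)
  have ne: "D z \<noteq> {}" for z by (auto simp: D_def)
  have le: "S' z \<le> S (z + t *\<^sub>R y) - t * S y" if "0 \<le> t" for z t
    unfolding S'_def using that by (intro cInf_lower[OF _ bdd]) (auto simp: D_def)
  have "sublinear S'"
    unfolding sublinear_def
  proof (intro conjI allI impI)
    fix u v
    have "S' (u + v) - (S (v + s *\<^sub>R y) - s * S y) \<le> S (u + t *\<^sub>R y) - t * S y"
      if "0 \<le> s" "0 \<le> t" for s t
    proof -
      have "S' (u + v) \<le> S ((u + v) + (t + s) *\<^sub>R y) - (t + s) * S y"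
        using that by (intro le) auto
      also have "(u + v) + (t + s) *\<^sub>R y = (u + t *\<^sub>R y) + (v + s *\<^sub>R y)"
        by (simp add: algebra_simps)
      finally show ?thesis
        using sublinear_add[OF S, of "u + t *\<^sub>R y" "v + s *\<^sub>R y"] by (simp add: algebra_simps)
    qed
    then have "S' (u + v) - (S (v + s *\<^sub>R y) - s * S y) \<le> S' u" if "0 \<le> s" for s
      unfolding S'_def[of u] using that by (intro cInf_greatest[OF ne]) (auto simp: D_def)
    then have "S' (u + v) - S' u \<le> S (v + s *\<^sub>R y) - s * S y" if "0 \<le> s" for s
      using that by fastforce
    then have "S' (u + v) - S' u \<le> S' v"
      unfolding S'_def[of v] by (intro cInf_greatest[OF ne]) (auto simp: D_def)
    then show "S' (u + v) \<le> S' u + S' v" by simp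
  next
    fix c :: real and z assume c: "0 < c"
    have "S' (c *\<^sub>R z) / c \<le> S (z + t *\<^sub>R y) - t * S y" if "0 \<le> t" for t
    proof -
      have "S' (c *\<^sub>R z) \<le> S (c *\<^sub>R z + (c * t) *\<^sub>R y) - (c * t) * S y"
        using c that by (intro le) auto
      also have "\<dots> = c * (S (z + t *\<^sub>R y) - t * S y)"
        using sublinear_scale[OF S c, of "z + t *\<^sub>R y"] by (simp add: algebra_simps)
      finally show ?thesis using c by (simp add: field_simps)
    qed
    then have "S' (c *\<^sub>R z) / c \<le> S' z"
      unfolding S'_def[of z] by (intro cInf_greatest[OF ne]) (auto simp: D_def)
    then show "S' (c *\<^sub>R z) \<le> c * S' z" using c by (simp add: field_simps)
  qed
  moreover have "S' \<le> S" using le[of 0] by (simp add: le_fun_def)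
  ultimately have "S' = S" by (rule min)
  then show ?thesis using le[of 1 x] by simp
qed

theorem hahn_banach:
  fixes S :: "'v::real_vector \<Rightarrow> real"
  assumes S: "sublinear S"
  shows "\<exists>\<Lambda>. linear \<Lambda> \<and> (\<forall>x. \<Lambda> x \<le> S x)"
proof -
  define A where "A = {R. sublinear R \<and> R \<le> S}"
  have low: "- S (- x) \<le> R x" if "R \<in> A" for R x
    using that sublinear_minus[of R x] by (auto simp: A_def le_fun_def intro: order_trans[rotated])
  have "\<exists>m\<in>A. \<forall>a\<in>A. m \<ge> a \<longrightarrow> a = m"
  proof (rule predicate_Zorn[where P = "\<lambda>R R'. R \<ge> R'"])
    show "partial_order_on A (relation_of (\<lambda>R R'. R \<ge> R') A)"
      by (rule partial_order_on_relation_ofI) auto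
  next
    fix C assume C: "C \<in> Chains (relation_of (\<lambda>R R'. R \<ge> R') A)"
    have CA: "C \<subseteq> A" using C by (auto simp: Chains_def relation_of_def)
    have tot: "R \<le> R' \<or> R' \<le> R" if "R \<in> C" "R' \<in> C" for R R'
      using C that by (auto simp: Chains_def relation_of_def)
    show "\<exists>u\<in>A. \<forall>a\<in>C. a \<ge> u"
    proof (cases "C = {}")
      case True then show ?thesis using S by (auto simp: A_def)
    next
      case False
      define u where "u x = (INF R\<in>C. R x)" for x
      have bdd: "bdd_below ((\<lambda>R. R x) ` C)" for x
        using low CA by (intro bdd_belowI2[where m = "- S (- x)"]) auto
      have le: "u x \<le> R x" if "R \<in> C" for R x
        unfolding u_def using that by (intro cINF_lower bdd)
      have "sublinear u" unfolding sublinear_def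
      proof (intro conjI allI impI)
        fix x y
        have "u (x + y) - R' y \<le> R x" if R: "R \<in> C" "R' \<in> C" for R R'
        proof -
          obtain Q where Q: "Q \<in> C" "Q \<le> R" "Q \<le> R'" using tot[OF R] R by blast
          have "u (x + y) \<le> Q x + Q y"
            using le[OF Q(1), of "x + y"] sublinear_add[of Q x y] Q(1) CA by (auto simp: A_def)
          with Q show ?thesis by (simp add: le_fun_def) (smt (verit, best))
        qed
        then have "u (x + y) - R' y \<le> u x" if "R' \<in> C" for R'
          unfolding u_def[of x] using that False by (intro cINF_greatest) auto
        then have "u (x + y) - u x \<le> R' y" if "R' \<in> C" for R'
          using that by (smt (verit, best))
        then have "u (x + y) - u x \<le> u y"
          unfolding u_def[of y] using False by (intro cINF_greatest) auto
        then show "u (x + y) \<le> u x + u y" by simp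
      next
        fix c :: real and x assume c: "0 < c"
        have "u (c *\<^sub>R x) / c \<le> R x" if "R \<in> C" for R
          using le[OF that, of "c *\<^sub>R x"] sublinear_scale[of R c x] that CA c
          by (auto simp: A_def field_simps)
        then have "u (c *\<^sub>R x) / c \<le> u x"
          unfolding u_def[of x] using False by (intro cINF_greatest) auto
        then show "u (c *\<^sub>R x) \<le> c * u x" using c by (simp add: field_simps)
      qed
      moreover have "u \<le> S"
      proof -
        obtain R where R: "R \<in> C" using False by auto
        then have "R \<le> S" using CA by (auto simp: A_def)
        then show ?thesis using le[OF R] by (meson le_funI le_funD order_trans)
      qed
      ultimately show ?thesis using le by (intro bexI[of _ u]) (auto simp: A_def le_fun_def)
    qed
  qed
  then obtain m where m: "sublinear m" "m \<le> S" and "\<And>R. sublinear R \<Longrightarrow> R \<le> S \<Longrightarrow> R \<le> m \<Longrightarrow> R = m"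
    by (auto simp: A_def)
  then have add: "m (x + y) = m x + m y" for x y
    using minimal_sublinear_superadditive[of m x y] sublinear_add[of m x y]
    by (meson antisym order_trans)
  have neg: "m (- x) = - m x" for x using add[of x "- x"] sublinear_zero[OF m(1)] by simp
  have "m (c *\<^sub>R x) = c * m x" for c x
  proof (cases "c > 0")
    case True then show ?thesis by (rule sublinear_scale[OF m(1)])
  next
    case False
    then show ?thesis
      using sublinear_scale[OF m(1), of "- c" x] neg[of "c *\<^sub>R x"] sublinear_zero[OF m(1)]
      by (cases "c = 0") auto
  qed
  then have "linear m" using add by (intro linearI) auto
  then show ?thesis using m(2) by (auto simp: le_fun_def)
qed

lemma hahn_banach_subspace:
  fixes S :: "'v::real_vector \<Rightarrow> real"
  assumes V: "subspace V"
    and add: "\<And>x y. x \<in> V \<Longrightarrow> y \<in> V \<Longrightarrow> S (x + y) \<le> S x + S y"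
    and scale: "\<And>c x. 0 < c \<Longrightarrow> x \<in> V \<Longrightarrow> S (c *\<^sub>R x) \<le> c * S x"
  shows "\<exists>\<Lambda>. linear \<Lambda> \<and> (\<forall>x\<in>V. \<Lambda> x \<le> S x)"
proof -
  obtain \<pi> where \<pi>: "range \<pi> \<subseteq> V" "linear \<pi>" "\<And>x. x \<in> V \<Longrightarrow> \<pi> x = x"
    using real_vector.linear_exists_left_inverse_on[OF linear_id V] by (auto simp: id_def)
  have "sublinear (S \<circ> \<pi>)"
    unfolding sublinear_def using \<pi>(1) by (auto simp: linear_add[OF \<pi>(2)] linear_scale[OF \<pi>(2)] intro!: add scale)
  from hahn_banach[OF this] show ?thesis using \<pi>(3) by (metis comp_apply)
qed

lemma norming_functional:
  fixes P :: "'x::real_normed_vector \<Rightarrow> 'x"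
  assumes P: "linear P" "\<And>x. norm (P x) \<le> norm x" and e: "P e = e" "norm e = 1"
  shows "\<exists>\<Lambda>. bounded_linear \<Lambda> \<and> \<Lambda> e = (1::real) \<and> (\<forall>x. \<bar>\<Lambda> x\<bar> \<le> norm (P x))"
proof -
  define D where "D x = range (\<lambda>t::real. norm (P x + t *\<^sub>R e) - t)" for x
  define S where "S x = Inf (D x)" for x
  have "- norm (P x) \<le> norm (P x + t *\<^sub>R e) - t" for x t
    using norm_triangle_ineq4[of "P x + t *\<^sub>R e" "P x"] e(2) by simp
  then have bdd: "bdd_below (D x)" for x unfolding D_def by (intro bdd_belowI[where m = "- norm (P x)"]) auto
  have ne: "D x \<noteq> {}" for x by (auto simp: D_def)
  have S_le: "S x \<le> norm (P x + t *\<^sub>R e) - t" for x t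
    unfolding S_def by (rule cInf_lower[OF _ bdd]) (auto simp: D_def)
  have "sublinear S" unfolding sublinear_def
  proof (intro conjI allI impI)
    fix x y
    have "S (x + y) - (norm (P y + s *\<^sub>R e) - s) \<le> norm (P x + t *\<^sub>R e) - t" for s t
    proof -
      have "S (x + y) \<le> norm (P (x + y) + (t + s) *\<^sub>R e) - (t + s)" by (rule S_le)
      also have "P (x + y) + (t + s) *\<^sub>R e = (P x + t *\<^sub>R e) + (P y + s *\<^sub>R e)"
        by (simp add: linear_add[OF P(1)] algebra_simps)
      finally show ?thesis using norm_triangle_ineq[of "P x + t *\<^sub>R e" "P y + s *\<^sub>R e"] by simp
    qed
    then have "S (x + y) - (norm (P y + s *\<^sub>R e) - s) \<le> S x" for s
      unfolding S_def[of x] by (intro cInf_greatest[OF ne]) (auto simp: D_def)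
    then have "S (x + y) - S x \<le> norm (P y + s *\<^sub>R e) - s" for s by (smt (verit, best))
    then have "S (x + y) - S x \<le> S y"
      unfolding S_def[of y] by (intro cInf_greatest[OF ne]) (auto simp: D_def)
    then show "S (x + y) \<le> S x + S y" by simp
  next
    fix c :: real and x assume c: "0 < c"
    have "S (c *\<^sub>R x) / c \<le> norm (P x + t *\<^sub>R e) - t" for t
    proof -
      have "P (c *\<^sub>R x) + (c * t) *\<^sub>R e = c *\<^sub>R (P x + t *\<^sub>R e)"
        by (simp add: linear_scale[OF P(1)] algebra_simps)
      then have "S (c *\<^sub>R x) \<le> c * norm (P x + t *\<^sub>R e) - c * t"
        using S_le[of "c *\<^sub>R x" "c * t"] c by simp
      then show ?thesis using c by (simp add: field_simps)
    qed
    then have "S (c *\<^sub>R x) / c \<le> S x"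
      unfolding S_def[of x] by (intro cInf_greatest[OF ne]) (auto simp: D_def)
    then show "S (c *\<^sub>R x) \<le> c * S x" using c by (simp add: field_simps)
  qed
  from hahn_banach[OF this] obtain \<Lambda> where \<Lambda>: "linear \<Lambda>" "\<And>x. \<Lambda> x \<le> S x" by blast
  have le: "\<Lambda> x \<le> norm (P x)" for x using \<Lambda>(2)[of x] S_le[of x 0] by simp
  have bound: "\<bar>\<Lambda> x\<bar> \<le> norm (P x)" for x
    using le[of x] le[of "- x"] by (simp add: linear_neg[OF \<Lambda>(1)] linear_neg[OF P(1)] abs_le_iff)
  have "\<Lambda> (- e) \<le> - 1" using \<Lambda>(2)[of "- e"] S_le[of "- e" 1] e by (simp add: linear_neg[OF P(1)])
  then have "\<Lambda> e = 1" using le[of e] e by (simp add: linear_neg[OF \<Lambda>(1)])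
  moreover have "bounded_linear \<Lambda>"
    using \<Lambda>(1) bound P(2) by (intro bounded_linear_intro[where K = 1])
      (auto simp: linear_add linear_scale intro: order_trans)
  ultimately show ?thesis using bound by blast
qed


section \<open>Delta-convexity\<close>

text \<open>
  If \<open>f = g - h\<close> with convex \<open>g\<close>, \<open>h\<close>, then the second differences of \<open>g + h\<close> dominate those of
  \<open>f\<close>, so from any node \<open>u\<close> one of the two steps \<open>u \<plusminus> v\<close> increases \<open>g + h\<close> by at least half
  of the second difference of \<open>f\<close>. Following these steps, a binary tree
  on which \<open>f\<close> has large second differences leads out of every ball on which \<open>g + h\<close> is bounded.
\<close>

lemma delta_convex_tree:
  fixes f :: "'x::banach \<Rightarrow> real"
  assumes "delta_convex f"
  shows "\<exists>\<rho>>0. \<forall>(N::nat) \<delta> P. (\<exists>u. P 0 u) \<and> (\<forall>k\<le>N. \<forall>u. P k u \<longrightarrow> norm u \<le> \<rho>) \<and>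
    (\<forall>k<N. \<forall>u. P k u \<longrightarrow>
      (\<exists>v. P (Suc k) (u + v) \<and> P (Suc k) (u - v) \<and> 2 * \<delta> \<le> \<bar>f (u + v) + f (u - v) - 2 * f u\<bar>))
    \<longrightarrow> real N * \<delta> \<le> 2"
proof -
  obtain g h where g: "convex_on UNIV g" "continuous_on UNIV g"
    and h: "convex_on UNIV h" "continuous_on UNIV h" and f: "\<And>x. f x = g x - h x"
    using assms unfolding delta_convex_def by auto
  define F where "F x = g x + h x" for x
  have mid: "2 * G u \<le> G (u + v) + G (u - v)" if "convex_on UNIV G" for G :: "'x \<Rightarrow> real" and u v
  proof -
    have "G ((1/2) *\<^sub>R (u + v) + (1/2) *\<^sub>R (u - v)) \<le> (1/2) * G (u + v) + (1/2) * G (u - v)"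
      using convex_onD[OF that, of "1/2" "u + v" "u - v"] by simp
    moreover have "(1/2) *\<^sub>R (u + v) + (1/2) *\<^sub>R (u - v) = u"
      by (simp add: scaleR_right_distrib scaleR_right_diff_distrib flip: scaleR_left_distrib)
    ultimately show ?thesis by simp
  qed
  have dom: "\<bar>f (u + v) + f (u - v) - 2 * f u\<bar> \<le> F (u + v) + F (u - v) - 2 * F u" for u v
    using mid[OF g(1), of u v] mid[OF h(1), of u v] unfolding f F_def abs_le_iff by argo
  have "continuous_on UNIV F" unfolding F_def by (intro continuous_intros g h)
  then have "isCont F 0" by (simp add: continuous_on_eq_continuous_at)
  then obtain d where d: "d > 0" "\<And>u. norm u < d \<Longrightarrow> \<bar>F u - F 0\<bar> < 1"
    unfolding continuous_at_eps_delta by (auto simp: dist_norm dest!: spec[of _ 1])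
  show ?thesis
  proof (intro exI[of _ "d/2"] conjI allI impI)
    show "d / 2 > 0" using d by simp
    fix N :: nat and \<delta> :: real and P :: "nat \<Rightarrow> 'x \<Rightarrow> bool"
    assume *: "(\<exists>u. P 0 u) \<and> (\<forall>k\<le>N. \<forall>u. P k u \<longrightarrow> norm u \<le> d / 2) \<and>
      (\<forall>k<N. \<forall>u. P k u \<longrightarrow>
        (\<exists>v. P (Suc k) (u + v) \<and> P (Suc k) (u - v) \<and> 2 * \<delta> \<le> \<bar>f (u + v) + f (u - v) - 2 * f u\<bar>))"
    have bd: "\<bar>F u - F 0\<bar> < 1" if "k \<le> N" "P k u" for k u
    proof -
      have "norm u \<le> d / 2" using * that by blast
      then show ?thesis using d by simp
    qed
    obtain u0 where u0: "P 0 u0" using * by blast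
    have "k \<le> N \<Longrightarrow> \<exists>u. P k u \<and> F u0 + real k * \<delta> \<le> F u" for k
    proof (induction k)
      case 0 show ?case using u0 by auto
    next
      case (Suc k)
      then obtain u where u: "P k u" "F u0 + real k * \<delta> \<le> F u" by auto
      have "k < N" using Suc.prems by simp
      with * u(1) obtain v where v: "P (Suc k) (u + v)" "P (Suc k) (u - v)"
        "2 * \<delta> \<le> \<bar>f (u + v) + f (u - v) - 2 * f u\<bar>" by blast
      have "2 * \<delta> \<le> F (u + v) + F (u - v) - 2 * F u" using v(3) dom[of u v] by linarith
      then have "F u + \<delta> \<le> F (u + v) \<or> F u + \<delta> \<le> F (u - v)" by linarith
      then have "F u0 + real (Suc k) * \<delta> \<le> F (u + v) \<or> F u0 + real (Suc k) * \<delta> \<le> F (u - v)"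
        using u(2) by (auto simp: algebra_simps)
      then show ?case using v(1,2) by blast
    qed
    from this[of N] obtain u where "P N u" "F u0 + real N * \<delta> \<le> F u" by auto
    then show "real N * \<delta> \<le> 2" using bd[of N u] bd[of 0 u0] u0 by auto
  qed
qed

lemma continuous_quadratic_form_continuous:
  "continuous_quadratic_form q \<Longrightarrow> continuous_on UNIV q"
  unfolding continuous_quadratic_form_def
  using bounded_bilinear.continuous_on[OF _ continuous_on_id continuous_on_id]
  by (metis (no_types, lifting) continuous_on_cong id_apply)

lemma nonneg_quadratic_form_convex:
  assumes "continuous_quadratic_form q" "\<forall>x. 0 \<le> q x"
  shows "convex_on UNIV q"
proof (rule convex_onI)
  obtain b where b: "bounded_bilinear b" "\<And>x. q x = b x x"
    using assms(1) unfolding continuous_quadratic_form_def by auto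
  interpret bounded_bilinear b by (rule b)
  fix t :: real and x y assume t: "0 < t" "t < 1"
  have "(1 - t) * q x + t * q y - q ((1 - t) *\<^sub>R x + t *\<^sub>R y) = t * (1 - t) * q (x - y)"
    unfolding b(2) by (simp add: add_left add_right diff_left diff_right scaleR_left scaleR_right algebra_simps)
  moreover have "0 \<le> t * (1 - t) * q (x - y)" using t assms(2) by simp
  ultimately show "q ((1 - t) *\<^sub>R x + t *\<^sub>R y) \<le> (1 - t) * q x + t * q y" by linarith
qed auto

lemma property_D_imp_property_dc: "property_D TYPE('x::banach) \<Longrightarrow> property_dc TYPE('x)"
  unfolding property_D_def property_dc_def delta_semidefinite_def delta_convex_def
  using nonneg_quadratic_form_convex continuous_quadratic_form_continuous by meson

lemma continuous_quadratic_form_C11: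
  fixes q :: "'x::banach \<Rightarrow> real"
  assumes "continuous_quadratic_form q"
  shows "C11 q"
proof -
  obtain b where b: "bounded_bilinear b" "\<And>x. q x = b x x"
    using assms unfolding continuous_quadratic_form_def by auto
  interpret bounded_bilinear b by (rule b)
  obtain K where K: "\<And>x y. norm (b x y) \<le> norm x * norm y * K" "K > 0" using pos_bounded by blast
  define D where "D x = Blinfun (\<lambda>h. b x h + b h x)" for x
  have D: "blinfun_apply (D x) = (\<lambda>h. b x h + b h x)" for x
    unfolding D_def by (intro bounded_linear_Blinfun_apply bounded_linear_add bounded_linear_right bounded_linear_left)
  have "(q has_derivative blinfun_apply (D x)) (at x)" for x
    unfolding D b(2)[abs_def] by (rule FDERIV[OF has_derivative_ident has_derivative_ident])
  moreover have "(2 * K)-lipschitz_on UNIV D"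
  proof (rule lipschitz_onI)
    fix x y
    show "dist (D x) (D y) \<le> 2 * K * dist x y"
      unfolding dist_norm
    proof (rule norm_blinfun_bound)
      fix h
      have "blinfun_apply (D x - D y) h = b (x - y) h + b h (x - y)"
        by (simp add: blinfun.diff_left D diff_left diff_right algebra_simps)
      then show "norm (blinfun_apply (D x - D y) h) \<le> 2 * K * norm (x - y) * norm h"
        using K(1)[of "x - y" h] K(1)[of h "x - y"] norm_triangle_ineq[of "b (x - y) h" "b h (x - y)"]
        by (simp add: algebra_simps)
    qed (use K in auto)
  qed (use K in auto)
  ultimately show ?thesis unfolding C11_def by blast
qed

lemma property_Cdc_imp_property_dc: "property_Cdc TYPE('x::banach) \<Longrightarrow> property_dc TYPE('x)"
  unfolding property_Cdc_def property_dc_def using continuous_quadratic_form_C11 by blast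

text \<open>
  The leftmost maximum of the difference between \<open>F\<close> and its chord would
  violate the midpoint inequality if it were positive.
\<close>

lemma midpoint_convex_imp_convex:
  fixes F :: "'x::real_normed_vector \<Rightarrow> real"
  assumes cont: "continuous_on UNIV F" and mid: "\<And>x h. 2 * F x \<le> F (x + h) + F (x - h)"
  shows "convex_on UNIV F"
proof (rule convex_onI)
  fix t :: real and x y :: 'x assume t: "0 < t" "t < 1"
  define \<phi> where "\<phi> s = F (x + s *\<^sub>R (y - x)) - F x - s * (F y - F x)" for s
  have cont\<phi>: "continuous_on {0..1} \<phi>" unfolding \<phi>_def
    by (intro continuous_intros continuous_on_compose2[OF cont]) auto
  have mid\<phi>: "2 * \<phi> s \<le> \<phi> (s + h) + \<phi> (s - h)" for s h
    using mid[of "x + s *\<^sub>R (y - x)" "h *\<^sub>R (y - x)"] by (simp add: \<phi>_def algebra_simps)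
  have ends: "\<phi> 0 = 0" "\<phi> 1 = 0" by (auto simp: \<phi>_def)
  obtain s0 where s0: "s0 \<in> {0..1}" "\<And>s. s \<in> {0..1} \<Longrightarrow> \<phi> s \<le> \<phi> s0"
    using continuous_attains_sup[OF _ _ cont\<phi>] by auto
  have "\<phi> s0 \<le> 0"
  proof (rule ccontr)
    assume pos: "\<not> \<phi> s0 \<le> 0"
    define S where "S = {s \<in> {0..1}. \<phi> s = \<phi> s0}"
    have "compact S" unfolding S_def
      using continuous_closedin_preimage_constant[OF cont\<phi>, of "\<phi> s0"]
      by (meson closedin_compact compact_Icc)
    moreover have "S \<noteq> {}" using s0 by (auto simp: S_def)
    ultimately obtain s1 where s1: "s1 \<in> S" "\<And>s. s \<in> S \<Longrightarrow> s1 \<le> s"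
      using compact_attains_inf[of S] by metis
    have "0 < s1" "s1 < 1" using s1(1) pos ends by (auto simp: S_def less_le)
    define h where "h = min s1 (1 - s1)"
    have h: "0 < h" "s1 - h \<in> {0..1}" "s1 + h \<in> {0..1}"
      using \<open>0 < s1\<close> \<open>s1 < 1\<close> by (auto simp: h_def)
    have "s1 - h \<notin> S" using s1(2)[of "s1 - h"] h(1) by auto
    then have "\<phi> (s1 - h) < \<phi> s0" using s0(2)[OF h(2)] h(2) by (auto simp: S_def)
    then show False
      using mid\<phi>[of s1 h] s0(2)[OF h(3)] s1(1) by (auto simp: S_def)
  qed
  then have "\<phi> t \<le> 0" using s0(2)[of t] t by auto
  then show "F ((1 - t) *\<^sub>R x + t *\<^sub>R y) \<le> (1 - t) * F x + t * F y"
    by (simp add: \<phi>_def algebra_simps)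
qed auto

lemma C11_second_difference:
  fixes f :: "'x::banach \<Rightarrow> real"
  assumes "C11 f"
  shows "\<exists>L\<ge>0. \<forall>x h. \<bar>f (x + h) + f (x - h) - 2 * f x\<bar> \<le> L * (norm h)\<^sup>2"
proof -
  obtain f' L where f': "\<And>x. (f has_derivative blinfun_apply (f' x)) (at x)"
    and L: "L-lipschitz_on UNIV f'" using assms unfolding C11_def by auto
  have L0: "0 \<le> L" using L by (rule lipschitz_on_nonneg)
  have "\<bar>f (x + h) + f (x - h) - 2 * f x\<bar> \<le> (2 * L) * (norm h)\<^sup>2" for x h
  proof -
    define \<phi> where "\<phi> s = f (x + s *\<^sub>R h) + f (x - s *\<^sub>R h)" for s
    define \<phi>' where "\<phi>' s = blinfun_apply (f' (x + s *\<^sub>R h)) h - blinfun_apply (f' (x - s *\<^sub>R h)) h" for s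
    have "(\<phi> has_derivative (\<lambda>t. t * \<phi>' s)) (at s)" for s
    proof -
      have "((\<lambda>s. x + s *\<^sub>R h) has_derivative (\<lambda>t. t *\<^sub>R h)) (at s)"
        "((\<lambda>s. x - s *\<^sub>R h) has_derivative (\<lambda>t. - (t *\<^sub>R h))) (at s)"
        by (auto intro!: derivative_eq_intros)
      note has_derivative_add[OF has_derivative_compose[OF this(1) f'] has_derivative_compose[OF this(2) f']]
      moreover have "(\<lambda>t. blinfun_apply (f' (x + s *\<^sub>R h)) (t *\<^sub>R h) + blinfun_apply (f' (x - s *\<^sub>R h)) (- (t *\<^sub>R h)))
        = (\<lambda>t. t * \<phi>' s)"
        by (rule ext) (simp add: \<phi>'_def blinfun.scaleR_right blinfun.minus_right right_diff_distrib)
      ultimately show ?thesis unfolding \<phi>_def by (simp only:)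
    qed
    then have "DERIV \<phi> s :> \<phi>' s" for s by (simp add: has_field_derivative_def mult_commute_abs)
    from MVT2[of 0 1 \<phi> \<phi>', OF _ this] obtain s where s: "0 < s" "s < 1" "\<phi> 1 - \<phi> 0 = \<phi>' s" by auto
    have "\<bar>\<phi>' s\<bar> = norm (blinfun_apply (f' (x + s *\<^sub>R h) - f' (x - s *\<^sub>R h)) h)"
      by (simp add: \<phi>'_def blinfun.diff_left)
    also have "\<dots> \<le> norm (f' (x + s *\<^sub>R h) - f' (x - s *\<^sub>R h)) * norm h" by (rule norm_blinfun)
    also have "\<dots> \<le> (L * dist (x + s *\<^sub>R h) (x - s *\<^sub>R h)) * norm h"
      using lipschitz_onD[OF L, of "x + s *\<^sub>R h" "x - s *\<^sub>R h"]
      by (intro mult_right_mono) (auto simp: dist_norm)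
    also have "dist (x + s *\<^sub>R h) (x - s *\<^sub>R h) = 2 * s * norm h"
    proof -
      have "(x + s *\<^sub>R h) - (x - s *\<^sub>R h) = (2 * s) *\<^sub>R h"
        using scaleR_left_distrib[of s s h] by simp
      then show ?thesis using s by (simp add: dist_norm)
    qed
    also have "L * (2 * s * norm h) * norm h \<le> L * (2 * 1 * norm h) * norm h"
      using s L0 by (intro mult_right_mono mult_left_mono) auto
    finally show ?thesis using s(3) by (simp add: \<phi>_def power2_eq_square algebra_simps)
  qed
  then show ?thesis using L0 by (intro exI[of _ "2 * L"]) auto
qed

text \<open>
  Under a quadratic lower bound on the modulus of convexity, adding a large multiple of the
  squared norm makes every \<open>C\<^sup>1\<^sup>,\<^sup>1\<close> function convex.
\<close>

lemma property_Cdc_if_two_convex: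
  assumes c: "c > 0"
    and conv: "\<And>x y :: 'x::banach. 2 * (norm x)\<^sup>2 + c * (norm y)\<^sup>2 \<le> (norm (x + y))\<^sup>2 + (norm (x - y))\<^sup>2"
  shows "property_Cdc TYPE('x)"
  unfolding property_Cdc_def
proof (intro allI impI)
  fix f :: "'x \<Rightarrow> real" assume C: "C11 f"
  obtain L where L: "L \<ge> 0" "\<And>x h. \<bar>f (x + h) + f (x - h) - 2 * f x\<bar> \<le> L * (norm h)\<^sup>2"
    using C11_second_difference[OF C] by blast
  have "continuous_on UNIV f"
    using C unfolding C11_def by (meson continuous_at_imp_continuous_on has_derivative_continuous)
  then have cont: "continuous_on UNIV (\<lambda>x. f x + (L/c) * (norm x)\<^sup>2)"
    "continuous_on UNIV (\<lambda>x :: 'x. (L/c) * (norm x)\<^sup>2)"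
    by (intro continuous_intros; assumption)+
  have n: "2 * ((L/c) * (norm x)\<^sup>2) + L * (norm h)\<^sup>2
      \<le> (L/c) * (norm (x + h))\<^sup>2 + (L/c) * (norm (x - h))\<^sup>2" for x h :: 'x
    using mult_left_mono[OF conv[of x h], of "L/c"] c L(1) by (simp add: algebra_simps)
  have "convex_on UNIV (\<lambda>x. f x + (L/c) * (norm x)\<^sup>2)"
  proof (rule midpoint_convex_imp_convex[OF cont(1)])
    fix x h
    show "2 * (f x + (L/c) * (norm x)\<^sup>2) \<le> f (x + h) + (L/c) * (norm (x + h))\<^sup>2 + (f (x - h) + (L/c) * (norm (x - h))\<^sup>2)"
      using n[of x h] abs_le_D2[OF L(2)[of x h]] by argo
  qed
  moreover have "convex_on UNIV (\<lambda>x :: 'x. (L/c) * (norm x)\<^sup>2)"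
  proof (rule midpoint_convex_imp_convex[OF cont(2)])
    fix x h :: 'x
    have "0 \<le> L * (norm h)\<^sup>2" using L(1) by simp
    then show "2 * ((L/c) * (norm x)\<^sup>2) \<le> (L/c) * (norm (x + h))\<^sup>2 + (L/c) * (norm (x - h))\<^sup>2"
      using n[of x h] by linarith
  qed
  ultimately show "delta_convex f"
    unfolding delta_convex_def using cont
    by (intro exI[of _ "\<lambda>x. f x + (L/c) * (norm x)\<^sup>2"] exI[of _ "\<lambda>x. (L/c) * (norm x)\<^sup>2"]) auto
qed

section \<open>Gluing along blocks of coordinates\<close>

text \<open>
  The counterexamples are sums \<open>\<Sum>k. 2\<^sup>-\<^sup>k f\<^sub>k\<close> in which \<open>f\<^sub>k\<close> depends on
  the \<open>k\<close>-th block of coordinates only. Restricted to the span of the vectors of one block, such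
  a sum equals \<open>2\<^sup>-\<^sup>k f\<^sub>k\<close> up to a constant, and it
  suffices that the \<open>f\<^sub>k\<close> become worse than \<open>2\<^sup>k\<close> can compensate.
\<close>

locale block_coordinates =
  fixes e :: "nat \<Rightarrow> nat \<Rightarrow> 'x::banach" and \<xi> :: "nat \<Rightarrow> nat \<Rightarrow> 'x \<Rightarrow> real"
  assumes linear_\<xi>: "bounded_linear (\<xi> k i)"
    and \<xi>_e: "\<xi> k i (e l j) = (if k = l \<and> i = j then 1 else 0)"
    and norm_\<xi>: "\<bar>\<xi> k i x\<bar> \<le> norm x"
    and norm_e: "norm (e k i) \<le> 1"
begin

lemma glue_forms:
  fixes u :: "nat \<Rightarrow> nat \<Rightarrow> nat \<Rightarrow> real" and n :: "nat \<Rightarrow> nat"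
  assumes bound: "\<And>k x y. \<bar>\<Sum>i<n k. \<Sum>j<n k. u k i j * \<xi> k i x * \<xi> k j y\<bar> \<le> norm x * norm y"
  shows "\<exists>b. bounded_bilinear b \<and> (\<forall>k. \<forall>i<n k. \<forall>j<n k. b (e k i) (e k j) = (1/2) ^ k * u k i j)"
proof -
  define B where "B k x y = (1/2) ^ k * (\<Sum>i<n k. \<Sum>j<n k. u k i j * \<xi> k i x * \<xi> k j y)" for k x y
  define b where "b x y = (\<Sum>k. B k x y)" for x y
  have geo: "summable (\<lambda>k. (1/2) ^ k * c)" "(\<Sum>k. (1/2) ^ k * c) = 2 * c" for c :: real
    using summable_mult2[of "\<lambda>k. (1/2) ^ k" c] suminf_mult2[of "\<lambda>k. (1/2) ^ k" c]
    by (auto simp: suminf_geometric)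
  have Bb: "norm (B k x y) \<le> (1/2) ^ k * (norm x * norm y)" for k x y
    unfolding B_def using bound[of k x y] by (simp add: abs_mult mult_left_mono)
  have sB: "summable (\<lambda>k. B k x y)" and snB: "summable (\<lambda>k. norm (B k x y))" for x y
    using summable_comparison_test'[OF geo(1)[of "norm x * norm y"], of 0 "\<lambda>k. B k x y"]
      summable_comparison_test'[OF geo(1)[of "norm x * norm y"], of 0 "\<lambda>k. norm (B k x y)"] Bb by auto
  have B_add: "B k (x + x') y = B k x y + B k x' y" "B k x (y + y') = B k x y + B k x y'" for k x x' y y'
    unfolding B_def
    by (simp_all add: linear_simps(1)[OF linear_\<xi>] algebra_simps sum.distrib)
  have B_scale: "B k (c *\<^sub>R x) y = c * B k x y" "B k x (c *\<^sub>R y) = c * B k x y" for k c x y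
    unfolding B_def
    by (simp_all add: linear_simps(5)[OF linear_\<xi>] sum_distrib_left mult_ac)
  have "bounded_bilinear b"
  proof (rule bounded_bilinear.intro)
    show "\<exists>K. \<forall>x y. norm (b x y) \<le> norm x * norm y * K"
    proof (intro exI[of _ 2] allI)
      fix x y
      have "norm (b x y) \<le> (\<Sum>k. norm (B k x y))" unfolding b_def by (rule summable_norm[OF snB])
      also have "\<dots> \<le> (\<Sum>k. (1/2) ^ k * (norm x * norm y))" by (intro suminf_le Bb snB geo)
      finally show "norm (b x y) \<le> norm x * norm y * 2" by (simp add: geo)
    qed
  qed (auto simp: b_def B_add B_scale suminf_add[OF sB sB] suminf_mult[OF sB])
  moreover have "b (e k i) (e k j) = (1/2) ^ k * u k i j" if "i < n k" "j < n k" for k i j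
  proof -
    have "B l (e k i) (e k j) = (if l = k then (1/2) ^ k * u k i j else 0)" for l
    proof -
      have "u l i' j' * \<xi> l i' (e k i) * \<xi> l j' (e k j)
          = (if j' = j then if i' = i then if l = k then u k i j else 0 else 0 else 0)" for i' j'
        by (auto simp: \<xi>_e)
      then show ?thesis using that by (cases "l = k") (auto simp: B_def intro!: sum.neutral)
    qed
    then show ?thesis
      unfolding b_def using sums_unique[OF sums_single[of k "\<lambda>_. (1/2) ^ k * u k i j"]] by simp
  qed
  ultimately show ?thesis by blast
qed

end

section \<open>A quadratic form on $\ell_1$ that is not delta-convex\<close>

text \<open>
  Consider the natural numbers as the leaves of a binary tree, in which the branches of \<open>i\<close> and \<open>j\<close> meet
  at the height \<open>h\<close>. The kernel depends only on \<open>h\<close>, and its values are the ones for which the form is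
  \<open>tree_value h\<close> at the average of the unit vectors below any vertex of height \<open>h\<close>: the
  average of the values of the kernel on two sibling blocks and across them is
  \<open>(tree_value (h - 1) + (2 tree_value h - tree_value (h - 1))) / 2 = tree_value h\<close>. As \<open>tree_value\<close> alternates, the
  averages below the two children of a vertex differ by \<open>2 v\<close> with the form equal to \<open>\<plusminus>1\<close> at \<open>v\<close>,
  although all averages lie in the unit ball of \<open>\<ell>\<^sub>1\<close> and the kernel is bounded.
\<close>

definition tree_value :: "nat \<Rightarrow> real" where
  "tree_value h = (if even h then 1 else 0)"

definition tree_kernel :: "nat \<Rightarrow> nat \<Rightarrow> real" where
  "tree_kernel i j = (let h = (LEAST h. i div 2 ^ h = j div 2 ^ h) in
     if h = 0 then 1 else 2 * tree_value h - tree_value (h - 1))"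

lemma tree_kernel_bound: "\<bar>tree_kernel i j\<bar> \<le> 2"
  by (simp add: tree_kernel_def tree_value_def Let_def)

lemma tree_kernel_commute: "tree_kernel i j = tree_kernel j i"
proof -
  have "(\<lambda>h. i div 2 ^ h = j div 2 ^ h) = (\<lambda>h. j div 2 ^ h = i div 2 ^ h)" by auto
  then show ?thesis by (simp add: tree_kernel_def)
qed

lemma tree_kernel_refl: "tree_kernel i i = 1"
  by (simp add: tree_kernel_def)

lemma tree_kernel_siblings:
  assumes "i < 2 ^ h" "j < 2 ^ h"
  shows "tree_kernel (2 ^ Suc h * c + i) (2 ^ Suc h * c + 2 ^ h + j)
    = 2 * tree_value (Suc h) - tree_value h"
proof -
  define a b where "a = 2 ^ Suc h * c + i" and "b = 2 ^ Suc h * c + 2 ^ h + j"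
  have eq: "a = 2 ^ h * (2 * c) + i" "b = 2 ^ h * (2 * c + 1) + j"
    by (auto simp: a_def b_def algebra_simps)
  have "(2 ^ h * m + l) div 2 ^ h = m" if "l < 2 ^ h" for m l :: nat
    using that by simp
  then have ab: "a div 2 ^ h = 2 * c" "b div 2 ^ h = 2 * c + 1"
    unfolding eq using assms by blast+
  have "(LEAST l. a div 2 ^ l = b div 2 ^ l) = Suc h"
  proof (rule Least_equality)
    have "2 ^ Suc h = 2 ^ h * (2::nat)" by simp
    then show "a div 2 ^ Suc h = b div 2 ^ Suc h" by (simp only: div_mult2_eq ab) simp
  next
    fix l assume l: "a div 2 ^ l = b div 2 ^ l"
    show "Suc h \<le> l"
    proof (rule ccontr)
      assume "\<not> Suc h \<le> l"
      then have "2 ^ h = 2 ^ l * (2::nat) ^ (h - l)" by (simp flip: power_add)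
      then have "a div 2 ^ h = b div 2 ^ h" by (simp only: div_mult2_eq l)
      then show False using ab by simp
    qed
  qed
  then show ?thesis unfolding tree_kernel_def a_def[symmetric] b_def[symmetric] by simp
qed

lemma sum_lessThan_power2_Suc:
  fixes f :: "nat \<Rightarrow> 'b::comm_monoid_add"
  shows "(\<Sum>t<2 ^ Suc n. f t) = (\<Sum>t<2 ^ n. f t) + (\<Sum>t<2 ^ n. f (2 ^ n + t))"
proof -
  have "(\<Sum>t = 0..<2 ^ n. f t) + (\<Sum>t = 2 ^ n..<2 ^ n + 2 ^ n. f t) = (\<Sum>t = 0..<2 ^ Suc n. f t)"
    by (subst sum.atLeastLessThan_concat) (auto simp: mult_2)
  moreover have "(\<Sum>t = 2 ^ n..<2 ^ n + 2 ^ n. f t) = (\<Sum>t = 0..<2 ^ n. f (2 ^ n + t))"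
    using sum.shift_bounds_nat_ivl[of f 0 "2 ^ n" "2 ^ n"] by (simp add: add.commute)
  ultimately show ?thesis by (simp add: lessThan_atLeast0)
qed

definition dyadic_mean :: "(nat \<Rightarrow> 'x::real_vector) \<Rightarrow> nat \<Rightarrow> nat \<Rightarrow> 'x" where
  "dyadic_mean e h a = (1/2) ^ h *\<^sub>R (\<Sum>t<2 ^ h. e (a + t))"

lemma dyadic_mean_Suc:
  "dyadic_mean e (Suc h) a = (1/2) *\<^sub>R (dyadic_mean e h a + dyadic_mean e h (a + 2 ^ h))"
  by (simp add: dyadic_mean_def sum_lessThan_power2_Suc scaleR_right_distrib add.assoc del: power_Suc)
    simp

lemma norm_dyadic_mean:
  assumes "\<And>i. norm (e i) \<le> 1"
  shows "norm (dyadic_mean e h a) \<le> 1"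
proof -
  have "norm (\<Sum>t<2 ^ h. e (a + t)) \<le> (\<Sum>t<(2::nat) ^ h. 1)"
    by (intro sum_norm_le assms)
  then show ?thesis by (simp add: dyadic_mean_def field_simps)
qed

context
  fixes b :: "'x::real_normed_vector \<Rightarrow> 'x \<Rightarrow> real" and e :: "nat \<Rightarrow> 'x" and w :: real and N :: nat
  assumes b: "bounded_bilinear b"
    and b_e: "\<And>i j. i < 2 ^ N \<Longrightarrow> j < 2 ^ N \<Longrightarrow> b (e i) (e j) = w * tree_kernel i j"
begin

interpretation bounded_bilinear b by (rule b)

lemma form_dyadic_siblings:
  assumes "2 ^ Suc h * c + 2 ^ Suc h \<le> 2 ^ N"
  defines "a \<equiv> 2 ^ Suc h * c"
  shows "b (dyadic_mean e h a) (dyadic_mean e h (a + 2 ^ h)) = w * (2 * tree_value (Suc h) - tree_value h)"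
    "b (dyadic_mean e h (a + 2 ^ h)) (dyadic_mean e h a) = w * (2 * tree_value (Suc h) - tree_value h)"
proof -
  have "b (e (a + i)) (e (a + 2 ^ h + j)) = w * (2 * tree_value (Suc h) - tree_value h)"
    "b (e (a + 2 ^ h + j)) (e (a + i)) = w * (2 * tree_value (Suc h) - tree_value h)"
    if "i < 2 ^ h" "j < 2 ^ h" for i j
    using that assms(1) tree_kernel_siblings[OF that, of c] tree_kernel_commute[of "a + 2 ^ h + j"]
    by (subst b_e; simp add: a_def)+
  then show "b (dyadic_mean e h a) (dyadic_mean e h (a + 2 ^ h)) = w * (2 * tree_value (Suc h) - tree_value h)"
    "b (dyadic_mean e h (a + 2 ^ h)) (dyadic_mean e h a) = w * (2 * tree_value (Suc h) - tree_value h)"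
    by (simp_all add: dyadic_mean_def scaleR_left scaleR_right sum_left sum_right power_one_over)
qed

lemma form_dyadic_mean:
  "2 ^ h * c + 2 ^ h \<le> 2 ^ N \<Longrightarrow> b (dyadic_mean e h (2 ^ h * c)) (dyadic_mean e h (2 ^ h * c)) = w * tree_value h"
proof (induction h arbitrary: c)
  case 0
  then show ?case by (simp add: dyadic_mean_def b_e tree_kernel_refl tree_value_def)
next
  case (Suc h)
  have *: "2 ^ h * (2 * c) + 2 ^ h \<le> (2::nat) ^ N" "2 ^ h * (2 * c + 1) + 2 ^ h \<le> (2::nat) ^ N"
    using Suc.prems by (auto simp: algebra_simps)
  have "2 ^ Suc h * c = 2 ^ h * (2 * c)" "2 ^ Suc h * c + 2 ^ h = 2 ^ h * (2 * c + 1)"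
    by (auto simp: algebra_simps)
  with Suc.IH[OF *(1)] Suc.IH[OF *(2)] form_dyadic_siblings[OF Suc.prems]
  show ?case
    by (simp add: dyadic_mean_Suc[of e h] add_left add_right scaleR_left scaleR_right) (simp add: field_simps)
qed

lemma form_dyadic_difference:
  assumes "2 ^ Suc h * c + 2 ^ Suc h \<le> 2 ^ N"
  defines "a \<equiv> 2 ^ Suc h * c"
  defines "v \<equiv> (1/2) *\<^sub>R (dyadic_mean e h a - dyadic_mean e h (a + 2 ^ h))"
  shows "\<bar>b v v\<bar> = \<bar>w\<bar>"
proof -
  have *: "2 ^ h * (2 * c) + 2 ^ h \<le> (2::nat) ^ N" "2 ^ h * (2 * c + 1) + 2 ^ h \<le> (2::nat) ^ N"
    using assms(1) by (auto simp: algebra_simps)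
  have "a = 2 ^ h * (2 * c)" "a + 2 ^ h = 2 ^ h * (2 * c + 1)"
    by (auto simp: a_def algebra_simps)
  with form_dyadic_mean[OF *(1)] form_dyadic_mean[OF *(2)] form_dyadic_siblings[OF assms(1)]
  have "b v v = w * (tree_value h - tree_value (Suc h))"
    unfolding v_def a_def
    by (simp add: diff_left diff_right scaleR_left scaleR_right) (simp add: field_simps)
  then show ?thesis by (simp add: tree_value_def abs_mult)
qed

end

text \<open>
  A block of depth \<open>4\<^sup>k\<close> with weight \<open>2\<^sup>-\<^sup>k\<close> has a tree of radius \<open>\<rho>\<close> along whose branches the second differences
  sum up to a multiple of \<open>2\<^sup>k \<rho>\<^sup>2\<close>.
\<close>

theorem (in block_coordinates) not_property_dc:
  assumes sum: "\<And>k n x. (\<Sum>i<n. \<bar>\<xi> k i x\<bar>) \<le> norm x"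
  shows "\<not> property_dc TYPE('x)"
proof
  assume dc: "property_dc TYPE('x)"
  define N :: "nat \<Rightarrow> nat" where "N k = 4 ^ k" for k
  (* The kernel is bounded by 2; half of it gives a form of norm at most 1. *)
  define u :: "nat \<Rightarrow> nat \<Rightarrow> nat \<Rightarrow> real" where "u k i j = tree_kernel i j / 2" for k i j
  have "\<bar>\<Sum>i<n. \<Sum>j<n. u k i j * \<xi> k i x * \<xi> k j y\<bar> \<le> norm x * norm y" for n k x y
  proof -
    have "\<bar>\<Sum>i<n. \<Sum>j<n. u k i j * \<xi> k i x * \<xi> k j y\<bar> \<le> (\<Sum>i<n. \<Sum>j<n. \<bar>u k i j * \<xi> k i x * \<xi> k j y\<bar>)"
      by (intro order_trans[OF sum_abs] sum_mono) auto
    also have "\<dots> \<le> (\<Sum>i<n. \<Sum>j<n. \<bar>\<xi> k i x\<bar> * \<bar>\<xi> k j y\<bar>)"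
    proof (intro sum_mono)
      fix i j
      have "\<bar>u k i j\<bar> * (\<bar>\<xi> k i x\<bar> * \<bar>\<xi> k j y\<bar>) \<le> 1 * (\<bar>\<xi> k i x\<bar> * \<bar>\<xi> k j y\<bar>)"
        using tree_kernel_bound[of i j] by (intro mult_right_mono) (auto simp: u_def)
      then show "\<bar>u k i j * \<xi> k i x * \<xi> k j y\<bar> \<le> \<bar>\<xi> k i x\<bar> * \<bar>\<xi> k j y\<bar>" by (simp add: abs_mult mult.assoc)
    qed
    also have "\<dots> = (\<Sum>i<n. \<bar>\<xi> k i x\<bar>) * (\<Sum>j<n. \<bar>\<xi> k j y\<bar>)" by (simp add: sum_product)
    also have "\<dots> \<le> norm x * norm y" by (intro mult_mono sum sum_nonneg) auto
    finally show ?thesis .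
  qed
  from glue_forms[where u = u and n = "\<lambda>k. 2 ^ N k", OF this] obtain b where b: "bounded_bilinear b"
    and b_e: "\<And>k i j. i < 2 ^ N k \<Longrightarrow> j < 2 ^ N k \<Longrightarrow> b (e k i) (e k j) = (1/2) ^ k * u k i j" by blast
  interpret b: bounded_bilinear b by (rule b)
  have "delta_convex (\<lambda>x. b x x)"
    using dc b unfolding property_dc_def continuous_quadratic_form_def by (metis (no_types, lifting))
  from delta_convex_tree[OF this] obtain \<rho> where \<rho>: "\<rho> > 0" and tree:
    "\<And>(N::nat) \<delta> P. \<exists>u. P 0 u \<Longrightarrow> (\<And>k u. k \<le> N \<Longrightarrow> P k u \<Longrightarrow> norm u \<le> \<rho>) \<Longrightarrow>
      (\<And>k u. k < N \<Longrightarrow> P k u \<Longrightarrow>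
        \<exists>v. P (Suc k) (u + v) \<and> P (Suc k) (u - v) \<and>
            2 * \<delta> \<le> \<bar>b (u + v) (u + v) + b (u - v) (u - v) - 2 * b u u\<bar>)
    \<Longrightarrow> real N * \<delta> \<le> 2" by metis
  have "real (N k) * ((1/2) ^ k / 2 * \<rho>\<^sup>2) \<le> 2" for k
  proof (rule tree)
    let ?P = "\<lambda>l u. \<exists>c. 2 ^ (N k - l) * c + 2 ^ (N k - l) \<le> (2::nat) ^ N k \<and>
      u = \<rho> *\<^sub>R dyadic_mean (e k) (N k - l) (2 ^ (N k - l) * c)"
    show "\<exists>u. ?P 0 u" by (intro exI[of _ 0] exI) auto
    show "norm u \<le> \<rho>" if "?P l u" for l u
    proof -
      from that obtain a where "u = \<rho> *\<^sub>R dyadic_mean (e k) (N k - l) a" by blast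
      then show ?thesis
        using norm_dyadic_mean[of "e k" "N k - l" a, OF norm_e] \<rho> by simp
    qed
    fix l u assume l: "l < N k" and "?P l u"
    then obtain c where c: "2 ^ (N k - l) * c + 2 ^ (N k - l) \<le> (2::nat) ^ N k"
      and u: "u = \<rho> *\<^sub>R dyadic_mean (e k) (N k - l) (2 ^ (N k - l) * c)" by blast
    define h where "h = N k - Suc l"
    have h: "N k - l = Suc h" using l by (simp add: h_def)
    define a where "a = 2 ^ Suc h * c"
    define v where "v = (1/2) *\<^sub>R (dyadic_mean (e k) h a - dyadic_mean (e k) h (a + 2 ^ h))"
    have "\<bar>b v v\<bar> = \<bar>(1/2) ^ k / 2\<bar>"
      unfolding v_def a_def using c b_e[of _ k]
      by (intro form_dyadic_difference[OF b, of "N k"]) (auto simp: h u_def)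
    then have bv: "\<bar>b v v\<bar> = (1/2) ^ k / 2" by simp
    have half: "(1/2) *\<^sub>R (x + y) + (1/2) *\<^sub>R (x - y) = x" "(1/2) *\<^sub>R (x + y) - (1/2) *\<^sub>R (x - y) = y" for x y :: 'x
      by (simp_all add: scaleR_right_distrib scaleR_right_diff_distrib flip: scaleR_left_distrib)
    have uv: "u + \<rho> *\<^sub>R v = \<rho> *\<^sub>R dyadic_mean (e k) h a"
      "u - \<rho> *\<^sub>R v = \<rho> *\<^sub>R dyadic_mean (e k) h (a + 2 ^ h)"
      unfolding u h dyadic_mean_Suc v_def a_def[symmetric]
      by (simp_all only: half scaleR_right_distrib[of \<rho>, symmetric] scaleR_right_diff_distrib[of \<rho>, symmetric])
    show "\<exists>v. ?P (Suc l) (u + v) \<and> ?P (Suc l) (u - v) \<and>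
      2 * ((1/2) ^ k / 2 * \<rho>\<^sup>2) \<le> \<bar>b (u + v) (u + v) + b (u - v) (u - v) - 2 * b u u\<bar>"
    proof (intro exI[of _ "\<rho> *\<^sub>R v"] conjI)
      show "?P (Suc l) (u + \<rho> *\<^sub>R v)"
        using c h uv(1) by (intro exI[of _ "2 * c"]) (auto simp: h_def[symmetric] a_def mult_ac)
      show "?P (Suc l) (u - \<rho> *\<^sub>R v)"
        using c h uv(2) by (intro exI[of _ "2 * c + 1"]) (auto simp: h_def[symmetric] a_def algebra_simps)
      have "b (u + \<rho> *\<^sub>R v) (u + \<rho> *\<^sub>R v) + b (u - \<rho> *\<^sub>R v) (u - \<rho> *\<^sub>R v) - 2 * b u u = 2 * \<rho>\<^sup>2 * b v v"
        by (simp add: b.add_left b.add_right b.diff_left b.diff_right b.scaleR_left b.scaleR_right power2_eq_square)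
          (simp add: algebra_simps)
      then show "2 * ((1/2) ^ k / 2 * \<rho>\<^sup>2)
          \<le> \<bar>b (u + \<rho> *\<^sub>R v) (u + \<rho> *\<^sub>R v) + b (u - \<rho> *\<^sub>R v) (u - \<rho> *\<^sub>R v) - 2 * b u u\<bar>"
        by (simp add: abs_mult bv)
    qed
  qed
  moreover have "(4::real) ^ k = 2 ^ k * 2 ^ k" for k
    by (simp flip: power_mult_distrib)
  ultimately have "2 ^ k \<le> 4 / \<rho>\<^sup>2" for k :: nat
    using \<rho> by (simp add: N_def field_simps)
  then show False
    using real_arch_pow[of 2 "4 / \<rho>\<^sup>2"] by (meson less_le_not_le one_less_numeral_iff semiring_norm(76))
qed

section \<open>Hadamard matrices and forms that are not delta-semidefinite\<close>

text \<open>Sylvester's construction: \<open>H (n + 1)\<close> has the blocks \<open>H n\<close>, \<open>H n\<close>, \<open>H n\<close> and \<open>- H n\<close>.\<close>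

fun hadamard :: "nat \<Rightarrow> nat \<Rightarrow> nat \<Rightarrow> real" where
  "hadamard 0 i j = 1"
| "hadamard (Suc n) i j =
    hadamard n (i mod 2 ^ n) (j mod 2 ^ n) * (if 2 ^ n \<le> i \<and> 2 ^ n \<le> j then - 1 else 1)"

lemma abs_hadamard: "\<bar>hadamard n i j\<bar> = 1"
  by (induction n arbitrary: i j) (auto simp: abs_mult)

lemma hadamard_commute: "hadamard n i j = hadamard n j i"
  by (induction n arbitrary: i j) auto

lemma hadamard_orthogonal:
  "j < 2 ^ n \<Longrightarrow> k < 2 ^ n \<Longrightarrow>
    (\<Sum>i<2 ^ n. hadamard n i j * hadamard n i k) = (if j = k then 2 ^ n else 0)"
proof (induction n arbitrary: j k)
  case (Suc n)
  define \<sigma> where "\<sigma> j = (if 2 ^ n \<le> j then - 1 else 1 :: real)" for j :: nat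
  define j' k' where "j' = j mod 2 ^ n" and "k' = k mod 2 ^ n"
  have "(\<Sum>i<2 ^ Suc n. hadamard (Suc n) i j * hadamard (Suc n) i k)
      = (\<Sum>i<2 ^ n. hadamard n i j' * hadamard n i k')
      + (\<Sum>i<2 ^ n. hadamard n i j' * hadamard n i k' * (\<sigma> j * \<sigma> k))"
    unfolding sum_lessThan_power2_Suc
    by (intro arg_cong2[where f = "(+)"] sum.cong) (auto simp: j'_def k'_def \<sigma>_def)
  also have "\<dots> = (\<Sum>i<2 ^ n. hadamard n i j' * hadamard n i k') * (1 + \<sigma> j * \<sigma> k)"
    by (simp add: distrib_left sum_distrib_right)
  also have "\<dots> = (if j' = k' then 2 ^ n else 0) * (1 + \<sigma> j * \<sigma> k)"
    by (subst Suc.IH) (auto simp: j'_def k'_def)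
  also have "\<dots> = (if j = k then 2 ^ Suc n else 0)"
  proof (cases "j' = k'")
    case True
    have dec: "l = (if 2 ^ n \<le> l then 2 ^ n + l mod 2 ^ n else l mod 2 ^ n)" if "l < 2 ^ Suc n" for l :: nat
      using that by (auto simp: le_mod_geq)
    show ?thesis using True dec[OF Suc.prems(1)] dec[OF Suc.prems(2)]
      by (auto simp: j'_def k'_def \<sigma>_def split: if_splits)
  next
    case False then show ?thesis by (auto simp: j'_def k'_def)
  qed
  finally show ?case .
qed simp

lemma hadamard_parseval:
  assumes "bounded_bilinear (B :: 'v::real_normed_vector \<Rightarrow> 'v \<Rightarrow> real)"
  shows "(\<Sum>i<2 ^ n. B (\<Sum>j<2 ^ n. hadamard n i j *\<^sub>R f j) (\<Sum>j<2 ^ n. hadamard n i j *\<^sub>R f j))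
    = 2 ^ n * (\<Sum>j<2 ^ n. B (f j) (f j))"
proof -
  interpret bounded_bilinear B by fact
  have "(\<Sum>i<2 ^ n. B (\<Sum>j<2 ^ n. hadamard n i j *\<^sub>R f j) (\<Sum>j<2 ^ n. hadamard n i j *\<^sub>R f j))
    = (\<Sum>i<2 ^ n. \<Sum>j<2 ^ n. \<Sum>k<2 ^ n. hadamard n i j * hadamard n i k * B (f j) (f k))"
    by (simp add: sum_left sum_right scaleR_left scaleR_right sum_distrib_left mult_ac)
      (rule sum.cong[OF refl], subst sum.swap, simp add: mult.left_commute)
  also have "\<dots> = (\<Sum>j<2 ^ n. \<Sum>k<2 ^ n. (\<Sum>i<2 ^ n. hadamard n i j * hadamard n i k) * B (f j) (f k))"
    by (subst sum.swap, rule sum.cong[OF refl], subst sum.swap, simp add: sum_distrib_right)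
  also have "\<dots> = (\<Sum>j<2 ^ n. \<Sum>k<2 ^ n. if j = k then 2 ^ n * B (f j) (f k) else 0)"
    by (intro sum.cong refl) (simp add: hadamard_orthogonal)
  finally show ?thesis by (simp add: sum_distrib_left)
qed

definition hadamard_form :: "nat \<Rightarrow> (nat \<Rightarrow> real) \<Rightarrow> (nat \<Rightarrow> real) \<Rightarrow> real" where
  "hadamard_form n x y = (\<Sum>i<2 ^ n. \<Sum>j<2 ^ n. hadamard n i j * x i * y j)"

lemma hadamard_form_bound_l1:
  "\<bar>hadamard_form n x y\<bar> \<le> (\<Sum>i<2 ^ n. \<bar>x i\<bar>) * (\<Sum>j<2 ^ n. \<bar>y j\<bar>)"
proof -
  have "\<bar>hadamard_form n x y\<bar> \<le> (\<Sum>i<2 ^ n. \<Sum>j<2 ^ n. \<bar>hadamard n i j * x i * y j\<bar>)"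
    unfolding hadamard_form_def by (intro order_trans[OF sum_abs] sum_mono) auto
  also have "\<dots> = (\<Sum>i<2 ^ n. \<bar>x i\<bar>) * (\<Sum>j<2 ^ n. \<bar>y j\<bar>)"
    by (simp add: abs_mult abs_hadamard sum_product)
  finally show ?thesis .
qed

lemma hadamard_form_bound_l2:
  "\<bar>hadamard_form n x y\<bar> \<le> sqrt (2 ^ n) * sqrt (\<Sum>i<2 ^ n. (x i)\<^sup>2) * sqrt (\<Sum>j<2 ^ n. (y j)\<^sup>2)"
proof -
  define z where "z i = (\<Sum>j<2 ^ n. hadamard n i j *\<^sub>R y j)" for i
  have "hadamard_form n x y = (\<Sum>i<2 ^ n. x i * z i)"
    unfolding hadamard_form_def z_def by (simp add: sum_distrib_left mult_ac)
  then have "(hadamard_form n x y)\<^sup>2 \<le> (\<Sum>i<2 ^ n. (x i)\<^sup>2) * (\<Sum>i<2 ^ n. (z i)\<^sup>2)"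
    using Cauchy_Schwarz_ineq_sum[of x z "{..<2 ^ n}"] by simp
  also have "(\<Sum>i<2 ^ n. (z i)\<^sup>2) = 2 ^ n * (\<Sum>j<2 ^ n. (y j)\<^sup>2)"
    using hadamard_parseval[OF bounded_bilinear_mult, of n y] by (simp add: z_def power2_eq_square)
  finally have "sqrt ((hadamard_form n x y)\<^sup>2) \<le> sqrt ((\<Sum>i<2 ^ n. (x i)\<^sup>2) * (2 ^ n * (\<Sum>j<2 ^ n. (y j)\<^sup>2)))"
    by (rule real_sqrt_le_mono)
  then show ?thesis by (simp add: real_sqrt_mult mult_ac)
qed

lemma hadamard_form_add:
  "hadamard_form n (\<lambda>i. x i + x' i) y = hadamard_form n x y + hadamard_form n x' y"
  "hadamard_form n x (\<lambda>i. y i + y' i) = hadamard_form n x y + hadamard_form n x y'"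
  by (simp_all add: hadamard_form_def algebra_simps sum.distrib)

text \<open>
  Interpolation between the two bounds would give \<open>(2\<^sup>n)\<^sup>1\<^sup>-\<^sup>1\<^sup>/\<^sup>p\<close>, but any power of \<open>2\<^sup>n\<close> below the
  square root is good enough. Splitting both vectors at the height \<open>(2\<^sup>n)\<^sup>-\<^sup>1\<^sup>/\<^sup>8\<close> and using the
  \<open>\<ell>\<^sub>1\<close> bound for the large coordinates and the \<open>\<ell>\<^sub>2\<close> bound for the remaining terms
  gives such a power.
\<close>

lemma hadamard_form_bound_lp:
  fixes p :: real
  assumes p: "1 \<le> p" "p < 2"
    and x: "(\<Sum>i<2 ^ n. \<bar>x i\<bar> powr p) \<le> 1" and y: "(\<Sum>i<2 ^ n. \<bar>y i\<bar> powr p) \<le> 1"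
  shows "\<bar>hadamard_form n x y\<bar> \<le> 3 * (2 ^ n) powr (1/2 - (2 - p) / 16)"
proof -
  define N :: real where "N = 2 ^ n"
  have N: "N \<ge> 1" by (simp add: N_def)
  define \<tau> where "\<tau> = N powr (- (1/8))"
  have \<tau>: "\<tau> > 0" using N by (simp add: \<tau>_def)
  define \<gamma> where "\<gamma> = 1/2 - (2 - p) / 16"
  define big where "big z i = (if \<tau> \<le> \<bar>z i\<bar> then z i else 0)" for z :: "nat \<Rightarrow> real" and i
  define small where "small z i = (if \<tau> \<le> \<bar>z i\<bar> then 0 else z i)" for z :: "nat \<Rightarrow> real" and i
  have split: "z = (\<lambda>i. big z i + small z i)" for z by (auto simp: big_def small_def)
  have big: "(\<Sum>i<2 ^ n. \<bar>big z i\<bar>) \<le> N powr (1/8)" if "(\<Sum>i<2 ^ n. \<bar>z i\<bar> powr p) \<le> 1" for z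
  proof -
    have "\<bar>big z i\<bar> \<le> \<bar>z i\<bar> powr p * \<tau> powr (1 - p)" for i
    proof (cases "\<tau> \<le> \<bar>z i\<bar>")
      case True
      then have pos: "\<bar>z i\<bar> > 0" using \<tau> by linarith
      have "\<bar>z i\<bar> = \<bar>z i\<bar> powr p * \<bar>z i\<bar> powr (1 - p)" using pos by (simp flip: powr_add)
      also have "\<dots> \<le> \<bar>z i\<bar> powr p * \<tau> powr (1 - p)"
        using True \<tau> p by (intro mult_left_mono powr_mono2') auto
      finally show ?thesis using True by (simp add: big_def)
    qed (simp add: big_def)
    then have "(\<Sum>i<2 ^ n. \<bar>big z i\<bar>) \<le> (\<Sum>i<2 ^ n. \<bar>z i\<bar> powr p) * \<tau> powr (1 - p)"
      unfolding sum_distrib_right by (intro sum_mono)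
    also have "\<dots> \<le> 1 * \<tau> powr (1 - p)" using that by (intro mult_right_mono) auto
    also have "\<dots> = N powr ((p - 1) / 8)"
      unfolding \<tau>_def powr_powr mult_1 by (rule arg_cong[where f = "(powr) N"]) (simp add: field_simps)
    also have "\<dots> \<le> N powr (1/8)" using N p by (intro powr_mono) auto
    finally show ?thesis .
  qed
  have le: "(z i)\<^sup>2 \<le> \<bar>z i\<bar> powr p * t powr (2 - p)" if "\<bar>z i\<bar> \<le> t" for z :: "nat \<Rightarrow> real" and i t
  proof (cases "z i = 0")
    case False
    have "(z i)\<^sup>2 = \<bar>z i\<bar> powr p * \<bar>z i\<bar> powr (2 - p)"
      using False by (simp add: powr_realpow[of "\<bar>z i\<bar>" 2, simplified] flip: powr_add)
    also have "\<dots> \<le> \<bar>z i\<bar> powr p * t powr (2 - p)"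
      using that p by (intro mult_left_mono powr_mono2) auto
    finally show ?thesis .
  qed simp
  have small: "sqrt (\<Sum>i<2 ^ n. (small z i)\<^sup>2) \<le> N powr (- (2 - p) / 16)"
    if "(\<Sum>i<2 ^ n. \<bar>z i\<bar> powr p) \<le> 1" for z
  proof -
    have "(small z i)\<^sup>2 \<le> \<bar>z i\<bar> powr p * \<tau> powr (2 - p)" for i
      using le[of z i \<tau>] by (simp add: small_def)
    then have "(\<Sum>i<2 ^ n. (small z i)\<^sup>2) \<le> (\<Sum>i<2 ^ n. \<bar>z i\<bar> powr p) * \<tau> powr (2 - p)"
      unfolding sum_distrib_right by (intro sum_mono)
    also have "\<dots> \<le> 1 * \<tau> powr (2 - p)" using that by (intro mult_right_mono) auto
    also have "\<dots> = (N powr (- (2 - p) / 16))\<^sup>2"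
      by (simp add: \<tau>_def powr_powr power2_eq_square flip: powr_add)
        (simp add: minus_divide_left)
    finally show ?thesis by (simp add: real_le_lsqrt sum_nonneg)
  qed
  have all: "sqrt (\<Sum>i<2 ^ n. (v i)\<^sup>2) \<le> 1"
    if z: "(\<Sum>i<2 ^ n. \<bar>z i\<bar> powr p) \<le> 1" and v: "\<And>i. \<bar>v i\<bar> \<le> \<bar>z i\<bar>"
    for z v :: "nat \<Rightarrow> real"
  proof -
    have "(v i)\<^sup>2 \<le> \<bar>z i\<bar> powr p" if "i < 2 ^ n" for i
    proof -
      have "\<bar>z i\<bar> powr p \<le> (\<Sum>i<2 ^ n. \<bar>z i\<bar> powr p)" using that by (intro member_le_sum) auto
      then have "\<bar>z i\<bar> powr p \<le> 1" using z by linarith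
      then have "\<bar>z i\<bar> \<le> 1" using p powr_less_mono2[of p 1 "\<bar>z i\<bar>"] by fastforce
      then have "(z i)\<^sup>2 \<le> \<bar>z i\<bar> powr p" using le[of z i 1] by simp
      moreover have "(v i)\<^sup>2 \<le> (z i)\<^sup>2" using v[of i] by (simp add: abs_le_square_iff)
      ultimately show ?thesis by linarith
    qed
    then have "(\<Sum>i<2 ^ n. (v i)\<^sup>2) \<le> (\<Sum>i<2 ^ n. \<bar>z i\<bar> powr p)" by (intro sum_mono) auto
    then show ?thesis using z by (intro real_sqrt_le_1_iff[THEN iffD2]) linarith
  qed
  have sqrtN: "sqrt (2 ^ n) = N powr (1/2)" using N by (simp add: N_def powr_half_sqrt)
  have "\<bar>hadamard_form n (big x) (big y)\<bar> \<le> (N powr (1/8)) * (N powr (1/8))"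
    by (rule order_trans[OF hadamard_form_bound_l1]) (intro mult_mono big x y; simp add: sum_nonneg)
  also have "\<dots> \<le> N powr \<gamma>" using N p by (simp add: \<gamma>_def flip: powr_add) (intro powr_mono; simp add: field_simps)
  finally have 1: "\<bar>hadamard_form n (big x) (big y)\<bar> \<le> N powr \<gamma>" .
  have g: "N powr (1/2) * N powr (- (2 - p) / 16) = N powr \<gamma>"
    by (simp add: \<gamma>_def diff_divide_distrib flip: powr_add)
  have "\<bar>hadamard_form n (small x) y\<bar> \<le> N powr (1/2) * N powr (- (2 - p) / 16) * 1"
    unfolding sqrtN[symmetric]
    by (rule order_trans[OF hadamard_form_bound_l2])
      (intro mult_mono small x all[OF y] mult_nonneg_nonneg; simp add: sum_nonneg)
  then have 2: "\<bar>hadamard_form n (small x) y\<bar> \<le> N powr \<gamma>" unfolding g by simp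
  have "\<bar>hadamard_form n (big x) (small y)\<bar> \<le> N powr (1/2) * 1 * N powr (- (2 - p) / 16)"
    unfolding sqrtN[symmetric]
    by (rule order_trans[OF hadamard_form_bound_l2])
      (intro mult_mono small y all[OF x] mult_nonneg_nonneg; simp add: sum_nonneg big_def)
  then have 3: "\<bar>hadamard_form n (big x) (small y)\<bar> \<le> N powr \<gamma>" using g by simp
  have "hadamard_form n x y = hadamard_form n (big x) (big y) + hadamard_form n (big x) (small y)
      + hadamard_form n (small x) y"
    using hadamard_form_add(1)[of n "big x" "small x" y] hadamard_form_add(2)[of n "big x" "big y" "small y"]
      split[of x] split[of y] by simp
  then show ?thesis using 1 2 3 unfolding N_def \<gamma>_def by linarith
qed

text \<open>
  If \<open>q = q1 - q2\<close> with nonnegative forms, then \<open>r = q1 + q2\<close> satisfies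
  \<open>q (x + y) - q (x - y) \<le> 2 r x + 2 r y\<close>. For the pairs \<open>x = e i\<close>, \<open>y = \<Sum>j. hadamard n i j e j\<close> the left-hand
  side is as large as the Hilbert space norm of the Hadamard form allows, while the orthogonality of the
  matrix turns the sum of the \<open>r y\<close> into the sum of the \<open>r (e j)\<close>.
\<close>

lemma hadamard_delta_semidefinite_bound:
  fixes b :: "'x::banach \<Rightarrow> 'x \<Rightarrow> real"
  assumes b: "bounded_bilinear b" and b1: "bounded_bilinear b1" and b2: "bounded_bilinear b2"
    and nn: "\<And>x. 0 \<le> b1 x x" "\<And>x. 0 \<le> b2 x x" and diff: "\<And>x. b x x = b1 x x - b2 x x"
    and C: "\<And>i. i < 2 ^ n \<Longrightarrow> b1 (e i) (e i) + b2 (e i) (e i) \<le> C"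
    and b_e: "\<And>i j. i < 2 ^ n \<Longrightarrow> j < 2 ^ n \<Longrightarrow> b (e i) (e j) = w * hadamard n i j"
  shows "w * sqrt (2 ^ n) \<le> C"
proof -
  interpret b: bounded_bilinear b by (rule b)
  interpret b1: bounded_bilinear b1 by (rule b1)
  interpret b2: bounded_bilinear b2 by (rule b2)
  define N :: real where "N = 2 ^ n"
  have N: "N > 0" by (simp add: N_def)
  define r where "r x = b1 x x + b2 x x" for x
  have polar: "2 * (b x y + b y x) \<le> 2 * r x + 2 * r y" for x y
  proof -
    have "2 * (b x y + b y x) = b (x + y) (x + y) - b (x - y) (x - y)"
      by (simp add: b.add_left b.add_right b.diff_left b.diff_right)
    also have "\<dots> \<le> r (x + y) + r (x - y)"
      using nn(1)[of "x - y"] nn(2)[of "x + y"] nn(1)[of "x + y"] nn(2)[of "x - y"] by (simp add: diff r_def)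
    also have "\<dots> = 2 * r x + 2 * r y"
      by (simp add: r_def b1.add_left b1.add_right b1.diff_left b1.diff_right
        b2.add_left b2.add_right b2.diff_left b2.diff_right)
    finally show ?thesis .
  qed
  define y where "y i = (\<Sum>j<2 ^ n. hadamard n i j *\<^sub>R e j)" for i
  (* This scaling balances the two sums: r (e i) contributes N in total and r (y i) contributes N * N. *)
  define s where "s = sqrt (sqrt N)"
  have s: "s > 0" "s * s = sqrt N" using N by (auto simp: s_def)
  have each: "4 * w * N \<le> 2 * (sqrt N * r (e i)) + 2 * (r (y i) / sqrt N)" if i: "i < 2 ^ n" for i
  proof -
    have hh: "hadamard n i j * hadamard n i j = 1" for j
      using abs_hadamard[of n i j] by (simp flip: power2_eq_square abs_square_eq_1)
    have "b (e i) (y i) = (\<Sum>j<2 ^ n. w * (hadamard n i j * hadamard n i j))"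
      unfolding y_def using i by (simp add: b.sum_right b.scaleR_right b_e mult_ac)
    moreover have "b (y i) (e i) = (\<Sum>j<2 ^ n. w * (hadamard n i j * hadamard n i j))"
      unfolding y_def using i
      by (simp add: b.sum_left b.scaleR_left b_e hadamard_commute[of n _ i] mult_ac)
    ultimately have "b (e i) (y i) = w * N" "b (y i) (e i) = w * N" by (simp_all add: hh N_def)
    then have "4 * w * N = 2 * (b (s *\<^sub>R e i) ((1/s) *\<^sub>R y i) + b ((1/s) *\<^sub>R y i) (s *\<^sub>R e i))"
      using s by (simp add: b.scaleR_left b.scaleR_right)
    also have "\<dots> \<le> 2 * r (s *\<^sub>R e i) + 2 * r ((1/s) *\<^sub>R y i)" by (rule polar)
    also have "r (s *\<^sub>R e i) = (s * s) * r (e i)"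
      by (simp add: r_def b1.scaleR_left b1.scaleR_right b2.scaleR_left b2.scaleR_right algebra_simps)
    also have "r ((1/s) *\<^sub>R y i) = r (y i) / (s * s)"
      by (simp add: r_def b1.scaleR_left b1.scaleR_right b2.scaleR_left b2.scaleR_right add_divide_distrib)
    finally show ?thesis using s(2) by simp
  qed
  have re: "(\<Sum>i<2 ^ n. r (e i)) \<le> N * C"
    using sum_mono[of "{..<2 ^ n}" "\<lambda>i. r (e i)" "\<lambda>_. C"] C by (simp add: r_def N_def)
  have "(\<Sum>i<2 ^ n. r (y i)) = N * (\<Sum>i<2 ^ n. r (e i))"
    unfolding r_def y_def
    by (simp only: sum.distrib hadamard_parseval[OF b1] hadamard_parseval[OF b2] N_def distrib_left)
  then have ry: "(\<Sum>i<2 ^ n. r (y i)) \<le> N * (N * C)" using re N by simp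
  have "N * (4 * w * N) = (\<Sum>i<(2::nat) ^ n. 4 * w * N)" by (simp add: N_def)
  also have "\<dots> \<le> (\<Sum>i<2 ^ n. 2 * (sqrt N * r (e i)) + 2 * (r (y i) / sqrt N))"
    by (intro sum_mono each) auto
  also have "\<dots> = 2 * sqrt N * (\<Sum>i<2 ^ n. r (e i)) + 2 / sqrt N * (\<Sum>i<2 ^ n. r (y i))"
    by (simp add: sum.distrib sum_distrib_left sum_divide_distrib mult.assoc)
  also have "\<dots> \<le> 2 * sqrt N * (N * C) + 2 / sqrt N * (N * (N * C))"
    using N re ry by (intro add_mono mult_left_mono) auto
  also have "2 / sqrt N * (N * (N * C)) = 2 * sqrt N * (N * C)"
    using N by (simp add: field_simps)
  finally have "N * (w * N) \<le> N * (sqrt N * C)" using N by (simp add: algebra_simps)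
  then have "w * (sqrt N * sqrt N) \<le> sqrt N * C" using N by simp
  then have "sqrt N * (w * sqrt N) \<le> sqrt N * C" by (simp only: mult_ac)
  then show ?thesis using N by (simp add: N_def)
qed

theorem (in block_coordinates) not_property_D:
  fixes p :: real
  assumes p: "1 \<le> p" "p < 2"
    and sum: "\<And>k n x. (\<Sum>i<n. \<bar>\<xi> k i x\<bar> powr p) \<le> norm x powr p"
  shows "\<not> property_D TYPE('x)"
proof
  assume D: "property_D TYPE('x)"
  (* The factor is chosen such that sqrt (2 ^ m k) / (2 ^ m k) powr \<gamma> is at least 4 ^ k, which
     beats the weight (1/2) ^ k of the block. *)
  define m where "m k = k * nat \<lceil>32 / (2 - p)\<rceil>" for k
  define \<gamma> where "\<gamma> = 1/2 - (2 - p) / 16"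
  define N :: "nat \<Rightarrow> real" where "N k = 2 ^ m k" for k
  have N: "N k > 0" for k by (simp add: N_def)
  define u where "u k i j = hadamard (m k) i j / (3 * N k powr \<gamma>)" for k i j
  have "\<bar>\<Sum>i<2 ^ m k. \<Sum>j<2 ^ m k. u k i j * \<xi> k i x * \<xi> k j y\<bar> \<le> norm x * norm y" for k x y
  proof (cases "x = 0 \<or> y = 0")
    case True then show ?thesis by (auto simp: linear_simps(3)[OF linear_\<xi>])
  next
    case False
    have scale: "\<xi> k i x = norm x * \<xi> k i (x /\<^sub>R norm x)" if "x \<noteq> 0" for i x
      using that by (simp add: linear_simps(5)[OF linear_\<xi>])
    have unit: "(\<Sum>i<2 ^ m k. \<bar>\<xi> k i (x /\<^sub>R norm x)\<bar> powr p) \<le> 1" if "x \<noteq> 0" for x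
      using sum[of k "x /\<^sub>R norm x" "2 ^ m k"] that by simp
    have "(\<Sum>i<2 ^ m k. \<Sum>j<2 ^ m k. u k i j * \<xi> k i x * \<xi> k j y)
        = norm x * norm y / (3 * N k powr \<gamma>)
          * hadamard_form (m k) (\<lambda>i. \<xi> k i (x /\<^sub>R norm x)) (\<lambda>j. \<xi> k j (y /\<^sub>R norm y))"
      unfolding hadamard_form_def u_def sum_distrib_left
      using False by (subst (1 2) scale) (auto simp: mult_ac)
    moreover have "\<bar>hadamard_form (m k) (\<lambda>i. \<xi> k i (x /\<^sub>R norm x)) (\<lambda>j. \<xi> k j (y /\<^sub>R norm y))\<bar> \<le> 3 * N k powr \<gamma>"
      using hadamard_form_bound_lp[OF p unit unit] False by (simp add: N_def \<gamma>_def)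
    then have "norm x * norm y / (3 * N k powr \<gamma>)
        * \<bar>hadamard_form (m k) (\<lambda>i. \<xi> k i (x /\<^sub>R norm x)) (\<lambda>j. \<xi> k j (y /\<^sub>R norm y))\<bar>
        \<le> norm x * norm y / (3 * N k powr \<gamma>) * (3 * N k powr \<gamma>)"
      by (intro mult_left_mono) auto
    ultimately show ?thesis using N[of k] by (simp add: abs_mult)
  qed
  from glue_forms[where u = u and n = "\<lambda>k. 2 ^ m k", OF this] obtain b where b: "bounded_bilinear b"
    and b_e: "\<And>k i j. i < 2 ^ m k \<Longrightarrow> j < 2 ^ m k \<Longrightarrow> b (e k i) (e k j) = (1/2) ^ k * u k i j" by blast
  have "delta_semidefinite (\<lambda>x. b x x)"
    using D b unfolding property_D_def continuous_quadratic_form_def by (metis (no_types, lifting))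
  then obtain b1 b2 where b1: "bounded_bilinear b1" "\<And>x. 0 \<le> b1 x x"
    and b2: "bounded_bilinear b2" "\<And>x. 0 \<le> b2 x x" and diff: "\<And>x. b x x = b1 x x - b2 x x"
    unfolding delta_semidefinite_def continuous_quadratic_form_def by auto
  have bounded: "\<exists>K. \<forall>k i. B (e k i) (e k i) \<le> K" if B: "bounded_bilinear B" for B :: "'x \<Rightarrow> 'x \<Rightarrow> real"
  proof -
    obtain K where K: "K \<ge> 0" "\<And>x y. norm (B x y) \<le> norm x * norm y * K"
      using bounded_bilinear.nonneg_bounded[OF B] by blast
    have "B (e k i) (e k i) \<le> K" for k i
    proof -
      have "B (e k i) (e k i) \<le> (norm (e k i) * norm (e k i)) * K" using K(2)[of "e k i" "e k i"] by simp
      also have "\<dots> \<le> (1 * 1) * K" using K(1) by (intro mult_right_mono mult_mono norm_e) auto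
      finally show ?thesis by simp
    qed
    then show ?thesis by blast
  qed
  obtain K1 K2 where K: "\<And>k i. b1 (e k i) (e k i) \<le> K1" "\<And>k i. b2 (e k i) (e k i) \<le> K2"
    using bounded[OF b1(1)] bounded[OF b2(1)] by blast
  have "2 ^ k \<le> 3 * (K1 + K2)" for k :: nat
  proof -
    have "(1/2) ^ k / (3 * N k powr \<gamma>) * sqrt (2 ^ m k) \<le> K1 + K2"
      by (rule hadamard_delta_semidefinite_bound[OF b b1(1) b2(1) b1(2) b2(2) diff, where e = "e k"])
        (auto simp: b_e u_def intro: add_mono K)
    then have *: "sqrt (N k) / N k powr \<gamma> \<le> 3 * (K1 + K2) * 2 ^ k"
      by (simp add: N_def field_simps)
    have "sqrt (N k) / N k powr \<gamma> = N k powr ((2 - p) / 16)"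
      using N[of k] by (simp add: \<gamma>_def powr_half_sqrt[symmetric] flip: powr_diff)
    also have "\<dots> = 2 powr (real (m k) * ((2 - p) / 16))" by (simp add: N_def powr_powr flip: powr_realpow)
    also have "\<dots> \<ge> 2 powr (real k * 2)"
    proof (intro powr_mono)
      have "2 \<le> real (nat \<lceil>32 / (2 - p)\<rceil>) * ((2 - p) / 16)"
        using p real_nat_ceiling_ge[of "32 / (2 - p)"]
        unfolding pos_divide_le_eq[of "2 - p" 32, simplified, OF p(2)] times_divide_eq_right
        by (simp only: pos_le_divide_eq)
      then have "real k * 2 \<le> real k * (real (nat \<lceil>32 / (2 - p)\<rceil>) * ((2 - p) / 16))"
        by (intro mult_left_mono) auto
      then show "real k * 2 \<le> real (m k) * ((2 - p) / 16)" by (simp add: m_def mult.assoc)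
    qed simp
    also have "2 powr (real k * 2) = 2 ^ k * (2 ^ k :: real)"
      using powr_realpow[of 2 "k * 2"] by (simp add: power_add mult_2_right)
    finally have "2 ^ k * 2 ^ k \<le> 3 * (K1 + K2) * 2 ^ k" using * by (rule order_trans)
    then show ?thesis by (rule mult_right_le_imp_le) simp
  qed
  then show False
    using real_arch_pow[of 2 "3 * (K1 + K2)"] by (meson less_le_not_le one_less_numeral_iff semiring_norm(76))
qed

section \<open>A $C^{1,1}$ function that is not delta-convex\<close>

text \<open>
  What matters is that \<open>gate\<close> is even with \<open>gate 0 = 0\<close>, that its first two derivatives are bounded by
  multiples of \<open>1 - gate\<close>, and that \<open>1 - gate\<close> decreases exponentially.
\<close>

definition gate :: "real \<Rightarrow> real" where
  "gate t = 1 - 1 / cosh t"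

definition gate' :: "real \<Rightarrow> real" where
  "gate' t = sinh t / (cosh t)\<^sup>2"

lemma gate_zero: "gate 0 = 0"
  by (simp add: gate_def)

lemma gate_bounds: "0 \<le> gate t" "gate t < 1"
  using cosh_real_ge_1[of t] by (auto simp: gate_def)

lemma gate_abs: "gate \<bar>t\<bar> = gate t"
  by (simp add: gate_def)

lemma gate_has_derivative: "(gate has_field_derivative gate' t) (at t within S)"
  unfolding gate_def gate'_def by (auto intro!: derivative_eq_intros simp: power2_eq_square)

lemma gate'_has_derivative:
  "(gate' has_field_derivative (1 / cosh t) * (1 - 2 * (tanh t)\<^sup>2)) (at t within S)"
  unfolding gate'_def
  by (auto intro!: derivative_eq_intros simp: tanh_def field_simps power2_eq_square power4_eq_xxxx)

lemma abs_gate'_le: "\<bar>gate' t\<bar> \<le> 1 - gate t"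
proof -
  have "\<bar>sinh t\<bar> \<le> cosh t"
    using sinh_le_cosh_real[of t] sinh_le_cosh_real[of "- t"] by (simp add: abs_le_iff)
  then show ?thesis by (simp add: gate_def gate'_def divide_simps power2_eq_square)
qed

lemma gate_nearby:
  assumes "\<bar>s - t\<bar> \<le> 1/2"
  shows "1 - gate s \<le> 2 * (1 - gate t)"
proof -
  have half: "exp (1/2::real) \<le> 2"
  proof -
    have "(exp (1/2::real))\<^sup>2 = exp 1" by (simp add: power2_eq_square flip: exp_add)
    then have "(exp (1/2::real))\<^sup>2 \<le> 2\<^sup>2" using exp_le by simp
    then show ?thesis by (rule power2_le_imp_le) simp
  qed
  have "exp (t - s) \<le> exp (1/2)" "exp (s - t) \<le> exp (1/2)"
  proof -
    have "t - s \<le> 1/2" "s - t \<le> 1/2" using assms by linarith+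
    then show "exp (t - s) \<le> exp (1/2)" "exp (s - t) \<le> exp (1/2)" by (simp_all only: exp_le_cancel_iff)
  qed
  note this[THEN order_trans[OF _ half]]
  then have "exp (t - s) * exp s \<le> 2 * exp s" "exp (s - t) * exp (- s) \<le> 2 * exp (- s)"
    by (intro mult_right_mono; simp)+
  then have "exp t \<le> 2 * exp s" "exp (- t) \<le> 2 * exp (- s)" by (simp_all flip: exp_add)
  then have "cosh t \<le> 2 * cosh s" by (simp add: cosh_field_def)
  then show ?thesis using cosh_real_pos[of t] cosh_real_pos[of s] by (simp add: gate_def divide_simps)
qed

lemma gate_lipschitz:
  assumes "\<bar>s - t\<bar> \<le> 1/2"
  shows "\<bar>gate s - gate t\<bar> \<le> 2 * (1 - gate t) * \<bar>s - t\<bar>"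
    "\<bar>gate' s - gate' t\<bar> \<le> 2 * (1 - gate t) * \<bar>s - t\<bar>"
proof -
  have *: "1 - gate z \<le> 2 * (1 - gate t)" if "z \<in> cball t (1/2)" for z
    using that by (intro gate_nearby) (auto simp: dist_real_def abs_minus_commute)
  have "norm (gate' z) \<le> 2 * (1 - gate t)" if "z \<in> cball t (1/2)" for z
    using abs_gate'_le[of z] *[OF that] by simp
  from field_differentiable_bound[where x = s and y = t, OF convex_cball[of t "1/2"] gate_has_derivative this]
  show "\<bar>gate s - gate t\<bar> \<le> 2 * (1 - gate t) * \<bar>s - t\<bar>"
    using assms by (auto simp: dist_real_def abs_minus_commute)
  have "norm ((1 / cosh z) * (1 - 2 * (tanh z)\<^sup>2)) \<le> 2 * (1 - gate t)" if "z \<in> cball t (1/2)" for z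
  proof -
    have "(tanh z)\<^sup>2 \<le> 1" using tanh_real_bounds[of z] by (auto simp: abs_square_le_1 abs_le_iff)
    then have "\<bar>1 - 2 * (tanh z)\<^sup>2\<bar> \<le> 1" by (simp add: abs_le_iff)
    then have "norm ((1 / cosh z) * (1 - 2 * (tanh z)\<^sup>2)) \<le> 1 / cosh z"
      using divide_right_mono[of "\<bar>1 - 2 * (tanh z)\<^sup>2\<bar>" 1 "cosh z"] by (simp add: abs_mult)
    then show ?thesis using *[OF that] by (simp add: gate_def)
  qed
  from field_differentiable_bound[where x = s and y = t, OF convex_cball[of t "1/2"] gate'_has_derivative this]
  show "\<bar>gate' s - gate' t\<bar> \<le> 2 * (1 - gate t) * \<bar>s - t\<bar>"
    using assms by (auto simp: dist_real_def abs_minus_commute)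
qed

lemma locally_lipschitz_imp_lipschitz:
  fixes D :: "'a::real_normed_vector \<Rightarrow> 'b::metric_space"
  assumes \<delta>: "\<delta> > 0" and L: "L \<ge> 0"
    and local: "\<And>x y. norm (x - y) \<le> \<delta> \<Longrightarrow> dist (D x) (D y) \<le> L * norm (x - y)"
  shows "L-lipschitz_on UNIV D"
proof (rule lipschitz_onI[OF _ L])
  fix x y :: 'a
  obtain n :: nat where n: "norm (y - x) / \<delta> < real n" using reals_Archimedean2 by blast
  have n0: "n > 0" using n \<delta> by (metis divide_nonneg_pos gr0I norm_ge_zero not_less of_nat_0)
  define z where "z i = x + (real i / real n) *\<^sub>R (y - x)" for i
  have step: "norm (z (Suc i) - z i) = norm (y - x) / real n" for i
  proof -
    have "z (Suc i) - z i = (1 / real n) *\<^sub>R (y - x)"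
      by (simp add: z_def add_divide_distrib scaleR_left_distrib)
    then show ?thesis by simp
  qed
  have next_le: "dist (D (z (Suc i))) (D (z i)) \<le> L * (norm (y - x) / real n)" for i
    using local[of "z (Suc i)" "z i"] n n0 \<delta> by (simp add: step field_simps)
  have "dist (D (z i)) (D (z 0)) \<le> real i * (L * (norm (y - x) / real n))" for i
  proof (induction i)
    case (Suc i)
    then show ?case
      using dist_triangle[of "D (z (Suc i))" "D (z 0)" "D (z i)"] next_le[of i]
      by (simp only: of_nat_Suc distrib_right mult_1)
  qed simp
  from this[of n] show "dist (D x) (D y) \<le> L * dist x y"
    using n0 by (simp add: z_def dist_norm norm_minus_commute dist_commute[of "D y"])
qed

text \<open>
  The gate of a coordinate is closed at \<open>0\<close>, where \<open>alternating\<close> ignores all later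
  coordinates, and almost open at \<open>\<plusminus>R\<close> for large \<open>R\<close>. If the first \<open>l\<close> coordinates are \<open>\<plusminus>R\<close> and the
  others are \<open>0\<close>, the value is almost \<open>1\<close> for even \<open>l\<close> and almost \<open>0\<close> for odd \<open>l\<close>. The derivatives of a gate are bounded by the
  remaining opening \<open>1 - gate t\<close>. Hence a new gate multiplies the derivatives of the tail by \<open>gate t\<close> and
  adds a term of the order of \<open>1 - gate t\<close>, and such convex combinations keep the bounds independent
  of the length of the list.
\<close>

fun alternating :: "('x::real_normed_vector \<Rightarrow>\<^sub>L real) list \<Rightarrow> 'x \<Rightarrow> real" where
  "alternating [] x = 1"
| "alternating (\<xi> # \<xi>s) x = 1 - gate (blinfun_apply \<xi> x) * alternating \<xi>s x"

lemma alternating_bounds: "0 \<le> alternating \<xi>s x" "alternating \<xi>s x \<le> 1"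
proof -
  have "0 \<le> alternating \<xi>s x \<and> alternating \<xi>s x \<le> 1"
  proof (induction \<xi>s)
    case (Cons \<xi> \<xi>s)
    then show ?case
      using gate_bounds[of "blinfun_apply \<xi> x"] by (auto simp: mult_le_one)
  qed simp
  then show "0 \<le> alternating \<xi>s x" "alternating \<xi>s x \<le> 1" by auto
qed

lemma alternating_C11:
  fixes \<xi>s :: "('x::real_normed_vector \<Rightarrow>\<^sub>L real) list"
  assumes "\<forall>\<xi>\<in>set \<xi>s. norm \<xi> \<le> 1"
  shows "\<exists>D :: 'x \<Rightarrow> 'x \<Rightarrow>\<^sub>L real. (\<forall>x. (alternating \<xi>s has_derivative blinfun_apply (D x)) (at x)) \<and>
    (\<forall>x. norm (D x) \<le> 1) \<and> 5-lipschitz_on UNIV D"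
  using assms
proof (induction \<xi>s)
  case Nil
  have "((\<lambda>x::'x. 1::real) has_derivative blinfun_apply 0) (at x)" for x
  proof -
    have "blinfun_apply (0 :: 'x \<Rightarrow>\<^sub>L real) = (\<lambda>_. 0)" by (rule ext) simp
    then show ?thesis by simp
  qed
  moreover have "alternating [] = (\<lambda>x::'x. 1)" by auto
  ultimately show ?case by (intro exI[of _ "\<lambda>_. 0"]) (auto intro!: lipschitz_onI)
next
  case (Cons \<xi> \<xi>s)
  define g where "g = alternating \<xi>s"
  obtain E where E: "\<And>x. (g has_derivative blinfun_apply (E x)) (at x)"
    and E1: "\<And>x. norm (E x) \<le> 1" and E5: "5-lipschitz_on UNIV E"
    using Cons unfolding g_def by auto
  have \<xi>: "norm \<xi> \<le> 1" using Cons.prems by simp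
  have \<xi>_le: "\<bar>blinfun_apply \<xi> x\<bar> \<le> norm x" for x
    using norm_blinfun[of \<xi> x] mult_right_mono[OF \<xi>, of "norm x"] by simp
  have g01: "\<bar>g x\<bar> \<le> 1" for x unfolding g_def using alternating_bounds[of \<xi>s x] by simp
  have g_lip: "\<bar>g x - g y\<bar> \<le> norm (x - y)" for x y
    using differentiable_bound[OF convex_UNIV, of g "\<lambda>x. blinfun_apply (E x)" 1 x y] E E1
    by (auto simp: norm_blinfun.rep_eq[symmetric])
  define D where "D x = - ((gate' (blinfun_apply \<xi> x) * g x) *\<^sub>R \<xi> + gate (blinfun_apply \<xi> x) *\<^sub>R E x)" for x
  have "(alternating (\<xi> # \<xi>s) has_derivative blinfun_apply (D x)) (at x)" for x
  proof -
    have "((\<lambda>x. gate (blinfun_apply \<xi> x)) has_derivative (\<lambda>h. gate' (blinfun_apply \<xi> x) * blinfun_apply \<xi> h)) (at x)"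
      using has_derivative_compose[OF blinfun.bounded_linear_right[of \<xi>, THEN bounded_linear_imp_has_derivative]
        gate_has_derivative[of "blinfun_apply \<xi> x" UNIV, unfolded has_field_derivative_def]] .
    note has_derivative_diff[OF has_derivative_const[of 1] has_derivative_mult[OF this E]]
    moreover have "(\<lambda>x. 1 - gate (blinfun_apply \<xi> x) * g x) = alternating (\<xi> # \<xi>s)"
      by (rule ext) (simp add: g_def)
    moreover have "(\<lambda>h. 0 - (gate (blinfun_apply \<xi> x) * blinfun_apply (E x) h
        + gate' (blinfun_apply \<xi> x) * blinfun_apply \<xi> h * g x)) = blinfun_apply (D x)"
      by (rule ext) (simp add: D_def blinfun.minus_left blinfun.diff_left blinfun.scaleR_left)
    ultimately show ?thesis by (simp only:)
  qed
  moreover have "norm (D x) \<le> 1" for x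
  proof -
    have "norm (D x) \<le> \<bar>gate' (blinfun_apply \<xi> x) * g x\<bar> * norm \<xi> + \<bar>gate (blinfun_apply \<xi> x)\<bar> * norm (E x)"
      unfolding D_def norm_minus_cancel by (rule order_trans[OF norm_triangle_ineq]) simp
    also have "\<dots> \<le> ((1 - gate (blinfun_apply \<xi> x)) * 1) * 1 + gate (blinfun_apply \<xi> x) * 1"
      unfolding abs_mult using gate_bounds[of "blinfun_apply \<xi> x"]
      by (intro add_mono mult_mono abs_gate'_le g01 \<xi> E1) auto
    finally show ?thesis by simp
  qed
  moreover have "5-lipschitz_on UNIV D"
  proof (rule locally_lipschitz_imp_lipschitz[where \<delta> = "1/2"])
    fix x y :: 'x assume xy: "norm (x - y) \<le> 1/2"
    define s t d where "s = blinfun_apply \<xi> x" and "t = blinfun_apply \<xi> y" and "d = norm (x - y)"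
    have st: "\<bar>s - t\<bar> \<le> d" using \<xi>_le[of "x - y"] by (simp add: s_def t_def d_def blinfun.diff_right)
    define \<eta> where "\<eta> = 1 - gate t"
    have \<eta>: "0 \<le> \<eta>" "\<eta> \<le> 1" using gate_bounds[of t] by (auto simp: \<eta>_def)
    have d: "0 \<le> d" by (simp add: d_def)
    have "\<bar>s - t\<bar> \<le> 1/2" using st xy by (simp add: d_def)
    note gl = gate_lipschitz[OF this]
    have 1: "\<bar>gate' s - gate' t\<bar> \<le> 2 * \<eta> * d" "\<bar>gate s - gate t\<bar> \<le> 2 * \<eta> * d"
      using gl[THEN order_trans, of "2 * \<eta> * d"] mult_left_mono[OF st, of "2 * \<eta>"] \<eta>
      by (simp_all add: \<eta>_def)
    have "D y - D x = (gate' s * g x - gate' t * g y) *\<^sub>R \<xi> + (gate s *\<^sub>R E x - gate t *\<^sub>R E y)"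
      by (simp add: D_def s_def t_def algebra_simps)
    also have "gate' s * g x - gate' t * g y = (gate' s - gate' t) * g x + gate' t * (g x - g y)"
      by (simp add: algebra_simps)
    also have "gate s *\<^sub>R E x - gate t *\<^sub>R E y = (gate s - gate t) *\<^sub>R E x + gate t *\<^sub>R (E x - E y)"
      by (simp add: algebra_simps)
    finally have eq: "D y - D x = ((gate' s - gate' t) * g x + gate' t * (g x - g y)) *\<^sub>R \<xi>
      + ((gate s - gate t) *\<^sub>R E x + gate t *\<^sub>R (E x - E y))" .
    have "norm (D y - D x) \<le> \<bar>(gate' s - gate' t) * g x + gate' t * (g x - g y)\<bar> * norm \<xi>
      + (\<bar>gate s - gate t\<bar> * norm (E x) + \<bar>gate t\<bar> * norm (E x - E y))"
      unfolding eq by (intro order_trans[OF norm_triangle_ineq] add_mono) (auto intro: order_trans[OF norm_triangle_ineq])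
    also have "\<dots> \<le> (2 * \<eta> * d * 1 + \<eta> * d) * 1 + (2 * \<eta> * d * 1 + gate t * (5 * d))"
    proof (intro add_mono mult_mono \<xi> E1 1)
      have "\<bar>(gate' s - gate' t) * g x + gate' t * (g x - g y)\<bar>
          \<le> \<bar>gate' s - gate' t\<bar> * \<bar>g x\<bar> + \<bar>gate' t\<bar> * \<bar>g x - g y\<bar>"
        by (simp only: abs_mult[symmetric] abs_triangle_ineq)
      also have "\<dots> \<le> 2 * \<eta> * d * 1 + \<eta> * d"
        using \<eta> d abs_gate'_le[of t] g_lip[of x y]
        by (intro add_mono mult_mono 1 g01) (auto simp: \<eta>_def d_def)
      finally show "\<bar>(gate' s - gate' t) * g x + gate' t * (g x - g y)\<bar> \<le> 2 * \<eta> * d * 1 + \<eta> * d" .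
      show "norm (E x - E y) \<le> 5 * d" using lipschitz_onD[OF E5, of x y] by (simp add: dist_norm d_def)
    qed (use \<eta> d gate_bounds[of t] in auto)
    also have "\<dots> = 5 * d" by (simp add: \<eta>_def algebra_simps)
    finally show "dist (D x) (D y) \<le> 5 * norm (x - y)"
      by (simp add: dist_norm d_def norm_minus_commute)
  qed auto
  ultimately show ?case by blast
qed

lemma alternating_branch:
  assumes "l \<le> length \<xi>s"
    and "\<And>i. i < l \<Longrightarrow> \<bar>blinfun_apply (\<xi>s ! i) x\<bar> = R"
    and "\<And>i. l \<le> i \<Longrightarrow> i < length \<xi>s \<Longrightarrow> blinfun_apply (\<xi>s ! i) x = 0"
  shows "alternating \<xi>s x = (\<Sum>j\<le>l. (- gate R) ^ j)"
  using assms
proof (induction \<xi>s arbitrary: l)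
  case Nil then show ?case by simp
next
  case (Cons \<xi> \<xi>s)
  show ?case
  proof (cases l)
    case 0
    then have "blinfun_apply \<xi> x = 0" using Cons.prems(3)[of 0] by simp
    then show ?thesis using 0 by (simp add: gate_zero)
  next
    case (Suc m)
    have "alternating \<xi>s x = (\<Sum>j\<le>m. (- gate R) ^ j)"
      using Cons.prems(1) Cons.prems(2,3)[of "Suc _"] Suc by (intro Cons.IH) auto
    moreover have "gate (blinfun_apply \<xi> x) = gate R"
      using Cons.prems(2)[of 0] Suc gate_abs[of "blinfun_apply \<xi> x"] by simp
    ultimately show ?thesis unfolding Suc by (simp add: sum.atMost_Suc_shift sum_distrib_left del: sum.atMost_Suc)
        (simp add: sum_negf)
  qed
qed

lemma C11_series:
  fixes f :: "nat \<Rightarrow> 'x::banach \<Rightarrow> real" and D :: "nat \<Rightarrow> 'x \<Rightarrow> 'x \<Rightarrow>\<^sub>L real"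
  assumes f: "\<And>k x. \<bar>f k x\<bar> \<le> 1" and fD: "\<And>k x. (f k has_derivative blinfun_apply (D k x)) (at x)"
    and D: "\<And>k x. norm (D k x) \<le> 1" and L: "\<And>k. L-lipschitz_on UNIV (D k)"
  shows "C11 (\<lambda>x. \<Sum>k. (1/2) ^ k * f k x)"
proof -
  have geo: "summable (\<lambda>k. (1/2) ^ k :: real)" by simp
  have geo2: "(\<Sum>k. (1/2) ^ k * c) = 2 * c" for c :: real
    using suminf_mult2[OF geo, of c] by (simp add: suminf_geometric)
  define G where "G x = (\<Sum>k. (1/2) ^ k *\<^sub>R D k x)" for x
  have nG: "norm ((1/2) ^ k *\<^sub>R D k x) \<le> (1/2) ^ k" for k x
    using D[of k x] by (simp add: mult_left_le)
  have sG: "summable (\<lambda>k. (1/2) ^ k *\<^sub>R D k x)" for x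
    by (rule summable_comparison_test'[OF geo, of 0]) (rule nG)
  have sf: "summable (\<lambda>k. (1/2) ^ k * f k x)" for x
    by (rule summable_comparison_test'[OF geo, of 0]) (use f[of _ x] in \<open>simp add: abs_mult mult_left_le\<close>)
  have tail: "norm ((\<Sum>i<n. (1/2) ^ i *\<^sub>R D i x) - G x) \<le> 2 * (1/2) ^ n" for n x
  proof -
    have "G x - (\<Sum>i<n. (1/2) ^ i *\<^sub>R D i x) = (\<Sum>i. (1/2) ^ (i + n) *\<^sub>R D (i + n) x)"
      unfolding G_def using suminf_minus_initial_segment[OF sG] by simp
    moreover have "norm (\<Sum>i. (1/2) ^ (i + n) *\<^sub>R D (i + n) x) \<le> (\<Sum>i. (1/2) ^ i * (1/2) ^ n)"
      by (rule norm_suminf_le) (use nG[of "_ + n" x] in \<open>auto simp: power_add intro!: summable_mult2\<close>)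
    ultimately show ?thesis by (simp add: geo2 norm_minus_commute)
  qed
  have "\<exists>g. \<forall>x\<in>UNIV. (\<lambda>k. (1/2) ^ k * f k x) sums (g x) \<and> (g has_derivative blinfun_apply (G x)) (at x within UNIV)"
  proof (rule has_derivative_series[where f = "\<lambda>k x. (1/2) ^ k * f k x" and x = 0
        and f' = "\<lambda>k x h. (1/2) ^ k * blinfun_apply (D k x) h" and g' = "\<lambda>x. blinfun_apply (G x)"])
    show "((\<lambda>x. (1/2) ^ n * f n x) has_derivative (\<lambda>h. (1/2) ^ n * blinfun_apply (D n x) h)) (at x within UNIV)" for n x
      by (intro has_derivative_mult_right fD)
    fix e :: real assume "e > 0"
    then have "\<forall>\<^sub>F n in sequentially. 2 * (1/2) ^ n < e"
      by (intro order_tendstoD(2)[of _ 0]) (auto intro!: tendsto_eq_intros LIMSEQ_realpow_zero)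
    then show "\<forall>\<^sub>F n in sequentially. \<forall>x\<in>UNIV. \<forall>h. norm ((\<Sum>i<n. (1/2) ^ i * blinfun_apply (D i x) h) - blinfun_apply (G x) h) \<le> e * norm h"
    proof eventually_elim
      case (elim n)
      have "norm ((\<Sum>i<n. (1/2) ^ i * blinfun_apply (D i x) h) - blinfun_apply (G x) h) \<le> e * norm h" for x h
      proof -
        have "(\<Sum>i<n. (1/2) ^ i * blinfun_apply (D i x) h) - blinfun_apply (G x) h
            = blinfun_apply ((\<Sum>i<n. (1/2) ^ i *\<^sub>R D i x) - G x) h"
          by (simp add: blinfun.diff_left blinfun.sum_left blinfun.scaleR_left)
        also have "norm \<dots> \<le> norm ((\<Sum>i<n. (1/2) ^ i *\<^sub>R D i x) - G x) * norm h" by (rule norm_blinfun)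
        also have "\<dots> \<le> e * norm h" using tail[where n = n and x = x] elim by (intro mult_right_mono) auto
        finally show ?thesis .
      qed
      then show ?case by blast
    qed
  next
    show "(\<lambda>k. (1/2) ^ k * f k 0) sums (\<Sum>k. (1/2) ^ k * f k 0)" using sf by (rule summable_sums)
  qed auto
  then obtain g where g: "\<And>x. (\<lambda>k. (1/2) ^ k * f k x) sums (g x)" "\<And>x. (g has_derivative blinfun_apply (G x)) (at x)"
    by auto
  have "(\<lambda>x. \<Sum>k. (1/2) ^ k * f k x) = g" using g(1) by (auto simp: sums_iff)
  moreover have "(2 * L)-lipschitz_on UNIV G"
  proof (rule lipschitz_onI)
    show L0: "0 \<le> 2 * L" using lipschitz_on_nonneg[OF L] by simp
    fix x y
    have n: "norm ((1/2) ^ k *\<^sub>R (D k x - D k y)) \<le> (1/2) ^ k * (L * dist x y)" for k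
      using lipschitz_onD[OF L[of k], of x y] by (simp add: dist_norm)
    have "G x - G y = (\<Sum>k. (1/2) ^ k *\<^sub>R (D k x - D k y))"
      unfolding G_def by (subst suminf_diff[OF sG sG]) (simp add: scaleR_right_diff_distrib)
    also have "norm \<dots> \<le> (\<Sum>k. (1/2) ^ k * (L * dist x y))"
      by (rule norm_suminf_le[OF n]) (intro summable_mult2 geo)
    finally show "dist (G x) (G y) \<le> 2 * L * dist x y" by (simp add: geo2 dist_norm)
  qed
  ultimately show ?thesis unfolding C11_def using g(2) by blast
qed

lemma ln_square_less_powr:
  assumes "c > 0"
  shows "\<exists>N::nat. N \<ge> 1 \<and> C * (ln (4 * real N))\<^sup>2 < real N powr c"
proof -
  have "((\<lambda>n. C * (ln (4 * real n))\<^sup>2 / real n powr c) \<longlongrightarrow> 0) sequentially"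
    using assms by real_asymp
  then have "\<forall>\<^sub>F n in sequentially. C * (ln (4 * real n))\<^sup>2 / real n powr c < 1"
    by (rule order_tendstoD) simp
  then have "\<forall>\<^sub>F n in sequentially. n \<ge> 1 \<and> C * (ln (4 * real n))\<^sup>2 < real n powr c"
    using eventually_ge_at_top[of 1] by eventually_elim (simp add: divide_less_eq)
  then show ?thesis using eventually_happens'[OF sequentially_bot] by blast
qed

text \<open>
  A branch of length \<open>N\<close> needs gates that are open up to \<open>1 / (2 N)\<close>, hence \<open>R\<close> of order \<open>ln N\<close>, and
  then reaches vectors of norm \<open>R N\<^sup>\<theta>\<close>. The rescaled function \<open>a\<^sup>2 f (x / a)\<close> has the same
  Lipschitz constant of the derivative; with \<open>a\<close> of order \<open>1 / (R N\<^sup>\<theta>)\<close> the branches stay bounded and the second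
  differences along them add up to \<open>N a\<^sup>2\<close>, which is \<open>N\<^sup>1\<^sup>-\<^sup>2\<^sup>\<theta>\<close> up to logarithmic factors.
\<close>

theorem (in block_coordinates) not_property_Cdc:
  fixes \<theta> :: real
  assumes \<theta>: "0 \<le> \<theta>" "\<theta> < 1/2"
    and flat: "\<And>k n \<sigma>. (\<forall>i. \<bar>\<sigma> i\<bar> = 1) \<Longrightarrow> norm (\<Sum>i<n. \<sigma> i *\<^sub>R e k i) \<le> real n powr \<theta>"
  shows "\<not> property_Cdc TYPE('x)"
proof
  assume Cdc: "property_Cdc TYPE('x)"
  have "\<exists>N::nat. N \<ge> 1 \<and> (8 ^ k * (real k + 1)\<^sup>2) * (ln (4 * real N))\<^sup>2 < real N powr (1 - 2 * \<theta>)" for k :: nat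
    using \<theta> by (intro ln_square_less_powr) auto
  then obtain N :: "nat \<Rightarrow> nat" where N1: "\<And>k. N k \<ge> 1"
    and N: "\<And>k. (8 ^ k * (real k + 1)\<^sup>2) * (ln (4 * real (N k)))\<^sup>2 < real (N k) powr (1 - 2 * \<theta>)"
    by metis
  define R where "R k = ln (4 * real (N k))" for k
  (* The factor k + 1 makes the trees eventually fit into every ball around 0. *)
  define a where "a k = 1 / ((real k + 1) * R k * real (N k) powr \<theta>)" for k
  have R1: "1 \<le> R k" for k
  proof -
    have "exp 1 \<le> 4 * real (N k)" using exp_le N1[of k] by linarith
    then show ?thesis unfolding R_def by (metis exp_gt_zero ln_exp ln_le_cancel_iff order_less_le_trans)
  qed
  have N\<theta>: "1 \<le> real (N k) powr \<theta>" for k using N1[of k] \<theta>(1) by (intro ge_one_powr_ge_zero) auto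
  have den: "1 \<le> (real k + 1) * R k * real (N k) powr \<theta>" for k
  proof -
    have "1 * 1 * 1 \<le> (real k + 1) * R k * real (N k) powr \<theta>"
      using R1[of k] N\<theta>[of k] by (intro mult_mono) auto
    then show ?thesis by simp
  qed
  have a: "0 < a k" "a k \<le> 1" for k
    using den[of k] by (auto simp: a_def)
  define \<xi>b where "\<xi>b k i = Blinfun (\<xi> k i)" for k i
  have \<xi>b: "blinfun_apply (\<xi>b k i) = \<xi> k i" for k i
    unfolding \<xi>b_def by (rule bounded_linear_Blinfun_apply[OF linear_\<xi>])
  have n\<xi>b: "norm (\<xi>b k i) \<le> 1" for k i
    by (rule norm_blinfun_bound) (auto simp: \<xi>b norm_\<xi>)
  define \<xi>s where "\<xi>s k = map (\<xi>b k) [0..<N k]" for k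
  have "\<forall>\<xi>\<in>set (\<xi>s k). norm \<xi> \<le> 1" for k by (auto simp: \<xi>s_def n\<xi>b)
  from alternating_C11[OF this] obtain D where
    D: "\<And>k x. (alternating (\<xi>s k) has_derivative blinfun_apply (D k x)) (at x)"
    and D1: "\<And>k x. norm (D k x) \<le> 1" and D5: "\<And>k. 5-lipschitz_on UNIV (D k)" by metis
  define f where "f k x = (a k)\<^sup>2 * alternating (\<xi>s k) ((1 / a k) *\<^sub>R x)" for k x
  define E where "E k x = a k *\<^sub>R D k ((1 / a k) *\<^sub>R x)" for k x
  define F where "F x = (\<Sum>k. (1/2) ^ k * f k x)" for x
  have f01: "\<bar>f k x\<bar> \<le> 1" for k x
    unfolding f_def using a[of k] alternating_bounds[of "\<xi>s k" "(1 / a k) *\<^sub>R x"]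
    by (simp add: abs_mult mult_le_one power_le_one)
  have "C11 F"
    unfolding F_def
  proof (rule C11_series[OF f01])
    fix k and x :: 'x
    have "((\<lambda>x. (1 / a k) *\<^sub>R x) has_derivative (\<lambda>h. (1 / a k) *\<^sub>R h)) (at x)"
      by (intro derivative_eq_intros) auto
    note has_derivative_mult_right[OF has_derivative_compose[OF this D[of k "(1 / a k) *\<^sub>R x"]], of "(a k)\<^sup>2"]
    moreover have "(\<lambda>h. (a k)\<^sup>2 * blinfun_apply (D k ((1 / a k) *\<^sub>R x)) ((1 / a k) *\<^sub>R h)) = blinfun_apply (E k x)"
      using a(1)[of k] by (auto simp: E_def blinfun.scaleR_left blinfun.scaleR_right power2_eq_square)
    ultimately show "(f k has_derivative blinfun_apply (E k x)) (at x)"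
      unfolding f_def[abs_def] by (simp only:)
    show "norm (E k x) \<le> 1"
      unfolding E_def using a[of k] D1[of k "(1 / a k) *\<^sub>R x"] by (simp add: mult_le_one)
  next
    fix k
    show "5-lipschitz_on UNIV (E k)"
    proof (rule lipschitz_onI)
      fix x y
      have "dist (E k x) (E k y) = a k * dist (D k ((1 / a k) *\<^sub>R x)) (D k ((1 / a k) *\<^sub>R y))"
        using a(1)[of k] by (simp add: E_def dist_norm flip: scaleR_right_diff_distrib)
      also have "\<dots> \<le> a k * (5 * dist ((1 / a k) *\<^sub>R x) ((1 / a k) *\<^sub>R y))"
        using a(1)[of k] lipschitz_onD[OF D5] by (intro mult_left_mono) auto
      also have "dist ((1 / a k) *\<^sub>R x) ((1 / a k) *\<^sub>R y) = dist x y / a k"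
        using a(1)[of k] by (simp add: dist_norm flip: scaleR_right_diff_distrib)
      finally show "dist (E k x) (E k y) \<le> 5 * dist x y" using a(1)[of k] by simp
    qed simp
  qed
  then have "delta_convex F" using Cdc unfolding property_Cdc_def by blast
  from delta_convex_tree[OF this] obtain \<rho> where \<rho>: "\<rho> > 0" and tree:
    "\<And>(N::nat) \<delta> P. \<exists>u. P 0 u \<Longrightarrow> (\<And>k u. k \<le> N \<Longrightarrow> P k u \<Longrightarrow> norm u \<le> \<rho>) \<Longrightarrow>
      (\<And>k u. k < N \<Longrightarrow> P k u \<Longrightarrow>
        \<exists>v. P (Suc k) (u + v) \<and> P (Suc k) (u - v) \<and>
            2 * \<delta> \<le> \<bar>F (u + v) + F (u - v) - 2 * F u\<bar>)
    \<Longrightarrow> real N * \<delta> \<le> 2" by metis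
  obtain m :: nat where m: "1 / \<rho> \<le> real m" using real_arch_simple by blast
  define k where "k = max 2 m"
  have k: "2 \<le> k" "1 / \<rho> \<le> real k + 1" using m by (auto simp: k_def)
  define P where "P l u \<longleftrightarrow> (\<exists>\<sigma>. (\<forall>i. \<bar>\<sigma> i\<bar> = 1) \<and> u = (a k * R k) *\<^sub>R (\<Sum>i<l. \<sigma> i *\<^sub>R e k i))" for l u
  define G where "G l = (\<Sum>j\<le>l. (- gate (R k)) ^ j)" for l
  have coord: "\<xi> j i ((1 / a k) *\<^sub>R (a k * R k) *\<^sub>R (\<Sum>i<l. \<sigma> i *\<^sub>R e k i)) = (if j = k \<and> i < l then R k * \<sigma> i else 0)"
    for j i l and \<sigma> :: "nat \<Rightarrow> real"
  proof -
    interpret \<xi>: bounded_linear "\<xi> j i" by (rule linear_\<xi>)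
    have "\<xi> j i (\<Sum>i<l. \<sigma> i *\<^sub>R e k i) = (\<Sum>i'<l. if i' = i then if j = k then \<sigma> i else 0 else 0)"
      unfolding \<xi>.sum \<xi>.scaleR by (intro sum.cong) (auto simp: \<xi>_e)
    also have "\<dots> = (if j = k \<and> i < l then \<sigma> i else 0)" by auto
    finally show ?thesis using a(1)[of k] by (simp add: \<xi>.scaleR)
  qed
  have F_node: "F u = (\<Sum>j. (1/2) ^ j * (a j)\<^sup>2) + (1/2) ^ k * ((a k)\<^sup>2 * G l - (a k)\<^sup>2)"
    if Pu: "P l u" and l: "l \<le> N k" for l u
  proof -
    obtain \<sigma> where \<sigma>: "\<forall>i. \<bar>\<sigma> i\<bar> = 1" and u: "u = (a k * R k) *\<^sub>R (\<Sum>i<l. \<sigma> i *\<^sub>R e k i)"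
      using Pu unfolding P_def by blast
    have sum: "summable (\<lambda>j. (1/2) ^ j * (a j)\<^sup>2)"
      by (rule summable_comparison_test'[of "\<lambda>j. (1/2) ^ j" 0])
        (use a in \<open>auto simp: abs_mult power_le_one less_imp_le intro!: mult_left_le\<close>)
    have zero: "alternating (\<xi>s j) ((1 / a j) *\<^sub>R u) = 1" if "j \<noteq> k" for j
    proof -
      have "\<xi> j i u = 0" for i
        using coord[where j = j and i = i and l = l and \<sigma> = \<sigma>] that a(1)[of k] linear_simps(5)[OF linear_\<xi>, of j i "1 / a k" u] u by simp
      then have "alternating (\<xi>s j) ((1 / a j) *\<^sub>R u) = (\<Sum>m\<le>0. (- gate 0) ^ m)"
        by (intro alternating_branch) (auto simp: \<xi>s_def \<xi>b linear_simps(5)[OF linear_\<xi>])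
      then show ?thesis by simp
    qed
    have "alternating (\<xi>s k) ((1 / a k) *\<^sub>R u) = G l"
      unfolding G_def u
    proof (rule alternating_branch)
      show "l \<le> length (\<xi>s k)" using l by (simp add: \<xi>s_def)
      show "\<bar>blinfun_apply (\<xi>s k ! i) ((1 / a k) *\<^sub>R (a k * R k) *\<^sub>R (\<Sum>i<l. \<sigma> i *\<^sub>R e k i))\<bar> = R k" if "i < l" for i
        using that l \<sigma> R1[of k] by (simp add: \<xi>s_def \<xi>b coord abs_mult del: scaleR_scaleR)
      show "blinfun_apply (\<xi>s k ! i) ((1 / a k) *\<^sub>R (a k * R k) *\<^sub>R (\<Sum>i<l. \<sigma> i *\<^sub>R e k i)) = 0"
        if "l \<le> i" "i < length (\<xi>s k)" for i
        using that by (simp add: \<xi>s_def \<xi>b coord del: scaleR_scaleR)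
    qed
    then have "f j u = (a j)\<^sup>2 + (if j = k then (a k)\<^sup>2 * G l - (a k)\<^sup>2 else 0)" for j
      using zero[of j] by (auto simp: f_def)
    then have "F u = (\<Sum>j. (1/2) ^ j * (a j)\<^sup>2 + (if j = k then (1/2) ^ k * ((a k)\<^sup>2 * G l - (a k)\<^sup>2) else 0))"
      unfolding F_def by (intro suminf_cong) (auto simp: algebra_simps)
    then show ?thesis
      using suminf_add[OF sum sums_summable[OF sums_single[of k "\<lambda>_. (1/2) ^ k * ((a k)\<^sup>2 * G l - (a k)\<^sup>2)"]]]
        sums_unique[OF sums_single[of k "\<lambda>_. (1/2) ^ k * ((a k)\<^sup>2 * G l - (a k)\<^sup>2)"]] by simp
  qed
  have open_gates: "1/2 \<le> gate (R k) ^ l" if "l \<le> N k" for l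
  proof -
    have "exp (R k) = 4 * real (N k)" using N1[of k] by (simp add: R_def)
    then have "2 * real (N k) \<le> cosh (R k)"
      by (simp add: cosh_field_def exp_minus)
    then have "1 / cosh (R k) \<le> 1 / (2 * real (N k))" using N1[of k] by (intro divide_left_mono) auto
    then have "real (N k) * (1 / cosh (R k)) \<le> 1/2" using N1[of k] by (simp add: field_simps)
    moreover have "1 - real (N k) * (1 / cosh (R k)) \<le> gate (R k) ^ N k"
      using cosh_real_ge_1[of "R k"] Bernoulli_inequality[of "- (1 / cosh (R k))" "N k"] by (simp add: gate_def)
    ultimately have "1/2 \<le> gate (R k) ^ N k" by linarith
    also have "\<dots> \<le> gate (R k) ^ l" using that gate_bounds[of "R k"] by (intro power_decreasing) auto
    finally show ?thesis .
  qed
  have "real (N k) * ((1/2) ^ k * (a k)\<^sup>2 / 2) \<le> 2"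
  proof (rule tree[of P])
    show "\<exists>u. P 0 u" by (auto simp: P_def intro: exI[of _ "\<lambda>_. 1"])
    show "norm u \<le> \<rho>" if "l \<le> N k" "P l u" for l u
    proof -
      obtain \<sigma> where \<sigma>: "\<forall>i. \<bar>\<sigma> i\<bar> = 1" and u: "u = (a k * R k) *\<^sub>R (\<Sum>i<l. \<sigma> i *\<^sub>R e k i)"
        using \<open>P l u\<close> unfolding P_def by blast
      have "norm u = a k * R k * norm (\<Sum>i<l. \<sigma> i *\<^sub>R e k i)" using a(1)[of k] R1[of k] by (simp add: u)
      also have "\<dots> \<le> a k * R k * real (N k) powr \<theta>"
        using a(1)[of k] R1[of k] \<theta>(1) \<open>l \<le> N k\<close>
        by (intro mult_left_mono order_trans[OF flat[OF \<sigma>]] powr_mono2) auto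
      also have "\<dots> = 1 / (real k + 1)"
        using R1[of k] N\<theta>[of k] N1[of k] by (simp add: a_def)
      also have "\<dots> \<le> \<rho>" using k(2) \<rho> by (simp add: field_simps)
      finally show ?thesis .
    qed
    fix l u assume l: "l < N k" and Pu: "P l u"
    obtain \<sigma> where \<sigma>: "\<forall>i. \<bar>\<sigma> i\<bar> = 1" and u: "u = (a k * R k) *\<^sub>R (\<Sum>i<l. \<sigma> i *\<^sub>R e k i)"
      using Pu unfolding P_def by blast
    define v where "v = (a k * R k) *\<^sub>R e k l"
    have Pv: "P (Suc l) (u + v)" "P (Suc l) (u - v)"
    proof -
      have uv: "u + v = (a k * R k) *\<^sub>R (\<Sum>i<Suc l. (\<sigma>(l := 1)) i *\<^sub>R e k i)"
        "u - v = (a k * R k) *\<^sub>R (\<Sum>i<Suc l. (\<sigma>(l := - 1)) i *\<^sub>R e k i)"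
        unfolding u v_def by (simp_all add: scaleR_right_distrib scaleR_right_diff_distrib)
      show "P (Suc l) (u + v)"
        unfolding P_def using uv(1) \<sigma> by (intro exI[of _ "\<sigma>(l := 1)"] conjI) simp_all
      show "P (Suc l) (u - v)"
        unfolding P_def using uv(2) \<sigma> by (intro exI[of _ "\<sigma>(l := - 1)"] conjI) simp_all
    qed
    have "F (u + v) + F (u - v) - 2 * F u = (1/2) ^ k * (a k)\<^sup>2 * (2 * (G (Suc l) - G l))"
      using F_node[OF Pu] F_node[OF Pv(1)] F_node[OF Pv(2)] l by (simp add: algebra_simps)
    moreover have "\<bar>G (Suc l) - G l\<bar> = gate (R k) ^ Suc l"
      using gate_bounds[of "R k"] by (simp add: G_def abs_mult power_abs)
    moreover have "1/2 \<le> gate (R k) ^ Suc l" using l by (intro open_gates) auto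
    ultimately have "\<bar>F (u + v) + F (u - v) - 2 * F u\<bar> \<ge> (1/2) ^ k * (a k)\<^sup>2 * (2 * (1/2))"
      by (simp only: abs_mult) (intro mult_mono; simp)
    then show "\<exists>v. P (Suc l) (u + v) \<and> P (Suc l) (u - v) \<and>
        2 * ((1/2) ^ k * (a k)\<^sup>2 / 2) \<le> \<bar>F (u + v) + F (u - v) - 2 * F u\<bar>"
      using Pv by (intro exI[of _ v]) auto
  qed
  then have "real (N k) * (a k)\<^sup>2 \<le> 4 * 2 ^ k" by (simp add: field_simps)
  moreover have "8 ^ k \<le> real (N k) * (a k)\<^sup>2"
  proof -
    have "real (N k) powr (1 - 2 * \<theta>) * (real (N k) powr \<theta>)\<^sup>2 = real (N k)"
      using N1[of k] by (simp add: power2_eq_square flip: powr_add)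
    moreover have "8 ^ k * ((real k + 1) * R k)\<^sup>2 * (real (N k) powr \<theta>)\<^sup>2
        \<le> real (N k) powr (1 - 2 * \<theta>) * (real (N k) powr \<theta>)\<^sup>2"
      using less_imp_le[OF N[of k]] by (intro mult_right_mono) (auto simp: R_def power_mult_distrib mult_ac)
    ultimately have "8 ^ k * ((real k + 1) * R k * real (N k) powr \<theta>)\<^sup>2 \<le> real (N k)"
      by (simp add: power_mult_distrib mult_ac)
    then show ?thesis using den[of k] by (simp add: a_def power_divide field_simps)
  qed
  ultimately have "8 ^ k \<le> 4 * (2::real) ^ k" by linarith
  moreover have "(8::real) ^ k = 4 ^ k * 2 ^ k" by (simp flip: power_mult_distrib)
  ultimately have "(4::real) ^ k \<le> 4" by simp
  moreover have "(4::real) ^ 2 \<le> 4 ^ k" using k(1) by (intro power_increasing) auto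
  ultimately show False by simp
qed

section \<open>Grothendieck's inequality for quadratic forms on a finite-dimensional lattice\<close>

fun sign_sums :: "'v::ab_group_add list \<Rightarrow> 'v list" where
  "sign_sums [] = [0]"
| "sign_sums (x # xs) = map (\<lambda>s. s + x) (sign_sums xs) @ map (\<lambda>s. s - x) (sign_sums xs)"

lemma length_sign_sums: "length (sign_sums xs) = 2 ^ length xs"
  by (induction xs) auto

lemma sum_list_sign_sums:
  fixes q :: "'v::ab_group_add \<Rightarrow> real"
  assumes par: "\<And>x y. q (x + y) + q (x - y) = 2 * q x + 2 * q y" and zero: "q 0 = 0"
  shows "(\<Sum>s\<leftarrow>sign_sums xs. q s) = 2 ^ length xs * (\<Sum>x\<leftarrow>xs. q x)"
proof (induction xs)
  case (Cons x xs)
  have "(\<Sum>s\<leftarrow>sign_sums (x # xs). q s) = (\<Sum>s\<leftarrow>sign_sums xs. q (s + x) + q (s - x))"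
    by (simp add: o_def sum_list_addf)
  also have "\<dots> = 2 * (\<Sum>s\<leftarrow>sign_sums xs. q s) + 2 ^ length (x # xs) * q x"
    by (simp add: par sum_list_addf sum_list_const_mult sum_list_triv length_sign_sums)
  finally show ?case using Cons.IH by (simp add: algebra_simps)
qed (simp add: zero)

lemma sum_list_sign_sums_power4:
  fixes xs :: "('j \<Rightarrow> real) list"
  shows "(\<Sum>s\<leftarrow>sign_sums xs. (s j) ^ 4) \<le> 2 ^ length xs * (3 * (\<Sum>x\<leftarrow>xs. (x j)\<^sup>2)\<^sup>2)"
proof (induction xs)
  case (Cons x xs)
  define V where "V = (\<Sum>x\<leftarrow>xs. (x j)\<^sup>2)"
  have V: "0 \<le> V" unfolding V_def by (induction xs) auto
  have *: "(\<Sum>s\<leftarrow>sign_sums xs. (s j)\<^sup>2) = 2 ^ length xs * V"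
    unfolding V_def by (rule sum_list_sign_sums) (auto simp: power2_eq_square algebra_simps)
  have "(\<Sum>s\<leftarrow>sign_sums (x # xs). (s j) ^ 4) = (\<Sum>s\<leftarrow>sign_sums xs. (s j + x j) ^ 4 + (s j - x j) ^ 4)"
    by (simp add: o_def sum_list_addf)
  also have "\<dots> = (\<Sum>s\<leftarrow>sign_sums xs. 2 * (s j) ^ 4 + (12 * (x j)\<^sup>2) * (s j)\<^sup>2 + 2 * (x j) ^ 4)"
    by (intro arg_cong[where f = sum_list] map_cong refl) (simp add: power4_eq_xxxx power2_eq_square algebra_simps)
  also have "\<dots> = 2 * (\<Sum>s\<leftarrow>sign_sums xs. (s j) ^ 4) + (12 * (x j)\<^sup>2) * (2 ^ length xs * V)
      + 2 ^ length xs * (2 * (x j) ^ 4)"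
    by (simp only: sum_list_addf sum_list_const_mult sum_list_triv length_sign_sums * of_nat_power of_nat_numeral)
  also have "\<dots> \<le> 2 * (2 ^ length xs * (3 * V\<^sup>2)) + (12 * (x j)\<^sup>2) * (2 ^ length xs * V)
      + 2 ^ length xs * (6 * (x j) ^ 4)"
    using Cons.IH V by (intro add_mono mult_left_mono) (auto simp: V_def)
  also have "\<dots> = 2 ^ length (x # xs) * (3 * ((x j)\<^sup>2 + V)\<^sup>2)"
    by (simp add: power4_eq_xxxx power2_eq_square algebra_simps)
  finally show ?case by (simp add: V_def)
qed simp

definition square_function :: "('j \<Rightarrow> real) list \<Rightarrow> 'j \<Rightarrow> real" where
  "square_function as j = sqrt (\<Sum>a\<leftarrow>as. (a j)\<^sup>2)"

lemma square_function_nonneg: "0 \<le> square_function as j"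
  unfolding square_function_def by (auto intro!: sum_list_nonneg)

lemma square_function_squared: "(square_function as j)\<^sup>2 = (\<Sum>a\<leftarrow>as. (a j)\<^sup>2)"
  unfolding square_function_def by (auto intro!: real_sqrt_pow2 sum_list_nonneg)

lemma abs_sum_list_le: "\<bar>\<Sum>x\<leftarrow>xs. f x\<bar> \<le> (\<Sum>x\<leftarrow>xs. \<bar>f x :: real\<bar>)"
  by (induction xs) (auto intro: order_trans[OF abs_triangle_ineq])

lemma sum_list_abs_mult_le_square_function:
  "(\<Sum>a\<leftarrow>as. \<bar>a j\<bar> * \<bar>a k\<bar>) \<le> square_function as j * square_function as k"
proof -
  have *: "(\<Sum>a\<leftarrow>as. f a) = (\<Sum>i<length as. f (as ! i))" for f :: "_ \<Rightarrow> real"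
    by (simp add: sum_list_sum_nth lessThan_atLeast0)
  have "(\<Sum>i<length as. \<bar>(as ! i) j\<bar> * \<bar>(as ! i) k\<bar>)\<^sup>2
      \<le> (\<Sum>i<length as. \<bar>(as ! i) j\<bar>\<^sup>2) * (\<Sum>i<length as. \<bar>(as ! i) k\<bar>\<^sup>2)"
    by (rule Cauchy_Schwarz_ineq_sum)
  then have "(\<Sum>a\<leftarrow>as. \<bar>a j\<bar> * \<bar>a k\<bar>)\<^sup>2 \<le> (square_function as j * square_function as k)\<^sup>2"
    by (simp add: * power_mult_distrib square_function_squared)
  then show ?thesis by (rule power2_le_imp_le) (simp add: square_function_nonneg)
qed

text \<open>
  The mean of \<open>q\<close> over all sign sums of a family is the sum of \<open>q\<close> over
  the family. Truncate a sign sum at \<open>20\<close> times the square function \<open>\<sigma>\<close> of the family: the truncated part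
  is pointwise at most \<open>20 \<sigma>\<close>, so that the bound on \<open>q\<close> suffices for it, and by the fourth
  moment estimate the quadratic mean of the remaining parts is at most \<open>\<sigma> / 10\<close>, so that the inequality
  itself can be applied to them with only a small part of its constant \<open>\<kappa>\<close>. Hence \<open>\<kappa>\<close> may be replaced by
  \<open>440 + \<kappa> * 31/100\<close>, and iteration removes the dimension from a constant that
  is finite for trivial reasons.
\<close>

locale lattice_form =
  fixes J :: "'j set" and B :: "'j \<Rightarrow> 'j \<Rightarrow> real" and nm :: "('j \<Rightarrow> real) \<Rightarrow> real"
  assumes finite_J: "finite J"
    and nm_mono: "(\<And>j. j \<in> J \<Longrightarrow> \<bar>a j\<bar> \<le> \<bar>a' j\<bar>) \<Longrightarrow> nm a \<le> nm a'"
    and nm_scale: "nm (\<lambda>j. c * a j) = \<bar>c\<bar> * nm a"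
    and nm_nonneg: "0 \<le> nm a"
    and form_bound: "\<bar>\<Sum>j\<in>J. \<Sum>k\<in>J. B j k * a j * a' k\<bar> \<le> nm a * nm a'"
begin

definition q :: "('j \<Rightarrow> real) \<Rightarrow> real" where
  "q a = (\<Sum>j\<in>J. \<Sum>k\<in>J. B j k * a j * a k)"

lemma q_parallelogram: "q (a + c) + q (a - c) = 2 * q a + 2 * q c"
  unfolding q_def sum_distrib_left sum.distrib[symmetric]
  by (intro sum.cong refl) (simp add: algebra_simps)

lemma q_zero: "q 0 = 0"
  by (simp add: q_def)

text \<open>Expressing the mixed term by values of \<open>q\<close> makes it accessible to the inequality under proof.\<close>

lemma q_add:
  assumes "r \<noteq> 0"
  shows "q (a + c) = (1 + r\<^sup>2) * q a + (1 + 1 / r\<^sup>2) * q c - q (\<lambda>j. r * a j - c j / r)"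
  unfolding q_def sum_distrib_left sum.distrib[symmetric] sum_subtractf[symmetric]
  using assms by (intro sum.cong refl) (simp add: field_simps power2_eq_square)

lemma q_bound: "\<bar>q a\<bar> \<le> (nm a)\<^sup>2"
  using form_bound[of a a] by (simp add: q_def power2_eq_square)

lemma coefficient_bound:
  assumes "j \<in> J" "k \<in> J"
  shows "\<bar>B j k\<bar> * \<bar>a j\<bar> * \<bar>a k\<bar> \<le> (nm a)\<^sup>2"
proof -
  define u where "u i l = (if l = i then a l else 0)" for i l :: 'j
  have "(\<Sum>j'\<in>J. \<Sum>k'\<in>J. B j' k' * u j j' * u k k')
      = (\<Sum>j'\<in>J. \<Sum>k'\<in>J. if k' = k then if j' = j then B j k * a j * a k else 0 else 0)"
    by (intro sum.cong refl) (auto simp: u_def)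
  also have "\<dots> = B j k * a j * a k" using assms finite_J by simp
  finally have "\<bar>B j k * a j * a k\<bar> \<le> nm (u j) * nm (u k)" using form_bound[of "u j" "u k"] by simp
  also have "\<dots> \<le> nm a * nm a" by (intro mult_mono nm_mono nm_nonneg) (auto simp: u_def)
  finally show ?thesis by (simp add: abs_mult power2_eq_square)
qed

definition admissible :: "real \<Rightarrow> bool" where
  "admissible \<kappa> \<longleftrightarrow> (\<forall>as. \<bar>\<Sum>a\<leftarrow>as. q a\<bar> \<le> \<kappa> * (nm (square_function as))\<^sup>2)"

lemma admissible_card: "admissible ((real (card J))\<^sup>2)"
  unfolding admissible_def
proof
  fix as :: "('j \<Rightarrow> real) list"
  define \<sigma> where "\<sigma> = square_function as"
  have "\<bar>\<Sum>a\<leftarrow>as. q a\<bar> \<le> (\<Sum>a\<leftarrow>as. \<bar>q a\<bar>)" by (rule abs_sum_list_le)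
  also have "\<dots> \<le> (\<Sum>a\<leftarrow>as. \<Sum>j\<in>J. \<Sum>k\<in>J. \<bar>B j k\<bar> * (\<bar>a j\<bar> * \<bar>a k\<bar>))"
    unfolding q_def
    by (intro sum_list_mono order_trans[OF sum_abs] sum_mono) (simp add: abs_mult mult.assoc)
  also have "\<dots> = (\<Sum>j\<in>J. \<Sum>k\<in>J. \<bar>B j k\<bar> * (\<Sum>a\<leftarrow>as. \<bar>a j\<bar> * \<bar>a k\<bar>))"
    by (induction as) (simp_all add: sum.distrib algebra_simps)
  also have "\<dots> \<le> (\<Sum>j\<in>J. \<Sum>k\<in>J. (nm \<sigma>)\<^sup>2)"
  proof (intro sum_mono)
    fix j k assume jk: "j \<in> J" "k \<in> J"
    have "\<bar>B j k\<bar> * (\<Sum>a\<leftarrow>as. \<bar>a j\<bar> * \<bar>a k\<bar>) \<le> \<bar>B j k\<bar> * (\<sigma> j * \<sigma> k)"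
      unfolding \<sigma>_def by (intro mult_left_mono sum_list_abs_mult_le_square_function) auto
    also have "\<dots> \<le> (nm \<sigma>)\<^sup>2"
      using coefficient_bound[OF jk, of \<sigma>] by (simp add: \<sigma>_def square_function_nonneg mult.assoc)
    finally show "\<bar>B j k\<bar> * (\<Sum>a\<leftarrow>as. \<bar>a j\<bar> * \<bar>a k\<bar>) \<le> (nm \<sigma>)\<^sup>2" .
  qed
  finally show "\<bar>\<Sum>a\<leftarrow>as. q a\<bar> \<le> (real (card J))\<^sup>2 * (nm (square_function as))\<^sup>2"
    by (simp add: \<sigma>_def power2_eq_square mult_ac)
qed

lemma admissible_family:
  assumes "admissible \<kappa>" "0 \<le> \<kappa>" "0 \<le> C"
    and le: "\<And>j. (\<Sum>s\<leftarrow>ss. (f s j)\<^sup>2) \<le> C * (\<sigma> j)\<^sup>2"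
  shows "\<bar>\<Sum>s\<leftarrow>ss. q (f s)\<bar> \<le> \<kappa> * (C * (nm \<sigma>)\<^sup>2)"
proof -
  have "square_function (map f ss) j \<le> sqrt C * \<bar>\<sigma> j\<bar>" for j
    using real_sqrt_le_mono[OF le[of j]] by (simp add: square_function_def o_def real_sqrt_mult)
  then have "nm (square_function (map f ss)) \<le> nm (\<lambda>j. sqrt C * \<sigma> j)"
    using assms(3) by (intro nm_mono) (simp add: abs_mult square_function_nonneg)
  also have "\<dots> = sqrt C * nm \<sigma>" using assms(3) by (simp add: nm_scale)
  finally have "(nm (square_function (map f ss)))\<^sup>2 \<le> (sqrt C * nm \<sigma>)\<^sup>2"
    by (intro power_mono nm_nonneg)
  then have "(nm (square_function (map f ss)))\<^sup>2 \<le> C * (nm \<sigma>)\<^sup>2"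
    using assms(3) by (simp add: power_mult_distrib)
  moreover have "\<bar>\<Sum>s\<leftarrow>ss. q (f s)\<bar> \<le> \<kappa> * (nm (square_function (map f ss)))\<^sup>2"
    using assms(1)[unfolded admissible_def, rule_format, of "map f ss"] by (simp add: o_def)
  ultimately show ?thesis
    using mult_left_mono[OF _ assms(2), of "(nm (square_function (map f ss)))\<^sup>2"] by fastforce
qed

lemma admissible_improve:
  assumes adm: "admissible \<kappa>" and \<kappa>: "0 \<le> \<kappa>"
  shows "admissible (440 + \<kappa> * 31 / 100)"
  unfolding admissible_def
proof
  fix as :: "('j \<Rightarrow> real) list"
  define \<sigma> where "\<sigma> = square_function as"
  define ss where "ss = sign_sums as"
  define n :: real where "n = 2 ^ length as"
  have n: "n > 0" by (simp add: n_def)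
  define low where "low s j = (if \<bar>s j\<bar> \<le> 20 * \<sigma> j then s j else 0)" for s :: "'j \<Rightarrow> real" and j
  define high where "high s j = (if \<bar>s j\<bar> \<le> 20 * \<sigma> j then 0 else s j)" for s :: "'j \<Rightarrow> real" and j
  have split: "s = low s + high s" for s by (auto simp: low_def high_def fun_eq_iff)
  (* With this weight the square function of r low - high / r is a small multiple of \<sigma> as well. *)
  define r where "r = sqrt (1/10 :: real)"
  have r: "r \<noteq> 0" "r\<^sup>2 = 1/10" by (simp_all add: r_def)
  have \<sigma>0: "0 \<le> \<sigma> j" for j by (simp add: \<sigma>_def square_function_nonneg)
  have moment2: "(\<Sum>s\<leftarrow>ss. (s j)\<^sup>2) = n * (\<sigma> j)\<^sup>2" for j
    unfolding ss_def n_def \<sigma>_def square_function_squared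
    by (rule sum_list_sign_sums) (auto simp: power2_eq_square algebra_simps)
  have moment4: "(\<Sum>s\<leftarrow>ss. (s j) ^ 4) \<le> n * (3 * ((\<sigma> j)\<^sup>2)\<^sup>2)" for j
    unfolding ss_def n_def \<sigma>_def square_function_squared by (rule sum_list_sign_sums_power4)
  have low2: "(\<Sum>s\<leftarrow>ss. (low s j)\<^sup>2) \<le> n * (\<sigma> j)\<^sup>2" for j
    unfolding moment2[symmetric] by (intro sum_list_mono) (auto simp: low_def)
  have high2: "(\<Sum>s\<leftarrow>ss. (high s j)\<^sup>2) \<le> n / 100 * (\<sigma> j)\<^sup>2" for j
  proof (cases "\<sigma> j = 0")
    case True
    have "(\<Sum>s\<leftarrow>ss. (high s j)\<^sup>2) \<le> (\<Sum>s\<leftarrow>ss. (s j)\<^sup>2)" by (intro sum_list_mono) (auto simp: high_def)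
    then show ?thesis using True by (simp add: moment2)
  next
    case False
    have "400 * (\<sigma> j)\<^sup>2 * (high s j)\<^sup>2 \<le> (s j) ^ 4" for s
    proof (cases "\<bar>s j\<bar> \<le> 20 * \<sigma> j")
      case False
      then have "(20 * \<sigma> j)\<^sup>2 \<le> \<bar>s j\<bar>\<^sup>2" using \<sigma>0[of j] by (intro power_mono) auto
      then have "(20 * \<sigma> j)\<^sup>2 * (s j)\<^sup>2 \<le> (s j)\<^sup>2 * (s j)\<^sup>2" by (intro mult_right_mono) auto
      then show ?thesis using False by (simp add: high_def power_mult_distrib flip: power_add)
    qed (simp add: high_def)
    then have "(\<Sum>s\<leftarrow>ss. 400 * (\<sigma> j)\<^sup>2 * (high s j)\<^sup>2) \<le> (\<Sum>s\<leftarrow>ss. (s j) ^ 4)"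
      by (intro sum_list_mono)
    then have "400 * (\<sigma> j)\<^sup>2 * (\<Sum>s\<leftarrow>ss. (high s j)\<^sup>2) \<le> n * (3 * ((\<sigma> j)\<^sup>2)\<^sup>2)"
      using moment4[of j] by (simp add: sum_list_const_mult)
    then have "(\<sigma> j)\<^sup>2 * (400 * (\<Sum>s\<leftarrow>ss. (high s j)\<^sup>2)) \<le> (\<sigma> j)\<^sup>2 * (n * (3 * (\<sigma> j)\<^sup>2))"
      by (simp add: power2_eq_square mult_ac)
    then have "400 * (\<Sum>s\<leftarrow>ss. (high s j)\<^sup>2) \<le> n * (3 * (\<sigma> j)\<^sup>2)"
      using False by (simp add: mult_le_cancel_left)
    moreover have "0 \<le> n * (\<sigma> j)\<^sup>2" using n by simp
    ultimately show ?thesis by (simp add: algebra_simps)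
  qed
  have mix2: "(\<Sum>s\<leftarrow>ss. (r * low s j - high s j / r)\<^sup>2) \<le> n / 5 * (\<sigma> j)\<^sup>2" for j
  proof -
    have "(r * low s j - high s j / r)\<^sup>2 = (1/10) * (low s j)\<^sup>2 + 10 * (high s j)\<^sup>2" for s
      by (auto simp: low_def high_def power_mult_distrib power_divide r)
    then have "(\<Sum>s\<leftarrow>ss. (r * low s j - high s j / r)\<^sup>2)
        = (1/10) * (\<Sum>s\<leftarrow>ss. (low s j)\<^sup>2) + 10 * (\<Sum>s\<leftarrow>ss. (high s j)\<^sup>2)"
      by (simp only: sum_list_addf sum_list_const_mult)
    then show ?thesis using low2[of j] high2[of j] by simp
  qed
  have "\<bar>q (low s)\<bar> \<le> 400 * (nm \<sigma>)\<^sup>2" for s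
  proof -
    have "nm (low s) \<le> nm (\<lambda>j. 20 * \<sigma> j)" using \<sigma>0 by (intro nm_mono) (auto simp: low_def)
    then have "(nm (low s))\<^sup>2 \<le> (20 * nm \<sigma>)\<^sup>2" unfolding nm_scale by (intro power_mono nm_nonneg) simp
    then show ?thesis using q_bound[of "low s"] by (simp add: power_mult_distrib)
  qed
  then have "(\<Sum>s\<leftarrow>ss. \<bar>q (low s)\<bar>) \<le> (\<Sum>s\<leftarrow>ss. 400 * (nm \<sigma>)\<^sup>2)" by (intro sum_list_mono)
  then have 1: "\<bar>\<Sum>s\<leftarrow>ss. q (low s)\<bar> \<le> n * (400 * (nm \<sigma>)\<^sup>2)"
    using abs_sum_list_le[of "\<lambda>s. q (low s)" ss]
    by (simp add: sum_list_triv ss_def length_sign_sums n_def)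
  have 2: "\<bar>\<Sum>s\<leftarrow>ss. q (high s)\<bar> \<le> \<kappa> * (n / 100 * (nm \<sigma>)\<^sup>2)"
    using n by (intro admissible_family adm \<kappa> high2) auto
  have 3: "\<bar>\<Sum>s\<leftarrow>ss. q (\<lambda>j. r * low s j - high s j / r)\<bar> \<le> \<kappa> * (n / 5 * (nm \<sigma>)\<^sup>2)"
    using n by (intro admissible_family adm \<kappa> mix2) auto
  have "n * (\<Sum>a\<leftarrow>as. q a) = (\<Sum>s\<leftarrow>ss. q s)"
    unfolding n_def ss_def by (rule sum_list_sign_sums[where q = q, OF q_parallelogram q_zero, symmetric])
  also have "\<dots> = (\<Sum>s\<leftarrow>ss. 11/10 * q (low s) + 11 * q (high s) - q (\<lambda>j. r * low s j - high s j / r))"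
  proof (intro arg_cong[where f = sum_list] map_cong refl)
    fix s
    show "q s = 11/10 * q (low s) + 11 * q (high s) - q (\<lambda>j. r * low s j - high s j / r)"
      using q_add[OF r(1), of "low s" "high s"] by (simp add: r(2) split[symmetric])
  qed
  also have "\<dots> = 11/10 * (\<Sum>s\<leftarrow>ss. q (low s)) + 11 * (\<Sum>s\<leftarrow>ss. q (high s))
      - (\<Sum>s\<leftarrow>ss. q (\<lambda>j. r * low s j - high s j / r))"
    by (simp only: sum_list_subtractf sum_list_addf sum_list_const_mult)
  finally have "\<bar>n * (\<Sum>a\<leftarrow>as. q a)\<bar> \<le> 11/10 * (n * (400 * (nm \<sigma>)\<^sup>2)) + 11 * (\<kappa> * (n / 100 * (nm \<sigma>)\<^sup>2))
      + \<kappa> * (n / 5 * (nm \<sigma>)\<^sup>2)"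
    using 1 2 3 by linarith
  also have "\<dots> = n * ((440 + \<kappa> * 31 / 100) * (nm \<sigma>)\<^sup>2)" by (simp add: algebra_simps)
  finally show "\<bar>\<Sum>a\<leftarrow>as. q a\<bar> \<le> (440 + \<kappa> * 31 / 100) * (nm (square_function as))\<^sup>2"
    using n by (simp add: abs_mult \<sigma>_def)
qed

theorem grothendieck: "\<bar>\<Sum>a\<leftarrow>as. q a\<bar> \<le> 1000 * (nm (square_function as))\<^sup>2"
proof -
  have mono: "admissible \<kappa>'" if "admissible \<kappa>" "\<kappa> \<le> \<kappa>'" for \<kappa> \<kappa>'
    using that unfolding admissible_def by (meson mult_right_mono order_trans zero_le_power2)
  define c where "c = (real (card J))\<^sup>2"
  have c: "0 \<le> c" by (simp add: c_def)
  have "admissible (1000 + (31/100) ^ m * c)" for m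
  proof (induction m)
    case 0 show ?case using mono[OF admissible_card, of "1000 + c"] by (simp add: c_def)
  next
    case (Suc m)
    have "admissible (440 + (1000 + (31/100) ^ m * c) * 31 / 100)"
      by (rule admissible_improve[OF Suc]) (use c in auto)
    then show ?case by (rule mono) simp
  qed
  then have "\<bar>\<Sum>a\<leftarrow>as. q a\<bar> \<le> (1000 + (31/100) ^ m * c) * (nm (square_function as))\<^sup>2" for m
    unfolding admissible_def by blast
  moreover have "(\<lambda>m. (1000 + (31/100) ^ m * c) * (nm (square_function as))\<^sup>2)
      \<longlonglongrightarrow> (1000 + 0 * c) * (nm (square_function as))\<^sup>2"
    by (intro tendsto_intros LIMSEQ_realpow_zero) auto
  ultimately show ?thesis by (intro LIMSEQ_le_const[of _ _ "\<bar>\<Sum>a\<leftarrow>as. q a\<bar>"]) auto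
qed

end

section \<open>Inequalities for powers\<close>

lemma powr_convex_combination:
  fixes a b s t q :: real
  assumes "1 \<le> q" "0 \<le> a" "0 \<le> b" "0 < s" "0 < t" "s + t = 1"
  shows "(s * a + t * b) powr q \<le> s * a powr q + t * b powr q"
proof -
  have shrink: "(s * a) powr q \<le> s * a powr q" if "0 < s" "s \<le> 1" "0 \<le> a" for s a :: real
  proof -
    have "s powr q \<le> s powr 1" using that assms(1) by (intro powr_mono') auto
    then show ?thesis using that by (simp add: powr_mult mult_right_mono)
  qed
  consider "a = 0" | "b = 0" | "a > 0" "b > 0" using assms by fastforce
  then show ?thesis
  proof cases
    case 3
    then show ?thesis
      using convex_onD[OF powr_convex[OF assms(1)], of t a b] assms by (simp add: eq_diff_eq[symmetric])
  qed (use shrink[of t b] shrink[of s a] assms in auto)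
qed

lemma powr_concave_combination:
  fixes a b s t q :: real
  assumes "0 < q" "q \<le> 1" "0 \<le> a" "0 \<le> b" "0 < s" "0 < t" "s + t = 1"
  shows "s * a powr q + t * b powr q \<le> (s * a + t * b) powr q"
proof -
  have "(s * a powr q + t * b powr q) powr (1 / q) \<le> s * (a powr q) powr (1 / q) + t * (b powr q) powr (1 / q)"
    using assms by (intro powr_convex_combination) auto
  also have "\<dots> = s * a + t * b" using assms by (simp add: powr_powr)
  finally have "((s * a powr q + t * b powr q) powr (1 / q)) powr q \<le> (s * a + t * b) powr q"
    using assms by (intro powr_mono2) auto
  then show ?thesis using assms by (simp add: powr_powr add_nonneg_nonneg)
qed

text \<open>
  The second derivative of \<open>(1 + t)\<^sup>p + (1 - t)\<^sup>p\<close> is \<open>p (p - 1)\<close> times a sum of two powers with the exponent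
  \<open>q = p - 2 \<le> 0\<close>. Their product \<open>(1 - t\<^sup>2)\<^sup>q\<close> is at least \<open>1\<close>, so their sum is at least \<open>2\<close>, and
  integrating twice gives a quadratic lower bound.
\<close>

lemma powr_sum_ge_two:
  fixes t q :: real
  assumes "q \<le> 0" "0 \<le> t" "t < 1"
  shows "2 \<le> (1 + t) powr q + (1 - t) powr q"
proof -
  have "1 = ((1 + t) * (1 - t)) powr 0" using assms by simp
  also have "\<dots> \<le> ((1 + t) * (1 - t)) powr q"
    using assms by (intro powr_mono') (auto simp: algebra_simps mult_le_one)
  finally have *: "1 \<le> (1 + t) powr q * (1 - t) powr q" using assms by (simp add: powr_mult)
  define x y where "x = (1 + t) powr q" and "y = (1 - t) powr q"
  have "0 \<le> (x - y)\<^sup>2" by simp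
  then have "4 \<le> (x + y)\<^sup>2" using * unfolding x_def[symmetric] y_def[symmetric]
    by (simp add: power2_eq_square algebra_simps)
  then have "2\<^sup>2 \<le> (x + y)\<^sup>2" by simp
  then show ?thesis unfolding x_def y_def by (rule power2_le_imp_le) simp
qed

lemma powr_sum_lower_bound_open:
  fixes p t :: real
  assumes p: "1 < p" "p \<le> 2" and t: "0 \<le> t" "t < 1"
  shows "2 + p * (p - 1) * t\<^sup>2 \<le> (1 + t) powr p + (1 - t) powr p"
proof -
  have first: "2 * (p - 1) * u \<le> (1 + u) powr (p - 1) - (1 - u) powr (p - 1)" if u: "0 \<le> u" "u < 1" for u
  proof -
    define g where "g u = (1 + u) powr (p - 1) - (1 - u) powr (p - 1) - 2 * (p - 1) * u" for u
    have "g 0 \<le> g u"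
    proof (rule DERIV_nonneg_imp_nondecreasing[OF u(1)])
      fix z assume z: "0 \<le> z" "z \<le> u"
      have "(g has_real_derivative (p - 1) * ((1 + z) powr (p - 2) + (1 - z) powr (p - 2) - 2)) (at z)"
        unfolding g_def using z u by (auto intro!: derivative_eq_intros simp: algebra_simps)
      moreover have "0 \<le> (p - 1) * ((1 + z) powr (p - 2) + (1 - z) powr (p - 2) - 2)"
        using powr_sum_ge_two[of "p - 2" z] z u p by simp
      ultimately show "\<exists>y. (g has_real_derivative y) (at z) \<and> 0 \<le> y" by blast
    qed
    then show ?thesis by (simp add: g_def)
  qed
  define h where "h u = (1 + u) powr p + (1 - u) powr p - p * (p - 1) * u\<^sup>2" for u
  have "h 0 \<le> h t"
  proof (rule DERIV_nonneg_imp_nondecreasing[OF t(1)])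
    fix z assume z: "0 \<le> z" "z \<le> t"
    have "(h has_real_derivative p * ((1 + z) powr (p - 1) - (1 - z) powr (p - 1) - 2 * (p - 1) * z)) (at z)"
      unfolding h_def using z t by (auto intro!: derivative_eq_intros simp: algebra_simps)
    moreover have "0 \<le> p * ((1 + z) powr (p - 1) - (1 - z) powr (p - 1) - 2 * (p - 1) * z)"
      using first[of z] z t p by simp
    ultimately show "\<exists>y. (h has_real_derivative y) (at z) \<and> 0 \<le> y" by blast
  qed
  then show ?thesis by (simp add: h_def)
qed

lemma powr_sum_lower_bound:
  fixes p t :: real
  assumes p: "1 < p" "p \<le> 2" and t: "\<bar>t\<bar> \<le> 1"
  shows "2 * (1 + (p - 1) * t\<^sup>2) powr (p / 2) \<le> \<bar>1 + t\<bar> powr p + \<bar>1 - t\<bar> powr p"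
proof -
  have main: "2 * (1 + (p - 1) * t\<^sup>2) powr (p / 2) \<le> (1 + t) powr p + (1 - t) powr p"
    if t: "0 \<le> t" "t < 1" for t
  proof -
    have "(1 + (p - 1) * t\<^sup>2) powr (p / 2) \<le> 1 + (p / 2) * ((p - 1) * t\<^sup>2)"
    proof (cases "p = 2")
      case False
      have "(1 + (p - 1) * t\<^sup>2) powr (p / 2) * 1 powr (1 - p / 2) \<le> (p / 2) * (1 + (p - 1) * t\<^sup>2) + (1 - p / 2) * 1"
        using p False by (intro Youngs_inequality_0 add_pos_nonneg) auto
      then show ?thesis by (simp add: algebra_simps)
    qed simp
    then have "2 * (1 + (p - 1) * t\<^sup>2) powr (p / 2) \<le> 2 + p * (p - 1) * t\<^sup>2"
      by (simp add: algebra_simps)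
    also have "\<dots> \<le> (1 + t) powr p + (1 - t) powr p" by (rule powr_sum_lower_bound_open[OF p t])
    finally show ?thesis .
  qed
  have closed: "2 * (1 + (p - 1) * t\<^sup>2) powr (p / 2) \<le> \<bar>1 + t\<bar> powr p + \<bar>1 - t\<bar> powr p"
    if t: "0 \<le> t" "t \<le> 1" for t
  proof (cases "t = 1")
    case True
    define u where "u n = 1 - 1 / real (Suc (Suc n))" for n
    have u: "0 \<le> u n" "u n < 1" for n by (auto simp: u_def field_simps)
    have lim: "u \<longlonglongrightarrow> 1 - 0"
      unfolding u_def using LIMSEQ_Suc[OF LIMSEQ_inverse_real_of_nat] by (intro tendsto_diff tendsto_const) (simp add: inverse_eq_divide)
    have "(\<lambda>n. 2 * (1 + (p - 1) * (u n)\<^sup>2) powr (p / 2)) \<longlonglongrightarrow> 2 * (1 + (p - 1) * (1 - 0)\<^sup>2) powr (p / 2)"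
      using p by (intro tendsto_intros lim) auto
    moreover have "(\<lambda>n. (1 + u n) powr p + (1 - u n) powr p) \<longlonglongrightarrow> (1 + (1 - 0)) powr p + (1 - (1 - 0)) powr p"
      using p lim u by (intro tendsto_intros tendsto_powr' ) (auto simp: less_imp_le)
    ultimately show ?thesis using True main[OF u]
      by (intro LIMSEQ_le[of "\<lambda>n. 2 * (1 + (p - 1) * (u n)\<^sup>2) powr (p / 2)" _ "\<lambda>n. (1 + u n) powr p + (1 - u n) powr p"]) auto
  qed (use main[of t] t in auto)
  show ?thesis
  proof (cases "0 \<le> t")
    case True then show ?thesis using closed[of t] t by auto
  next
    case False then show ?thesis using closed[of "- t"] t by (simp add: add.commute)
  qed
qed

text \<open>
  By homogeneity only \<open>t = b / a\<close> matters if \<open>\<bar>b\<bar> \<le> \<bar>a\<bar>\<close>. In the other case exchange \<open>a\<close> and \<open>b\<close>, which does not decrease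
  the left-hand side because \<open>p - 1 \<le> 1\<close>.
\<close>

lemma two_point_inequality:
  fixes a b p :: real
  assumes p: "1 < p" "p \<le> 2"
  shows "2 * (a\<^sup>2 + (p - 1) * b\<^sup>2) powr (p / 2) \<le> \<bar>a + b\<bar> powr p + \<bar>a - b\<bar> powr p"
proof -
  have main: "2 * (a\<^sup>2 + (p - 1) * b\<^sup>2) powr (p / 2) \<le> \<bar>a + b\<bar> powr p + \<bar>a - b\<bar> powr p"
    if ab: "\<bar>b\<bar> \<le> \<bar>a\<bar>" for a b :: real
  proof (cases "a = 0")
    case False
    define t where "t = b / a"
    have b: "b = a * t" and t: "\<bar>t\<bar> \<le> 1" using False ab by (auto simp: t_def divide_le_eq_1)
    have "a\<^sup>2 = \<bar>a\<bar> powr 2" using False by simp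
    then have "(a\<^sup>2) powr (p / 2) = \<bar>a\<bar> powr p" by (simp only: powr_powr) simp
    moreover have "a\<^sup>2 + (p - 1) * b\<^sup>2 = a\<^sup>2 * (1 + (p - 1) * t\<^sup>2)"
      by (simp add: b power_mult_distrib algebra_simps)
    ultimately have 1: "(a\<^sup>2 + (p - 1) * b\<^sup>2) powr (p / 2) = \<bar>a\<bar> powr p * (1 + (p - 1) * t\<^sup>2) powr (p / 2)"
      using p by (simp only: powr_mult)
    have "a + b = a * (1 + t)" "a - b = a * (1 - t)" by (simp_all add: b algebra_simps)
    then have 2: "\<bar>a + b\<bar> powr p = \<bar>a\<bar> powr p * \<bar>1 + t\<bar> powr p" "\<bar>a - b\<bar> powr p = \<bar>a\<bar> powr p * \<bar>1 - t\<bar> powr p"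
      by (simp_all only: abs_mult powr_mult)
    have "\<bar>a + b\<bar> powr p + \<bar>a - b\<bar> powr p - 2 * (a\<^sup>2 + (p - 1) * b\<^sup>2) powr (p / 2)
      = \<bar>a\<bar> powr p * (\<bar>1 + t\<bar> powr p + \<bar>1 - t\<bar> powr p - 2 * (1 + (p - 1) * t\<^sup>2) powr (p / 2))"
      unfolding 1 2 by (simp only: algebra_simps)
    also have "\<dots> \<ge> 0" using powr_sum_lower_bound[OF p t] by (intro mult_nonneg_nonneg) auto
    finally show ?thesis by simp
  qed (use ab in auto)
  show ?thesis
  proof (cases "\<bar>b\<bar> \<le> \<bar>a\<bar>")
    case False
    then have "a\<^sup>2 \<le> b\<^sup>2" by (simp add: abs_le_square_iff)
    then have "(2 - p) * a\<^sup>2 \<le> (2 - p) * b\<^sup>2" using p by (intro mult_left_mono) auto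
    then have "a\<^sup>2 + (p - 1) * b\<^sup>2 \<le> b\<^sup>2 + (p - 1) * a\<^sup>2" by (simp add: algebra_simps)
    then have "2 * (a\<^sup>2 + (p - 1) * b\<^sup>2) powr (p / 2) \<le> 2 * (b\<^sup>2 + (p - 1) * a\<^sup>2) powr (p / 2)"
      using p by (intro mult_left_mono powr_mono2) auto
    also have "\<dots> \<le> \<bar>b + a\<bar> powr p + \<bar>b - a\<bar> powr p" using False by (intro main) auto
    finally show ?thesis by (simp add: add.commute abs_minus_commute)
  qed (rule main)
qed

section \<open>The spaces $L_p$\<close>

locale Lp_space =
  fixes p :: ennreal and M :: "'a measure" and T :: "('a \<Rightarrow> real) \<Rightarrow> 'x::banach"
  assumes p_ge_1: "1 \<le> p" and is_Lp: "is_Lp_space p M T"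
begin

abbreviation L :: "('a \<Rightarrow> real) set" where "L \<equiv> Lp_functions p M"
abbreviation N :: "('a \<Rightarrow> real) \<Rightarrow> real" where "N \<equiv> Lp_norm p M"
abbreviation r :: real where "r \<equiv> enn2real p"

lemma T_onto: "\<exists>f\<in>L. T f = x"
  using is_Lp unfolding is_Lp_space_def by (metis UNIV_I imageE)

lemma T_eq_iff: "f \<in> L \<Longrightarrow> g \<in> L \<Longrightarrow> T f = T g \<longleftrightarrow> (AE x in M. f x = g x)"
  using is_Lp unfolding is_Lp_space_def by blast

lemma T_add: "f \<in> L \<Longrightarrow> g \<in> L \<Longrightarrow> T (\<lambda>x. f x + g x) = T f + T g"
  using is_Lp unfolding is_Lp_space_def by blast

lemma T_scale: "f \<in> L \<Longrightarrow> T (\<lambda>x. c * f x) = c *\<^sub>R T f"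
  using is_Lp unfolding is_Lp_space_def by blast

lemma norm_T: "f \<in> L \<Longrightarrow> norm (T f) = N f"
  using is_Lp unfolding is_Lp_space_def by blast

lemma r_ge_1: "p \<noteq> \<infinity> \<Longrightarrow> 1 \<le> r"
  using p_ge_1 by (cases p) (auto simp flip: ennreal_1)

lemma compare_p:
  assumes "p \<noteq> \<infinity>"
  shows "1 < p \<longleftrightarrow> 1 < r" "2 \<le> p \<longleftrightarrow> 2 \<le> r" "p \<le> 2 \<longleftrightarrow> r \<le> 2" "p < 2 \<longleftrightarrow> r < 2"
proof -
  have "ennreal r = p" using assms by (simp add: less_top)
  then show "1 < p \<longleftrightarrow> 1 < r" "2 \<le> p \<longleftrightarrow> 2 \<le> r" "p \<le> 2 \<longleftrightarrow> r \<le> 2" "p < 2 \<longleftrightarrow> r < 2"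
    using ennreal_less_iff[of 1 r] ennreal_le_iff2[of 2 r] ennreal_le_iff[of 2 r] ennreal_less_iff[of r 2]
    by (simp_all del: ennreal_enn2real)
qed

lemma L_finite_iff: "p \<noteq> \<infinity> \<Longrightarrow> f \<in> L \<longleftrightarrow> f \<in> borel_measurable M \<and> integrable M (\<lambda>x. \<bar>f x\<bar> powr r)"
  by (simp add: Lp_functions_def)

lemma N_finite: "p \<noteq> \<infinity> \<Longrightarrow> N f powr r = (LINT x|M. \<bar>f x\<bar> powr r)"
  using r_ge_1 by (simp add: Lp_norm_def powr_powr Bochner_Integration.integral_nonneg)

lemma N_nonneg: "0 \<le> N f"
  by (simp add: Lp_norm_def)

lemma AE_abs_le_N:
  assumes "p = \<infinity>" "f \<in> L"
  shows "AE x in M. \<bar>f x\<bar> \<le> N f"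
proof -
  have f: "f \<in> borel_measurable M" "esssup M (\<lambda>x. ennreal \<bar>f x\<bar>) < \<infinity>"
    using assms by (auto simp: Lp_functions_def)
  have "AE x in M. ennreal \<bar>f x\<bar> \<le> esssup M (\<lambda>x. ennreal \<bar>f x\<bar>)" by (rule esssup_AE)
  then show ?thesis
  proof eventually_elim
    case (elim x)
    then have "enn2real (ennreal \<bar>f x\<bar>) \<le> enn2real (esssup M (\<lambda>x. ennreal \<bar>f x\<bar>))"
      using f(2) by (intro enn2real_mono) auto
    then show ?case using assms(1) by (simp add: Lp_norm_def)
  qed
qed

lemma L_infinite_iff:
  assumes "p = \<infinity>"
  shows "f \<in> L \<longleftrightarrow> f \<in> borel_measurable M \<and> (\<exists>C. AE x in M. \<bar>f x\<bar> \<le> C)"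
proof
  assume "f \<in> L"
  then show "f \<in> borel_measurable M \<and> (\<exists>C. AE x in M. \<bar>f x\<bar> \<le> C)"
    using AE_abs_le_N[OF assms] assms by (auto simp: Lp_functions_def)
next
  assume "f \<in> borel_measurable M \<and> (\<exists>C. AE x in M. \<bar>f x\<bar> \<le> C)"
  then obtain C where f[measurable]: "f \<in> borel_measurable M" and C: "AE x in M. \<bar>f x\<bar> \<le> C" by blast
  have "esssup M (\<lambda>x. ennreal \<bar>f x\<bar>) \<le> ennreal C"
    by (intro esssup_I) (use C in \<open>auto elim!: eventually_mono intro: ennreal_leI\<close>)
  then show "f \<in> L" using assms f by (auto simp: Lp_functions_def intro: le_less_trans)
qed

lemma N_infinite_le:
  assumes "p = \<infinity>" "f \<in> borel_measurable M" "0 \<le> C" "AE x in M. \<bar>f x\<bar> \<le> C"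
  shows "N f \<le> C"
proof -
  have "esssup M (\<lambda>x. ennreal \<bar>f x\<bar>) \<le> ennreal C"
    using assms(2,4) by (intro esssup_I) (auto elim!: eventually_mono intro: ennreal_leI)
  then show ?thesis using assms(1,3) by (simp add: Lp_norm_def enn2real_leI)
qed

lemma L_measurable: "f \<in> L \<Longrightarrow> f \<in> borel_measurable M"
  by (auto simp: Lp_functions_def split: if_splits)

lemma dominated:
  assumes "f \<in> L" "g \<in> borel_measurable M" "AE x in M. \<bar>g x\<bar> \<le> \<bar>f x\<bar>"
  shows dominated_mem: "g \<in> L" and dominated_norm: "N g \<le> N f"
proof -
  have "g \<in> L \<and> N g \<le> N f"
  proof (cases "p = \<infinity>")
    case True
    have "AE x in M. \<bar>g x\<bar> \<le> N f"
      using AE_abs_le_N[OF True assms(1)] assms(3) by eventually_elim linarith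
    then show ?thesis using assms(2) True L_infinite_iff N_infinite_le N_nonneg by blast
  next
    case False
    note [measurable] = assms(2) L_measurable[OF assms(1)]
    have r: "1 \<le> r" using False by (rule r_ge_1)
    have f: "integrable M (\<lambda>x. \<bar>f x\<bar> powr r)" using assms(1) False by (simp add: L_finite_iff)
    have le: "AE x in M. \<bar>g x\<bar> powr r \<le> \<bar>f x\<bar> powr r"
      using assms(3) by eventually_elim (use r in \<open>intro powr_mono2; simp\<close>)
    have g: "integrable M (\<lambda>x. \<bar>g x\<bar> powr r)"
      by (rule Bochner_Integration.integrable_bound[OF f]) (use le in auto)
    have "(LINT x|M. \<bar>g x\<bar> powr r) \<le> (LINT x|M. \<bar>f x\<bar> powr r)"
      by (rule integral_mono_AE[OF g f le])
    then have "N g \<le> N f"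
      using False r by (simp add: Lp_norm_def powr_mono2 Bochner_Integration.integral_nonneg)
    then show ?thesis using g False by (simp add: L_finite_iff)
  qed
  then show "g \<in> L" "N g \<le> N f" by auto
qed

lemma zero_mem: "(\<lambda>x. 0) \<in> L"
proof (cases "p = \<infinity>")
  case True
  show ?thesis unfolding L_infinite_iff[OF True] by auto
qed (simp add: L_finite_iff)

lemma T_zero: "T (\<lambda>x. 0) = 0"
  using T_scale[OF zero_mem, of 0] by simp

lemma scale_mem: "f \<in> L \<Longrightarrow> (\<lambda>x. c * f x) \<in> L"
proof (cases "p = \<infinity>")
  case True
  assume "f \<in> L"
  then obtain C where f: "f \<in> borel_measurable M" and C: "AE x in M. \<bar>f x\<bar> \<le> C"
    using L_infinite_iff[OF True] by blast
  have "AE x in M. \<bar>c * f x\<bar> \<le> \<bar>c\<bar> * C" using C by eventually_elim (simp add: abs_mult mult_left_mono)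
  then show ?thesis unfolding L_infinite_iff[OF True] using f by auto
qed (auto simp: L_finite_iff abs_mult powr_mult)

lemma add_mem:
  assumes "f \<in> L" "g \<in> L"
  shows "(\<lambda>x. f x + g x) \<in> L"
proof (cases "p = \<infinity>")
  case True
  note L_measurable[OF assms(1), measurable] L_measurable[OF assms(2), measurable]
  have "AE x in M. \<bar>f x + g x\<bar> \<le> N f + N g"
    using AE_abs_le_N[OF True assms(1)] AE_abs_le_N[OF True assms(2)] by eventually_elim linarith
  then show ?thesis unfolding L_infinite_iff[OF True] by (intro conjI exI[of _ "N f + N g"]) simp_all
next
  case False
  note L_measurable[OF assms(1), measurable] L_measurable[OF assms(2), measurable]
  have r: "1 \<le> r" using False by (rule r_ge_1)
  have int: "integrable M (\<lambda>x. 2 powr r * (\<bar>f x\<bar> powr r + \<bar>g x\<bar> powr r))"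
    using assms False by (simp add: L_finite_iff)
  have "\<bar>f x + g x\<bar> powr r \<le> 2 powr r * (\<bar>f x\<bar> powr r + \<bar>g x\<bar> powr r)" for x
  proof -
    have "\<bar>f x + g x\<bar> powr r \<le> (2 * max \<bar>f x\<bar> \<bar>g x\<bar>) powr r" using r by (intro powr_mono2) auto
    also have "\<dots> \<le> 2 powr r * (\<bar>f x\<bar> powr r + \<bar>g x\<bar> powr r)"
      by (simp add: powr_mult max_def mult_left_mono)
    finally show ?thesis .
  qed
  then have "integrable M (\<lambda>x. \<bar>f x + g x\<bar> powr r)"
    by (intro Bochner_Integration.integrable_bound[OF int]) auto
  then show ?thesis using False by (simp add: L_finite_iff)
qed

lemma diff_mem: "f \<in> L \<Longrightarrow> g \<in> L \<Longrightarrow> (\<lambda>x. f x - g x) \<in> L"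
  using add_mem[OF _ scale_mem[of g "- 1"]] by simp

lemma T_diff: "f \<in> L \<Longrightarrow> g \<in> L \<Longrightarrow> T (\<lambda>x. f x - g x) = T f - T g"
  using T_add[OF _ scale_mem[of g "- 1"]] T_scale[of g "- 1"] by simp

lemma sum_mem: "finite I \<Longrightarrow> (\<And>i. i \<in> I \<Longrightarrow> f i \<in> L) \<Longrightarrow> (\<lambda>x. \<Sum>i\<in>I. f i x) \<in> L"
  by (induction I rule: finite_induct) (auto intro: zero_mem add_mem)

lemma T_sum: "finite I \<Longrightarrow> (\<And>i. i \<in> I \<Longrightarrow> f i \<in> L) \<Longrightarrow> T (\<lambda>x. \<Sum>i\<in>I. f i x) = (\<Sum>i\<in>I. T (f i))"
  by (induction I rule: finite_induct) (auto simp: T_zero T_add sum_mem)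

lemma N_scale: "f \<in> L \<Longrightarrow> N (\<lambda>x. c * f x) = \<bar>c\<bar> * N f"
  by (simp add: norm_T[symmetric] scale_mem T_scale)

lemma N_cong: "f \<in> L \<Longrightarrow> g \<in> L \<Longrightarrow> AE x in M. \<bar>f x\<bar> = \<bar>g x\<bar> \<Longrightarrow> N f = N g"
  by (intro antisym dominated_norm) (auto simp: L_measurable)

lemma N_eq_0_iff: "f \<in> L \<Longrightarrow> N f = 0 \<longleftrightarrow> (AE x in M. f x = 0)"
  using T_eq_iff[OF _ zero_mem, of f] norm_T[of f] by (metis T_zero norm_eq_zero)

subsection \<open>The square function of two elements\<close>

lemma sqrt_sum_squares_mem:
  assumes "f \<in> L" "g \<in> L"
  shows "(\<lambda>x. sqrt ((f x)\<^sup>2 + (g x)\<^sup>2)) \<in> L"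
proof (rule dominated_mem[OF add_mem])
  show "(\<lambda>x. \<bar>f x\<bar>) \<in> L" "(\<lambda>x. \<bar>g x\<bar>) \<in> L"
    using L_measurable[OF assms(1)] L_measurable[OF assms(2)] by (auto intro: dominated_mem assms)
  show "(\<lambda>x. sqrt ((f x)\<^sup>2 + (g x)\<^sup>2)) \<in> borel_measurable M"
    using L_measurable[OF assms(1)] L_measurable[OF assms(2)] by measurable
  show "AE x in M. \<bar>sqrt ((f x)\<^sup>2 + (g x)\<^sup>2)\<bar> \<le> \<bar>\<bar>f x\<bar> + \<bar>g x\<bar>\<bar>"
    using sqrt_sum_squares_le_sum_abs by auto
qed

lemma powr_le_imp_le:
  fixes u v q :: real
  shows "0 < q \<Longrightarrow> 0 \<le> u \<Longrightarrow> 0 \<le> v \<Longrightarrow> u powr q \<le> v powr q \<Longrightarrow> u \<le> v"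
  by (metis not_less powr_less_mono2)

lemma sqrt_powr: "0 \<le> u \<Longrightarrow> sqrt u powr q = u powr (q / 2)"
  by (simp add: powr_half_sqrt[symmetric] powr_powr)

text \<open>
  With \<open>s = N f\<^sup>2 / (N f\<^sup>2 + N g\<^sup>2)\<close>, write \<open>f\<^sup>2 + g\<^sup>2\<close> as the convex combination of
  \<open>f\<^sup>2 / s\<close> and \<open>g\<^sup>2 / (1 - s)\<close>. The function \<open>u \<mapsto> u\<^sup>p\<^sup>/\<^sup>2\<close> is convex or concave according to
  whether \<open>p \<ge> 2\<close> or \<open>p \<le> 2\<close>, and for this choice of \<open>s\<close> the
  integrated Jensen inequality is the assertion.
\<close>

lemma N_sqrt_sum_squares:
  assumes p: "p \<noteq> \<infinity>" and fg: "f \<in> L" "g \<in> L"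
  defines "h \<equiv> \<lambda>x. sqrt ((f x)\<^sup>2 + (g x)\<^sup>2)"
  shows N_sqrt_sum_squares_le: "2 \<le> r \<Longrightarrow> (N h)\<^sup>2 \<le> (N f)\<^sup>2 + (N g)\<^sup>2"
    and N_sqrt_sum_squares_ge: "r \<le> 2 \<Longrightarrow> (N f)\<^sup>2 + (N g)\<^sup>2 \<le> (N h)\<^sup>2"
proof -
  have r: "1 \<le> r" using p by (rule r_ge_1)
  have h: "h \<in> L" unfolding h_def by (rule sqrt_sum_squares_mem[OF fg])
  define \<alpha> \<beta> where "\<alpha> = (N f)\<^sup>2" and "\<beta> = (N g)\<^sup>2"
  have "(2 \<le> r \<longrightarrow> (N h)\<^sup>2 \<le> \<alpha> + \<beta>) \<and> (r \<le> 2 \<longrightarrow> \<alpha> + \<beta> \<le> (N h)\<^sup>2)"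
  proof (cases "\<alpha> = 0 \<or> \<beta> = 0")
    case True
    then consider "N f = 0" | "N g = 0" by (auto simp: \<alpha>_def \<beta>_def)
    then show ?thesis
    proof cases
      case 1
      then have "AE x in M. f x = 0" using fg by (simp add: N_eq_0_iff)
      then have "AE x in M. \<bar>h x\<bar> = \<bar>g x\<bar>" by eventually_elim (simp add: h_def)
      then have "N h = N g" using h fg by (intro N_cong)
      then show ?thesis using 1 by (simp add: \<alpha>_def \<beta>_def)
    next
      case 2
      then have "AE x in M. g x = 0" using fg by (simp add: N_eq_0_iff)
      then have "AE x in M. \<bar>h x\<bar> = \<bar>f x\<bar>" by eventually_elim (simp add: h_def)
      then have "N h = N f" using h fg by (intro N_cong)
      then show ?thesis using 2 by (simp add: \<alpha>_def \<beta>_def)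
    qed
  next
    case False
    then have pos: "0 < \<alpha>" "0 < \<beta>" by (auto simp: \<alpha>_def \<beta>_def)
    define s t where "s = \<alpha> / (\<alpha> + \<beta>)" and "t = \<beta> / (\<alpha> + \<beta>)"
    have st: "0 < s" "0 < t" "s + t = 1" using pos by (auto simp: s_def t_def add_divide_distrib[symmetric])
    define J where "J x = s * ((f x)\<^sup>2 / s) powr (r / 2) + t * ((g x)\<^sup>2 / t) powr (r / 2)" for x
    have sq: "(u\<^sup>2) powr (r / 2) = \<bar>u\<bar> powr r" for u :: real
      using sqrt_powr[of "u\<^sup>2" r] by simp
    have "J x = s * (\<bar>f x\<bar> powr r / s powr (r / 2)) + t * (\<bar>g x\<bar> powr r / t powr (r / 2))" for x
      using st unfolding J_def by (simp add: powr_divide sq)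
    then have J: "J = (\<lambda>x. s / s powr (r / 2) * \<bar>f x\<bar> powr r + t / t powr (r / 2) * \<bar>g x\<bar> powr r)"
      by (simp add: fun_eq_iff)
    have int: "integrable M (\<lambda>x. \<bar>f x\<bar> powr r)" "integrable M (\<lambda>x. \<bar>g x\<bar> powr r)"
      "integrable M (\<lambda>x. \<bar>h x\<bar> powr r)" using fg h p by (auto simp: L_finite_iff)
    have intJ: "integrable M J" unfolding J using int by simp
    have Nr: "u powr r = (u\<^sup>2) powr (r / 2)" if "0 \<le> u" for u :: real
      using sq[of u] that by simp
    have "(LINT x|M. J x) = s / s powr (r / 2) * \<alpha> powr (r / 2) + t / t powr (r / 2) * \<beta> powr (r / 2)"
      unfolding J using int Nr[OF N_nonneg[of f]] Nr[OF N_nonneg[of g]]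
      by (simp add: N_finite[OF p, symmetric] \<alpha>_def \<beta>_def)
    also have "s / s powr (r / 2) * \<alpha> powr (r / 2) = s * (\<alpha> + \<beta>) powr (r / 2)"
      using pos by (simp add: s_def powr_divide)
    also have "t / t powr (r / 2) * \<beta> powr (r / 2) = t * (\<alpha> + \<beta>) powr (r / 2)"
      using pos by (simp add: t_def powr_divide)
    finally have intJ_eq: "(LINT x|M. J x) = (\<alpha> + \<beta>) powr (r / 2)"
      using st by (simp add: distrib_right[symmetric])
    have hr: "\<bar>h x\<bar> powr r = (s * ((f x)\<^sup>2 / s) + t * ((g x)\<^sup>2 / t)) powr (r / 2)" for x
      using st by (simp add: h_def sqrt_powr)
    have Nh: "((N h)\<^sup>2) powr (r / 2) = (LINT x|M. \<bar>h x\<bar> powr r)"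
      using Nr[OF N_nonneg[of h]] by (simp add: N_finite[OF p])
    show ?thesis
    proof (intro conjI impI)
      assume "2 \<le> r"
      then have "\<bar>h x\<bar> powr r \<le> J x" for x
        unfolding hr J_def using st by (intro powr_convex_combination) auto
      then have "((N h)\<^sup>2) powr (r / 2) \<le> (\<alpha> + \<beta>) powr (r / 2)"
        unfolding Nh intJ_eq[symmetric] using int intJ by (intro integral_mono) auto
      then show "(N h)\<^sup>2 \<le> \<alpha> + \<beta>" using pos r by (auto intro: powr_le_imp_le[of "r / 2"])
    next
      assume "r \<le> 2"
      then have "J x \<le> \<bar>h x\<bar> powr r" for x
        unfolding hr J_def using st r by (intro powr_concave_combination) auto
      then have "(\<alpha> + \<beta>) powr (r / 2) \<le> ((N h)\<^sup>2) powr (r / 2)"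
        unfolding Nh intJ_eq[symmetric] using int intJ by (intro integral_mono) auto
      then show "\<alpha> + \<beta> \<le> (N h)\<^sup>2" using pos r by (auto intro: powr_le_imp_le[of "r / 2"])
    qed
  qed
  then show "2 \<le> r \<Longrightarrow> (N h)\<^sup>2 \<le> (N f)\<^sup>2 + (N g)\<^sup>2" "r \<le> 2 \<Longrightarrow> (N f)\<^sup>2 + (N g)\<^sup>2 \<le> (N h)\<^sup>2"
    by (auto simp: \<alpha>_def \<beta>_def)
qed

text \<open>
  For \<open>1 < p \<le> 2\<close>, integrating the two-point inequality and applying the reverse triangle
  inequality in \<open>L\<^sub>p\<^sub>/\<^sub>2\<close> gives \<open>N (f + g)\<^sup>2 + N (f - g)\<^sup>2 \<ge> 2 N f\<^sup>2 + 2 (p - 1) N g\<^sup>2\<close>.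
\<close>

theorem property_Cdc_if_between:
  assumes "1 < p" "p \<le> 2"
  shows "property_Cdc TYPE('x)"
proof -
  have p: "p \<noteq> \<infinity>" using assms(2) by (auto simp: top_unique)
  have r: "1 < r" "r \<le> 2" using assms p by (auto simp: compare_p)
  have "2 * (norm x)\<^sup>2 + (2 * (r - 1)) * (norm y)\<^sup>2 \<le> (norm (x + y))\<^sup>2 + (norm (x - y))\<^sup>2" for x y :: 'x
  proof -
    obtain f g where f: "f \<in> L" "T f = x" and g: "g \<in> L" "T g = y" using T_onto by meson
    define c where "c = sqrt (r - 1)"
    have c: "c\<^sup>2 = r - 1" using r by (simp add: c_def)
    define h where "h x = sqrt ((f x)\<^sup>2 + (c * g x)\<^sup>2)" for x
    have h: "h \<in> L" unfolding h_def by (intro sqrt_sum_squares_mem scale_mem f g)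
    define A B where "A = norm (x + y)" and "B = norm (x - y)"
    have AB: "A = N (\<lambda>x. f x + g x)" "B = N (\<lambda>x. f x - g x)"
      using f g by (auto simp: A_def B_def norm_T[symmetric] T_add T_diff add_mem diff_mem)
    have "(N f)\<^sup>2 + (N (\<lambda>x. c * g x))\<^sup>2 \<le> (N h)\<^sup>2"
      unfolding h_def using r f g by (intro N_sqrt_sum_squares_ge p scale_mem) auto
    then have 1: "(norm x)\<^sup>2 + (r - 1) * (norm y)\<^sup>2 \<le> (N h)\<^sup>2"
      using f g by (simp add: N_scale power_mult_distrib c norm_T[symmetric])
    have "2 * \<bar>h x\<bar> powr r \<le> \<bar>f x + g x\<bar> powr r + \<bar>f x - g x\<bar> powr r" for x
    proof -
      have "\<bar>h x\<bar> powr r = ((f x)\<^sup>2 + (r - 1) * (g x)\<^sup>2) powr (r / 2)"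
        using r by (simp add: h_def sqrt_powr power_mult_distrib c)
      then show ?thesis using two_point_inequality[OF r, of "f x" "g x"] by simp
    qed
    then have "(LINT x|M. 2 * \<bar>h x\<bar> powr r) \<le> (LINT x|M. \<bar>f x + g x\<bar> powr r + \<bar>f x - g x\<bar> powr r)"
      using f g h p by (intro integral_mono) (auto simp: L_finite_iff[symmetric] add_mem diff_mem
        intro!: Bochner_Integration.integrable_add simp: L_finite_iff[THEN iffD1, THEN conjunct2, OF p])
    also have "\<dots> = A powr r + B powr r"
      unfolding AB N_finite[OF p] using add_mem[OF f(1) g(1)] diff_mem[OF f(1) g(1)] p
      by (intro Bochner_Integration.integral_add) (auto simp: L_finite_iff)
    also have "(LINT x|M. 2 * \<bar>h x\<bar> powr r) = 2 * N h powr r" by (simp add: N_finite[OF p])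
    finally have "N h powr r \<le> 1/2 * A powr r + 1/2 * B powr r" by simp
    then have "(N h powr r) powr (2 / r) \<le> (1/2 * A powr r + 1/2 * B powr r) powr (2 / r)"
      using r by (intro powr_mono2) auto
    also have "\<dots> \<le> 1/2 * (A powr r) powr (2 / r) + 1/2 * (B powr r) powr (2 / r)"
      using r by (intro powr_convex_combination) auto
    finally have "(N h)\<^sup>2 \<le> 1/2 * A\<^sup>2 + 1/2 * B\<^sup>2"
      using r N_nonneg[of h] by (simp add: powr_powr A_def B_def)
    then show ?thesis using 1 unfolding A_def B_def by linarith
  qed
  then show ?thesis using r by (intro property_Cdc_if_two_convex[of "2 * (r - 1)"]) auto
qed

end

subsection \<open>Disjoint sets of positive measure\<close>

lemma sum_disjoint_family:
  fixes F :: "'i \<Rightarrow> real"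
  assumes "disjoint_family_on A I" "finite I" "i \<in> I" "\<omega> \<in> A i"
    and zero: "\<And>j. j \<in> I \<Longrightarrow> \<omega> \<notin> A j \<Longrightarrow> F j = 0"
  shows "(\<Sum>j\<in>I. F j) = F i"
proof -
  have "F j = 0" if "j \<in> I - {i}" for j
    using that assms(1,3,4) by (intro zero) (auto simp: disjoint_family_on_def)
  then show ?thesis using sum.remove[OF assms(2,3), of F] by simp
qed

context Lp_space
begin

text \<open>
  For finite \<open>p\<close> these are the sets of positive finite measure; for \<open>p = \<infinity>\<close> the measure may
  also be infinite.
\<close>

definition positive :: "'a set \<Rightarrow> bool" where
  "positive A \<longleftrightarrow> A \<in> sets M \<and> (indicator A :: 'a \<Rightarrow> real) \<in> L \<and> \<not> (AE x in M. x \<notin> A)"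

lemma positive_subset:
  assumes "positive A" "B \<in> sets M" "B \<subseteq> A" "\<not> (AE x in M. x \<notin> B)"
  shows "positive B"
  unfolding positive_def
proof (intro conjI assms)
  have "(indicator A :: 'a \<Rightarrow> real) \<in> L" using assms(1) by (simp add: positive_def)
  then show "(indicator B :: 'a \<Rightarrow> real) \<in> L"
    by (rule dominated_mem) (use assms in \<open>auto split: split_indicator\<close>)
qed

definition disjoint_positive :: "'a set \<Rightarrow> nat set \<Rightarrow> (nat \<Rightarrow> 'a set) \<Rightarrow> bool" where
  "disjoint_positive A I D \<longleftrightarrow> finite I \<and> (\<forall>i\<in>I. positive (D i) \<and> D i \<subseteq> A) \<and> disjoint_family_on D I"

definition splits_into :: "'a set \<Rightarrow> nat \<Rightarrow> bool" where
  "splits_into A n \<longleftrightarrow> (\<exists>I D. disjoint_positive A I D \<and> card I = n)"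

lemma disjoint_positive_splits:
  assumes "disjoint_positive A I D" "n \<le> card I"
  shows "splits_into A n"
proof -
  obtain I' where "I' \<subseteq> I" "card I' = n" "finite I'"
    using obtain_subset_with_card_n[OF assms(2)] by metis
  then show ?thesis
    using assms(1) unfolding splits_into_def disjoint_positive_def
    by (intro exI[of _ I'] exI[of _ D]) (auto intro: disjoint_family_on_mono)
qed

lemma splits_into_mono: "splits_into A n \<Longrightarrow> A \<subseteq> B \<Longrightarrow> splits_into B n"
  unfolding splits_into_def disjoint_positive_def by (elim exE conjE, intro exI conjI) auto

lemma splits_into_Int_or_Diff:
  assumes A: "\<And>n. splits_into A n" and B: "B \<in> sets M"
  shows "(\<forall>n. splits_into (A \<inter> B) n) \<or> (\<forall>n. splits_into (A - B) n)"
proof (rule ccontr)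
  assume "\<not> ?thesis"
  then obtain m n where mn: "\<not> splits_into (A \<inter> B) m" "\<not> splits_into (A - B) n" by blast
  obtain I D where D: "disjoint_positive A I D" and card: "card I = m + n"
    using A[of "m + n"] unfolding splits_into_def by blast
  define I1 I2 where "I1 = {i \<in> I. positive (D i \<inter> B)}" and "I2 = {i \<in> I. positive (D i - B)}"
  have fin: "finite I" using D by (simp add: disjoint_positive_def)
  have "disjoint_positive (A \<inter> B) I1 (\<lambda>i. D i \<inter> B)" "disjoint_positive (A - B) I2 (\<lambda>i. D i - B)"
    using D by (auto simp: disjoint_positive_def I1_def I2_def disjoint_family_on_def) blast+
  then have small: "card I1 < m" "card I2 < n"
    using mn disjoint_positive_splits by (meson not_less)+
  have "I \<subseteq> I1 \<union> I2"
  proof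
    fix i assume i: "i \<in> I"
    then have pos: "positive (D i)" using D by (simp add: disjoint_positive_def)
    then have sets: "D i \<inter> B \<in> sets M" "D i - B \<in> sets M" using B by (auto simp: positive_def)
    have "\<not> (AE x in M. x \<notin> D i \<inter> B) \<or> \<not> (AE x in M. x \<notin> D i - B)"
    proof (rule ccontr)
      assume "\<not> ?thesis"
      then have "AE x in M. x \<notin> D i \<inter> B" "AE x in M. x \<notin> D i - B" by auto
      then have "AE x in M. x \<notin> D i" by eventually_elim auto
      then show False using pos by (simp add: positive_def)
    qed
    then show "i \<in> I1 \<union> I2"
      using i positive_subset[OF pos sets(1)] positive_subset[OF pos sets(2)] by (auto simp: I1_def I2_def)
  qed
  then have "m + n \<le> card (I1 \<union> I2)"
    using fin by (subst card[symmetric]) (intro card_mono, auto simp: I1_def I2_def)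
  then show False using small card_Un_le[of I1 I2] by linarith
qed

text \<open>
  When a set with arbitrarily many disjoint positive subsets is split in two, at least one of the parts
  again has arbitrarily many. So of two disjoint positive subsets at least one can be removed without
  losing this property.
\<close>

lemma splits_into_remove:
  assumes A: "\<And>n. splits_into A n"
  shows "\<exists>E. positive E \<and> E \<subseteq> A \<and> (\<forall>n. splits_into (A - E) n)"
proof -
  obtain I D where D: "disjoint_positive A I D" and "card I = 2"
    using A[of 2] unfolding splits_into_def by blast
  then obtain i j where ij: "i \<in> I" "j \<in> I" "i \<noteq> j" by (metis card_2_iff')
  have pos: "positive (D i)" "positive (D j)" and sub: "D i \<subseteq> A" "D j \<subseteq> A" and disj: "D i \<inter> D j = {}"
    using D ij by (auto simp: disjoint_positive_def disjoint_family_on_def)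
  have "D i \<in> sets M" using pos(1) by (simp add: positive_def)
  from splits_into_Int_or_Diff[OF A this] show ?thesis
  proof
    assume "\<forall>n. splits_into (A \<inter> D i) n"
    then have "\<forall>n. splits_into (A - D j) n"
      using splits_into_mono[of "A \<inter> D i" _ "A - D j"] disj by blast
    then show ?thesis using pos(2) sub(2) by blast
  next
    assume "\<forall>n. splits_into (A - D i) n"
    then show ?thesis using pos(1) sub(1) by blast
  qed
qed

lemma disjoint_positive_sequence:
  assumes "\<And>n. splits_into (space M) n"
  shows "\<exists>E :: nat \<Rightarrow> 'a set. (\<forall>i. positive (E i)) \<and> disjoint_family E"
proof -
  define P where "P A \<longleftrightarrow> (\<forall>n. splits_into A n)" for A
  define F where "F A = (SOME E. positive E \<and> E \<subseteq> A \<and> P (A - E))" for A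
  have F: "positive (F A)" "F A \<subseteq> A" "P (A - F A)" if "P A" for A
    using someI_ex[of "\<lambda>E. positive E \<and> E \<subseteq> A \<and> P (A - E)"] splits_into_remove[of A] that
    unfolding P_def F_def by blast+
  define A where "A = rec_nat (space M) (\<lambda>_ A. A - F A)"
  have A_Suc: "A (Suc n) = A n - F (A n)" for n by (simp add: A_def)
  have PA: "P (A n)" for n
    by (induction n) (use assms F(3) in \<open>auto simp: A_Suc P_def A_def\<close>)
  have dec: "A n \<subseteq> A m" if "m \<le> n" for m n
    using lift_Suc_antimono_le[of A m n] that by (auto simp: A_Suc)
  have "F (A m) \<inter> F (A n) = {}" if "m < n" for m n
    using dec[of "Suc m" n] that F(2)[OF PA, of n] by (auto simp: A_Suc)
  then have "disjoint_family (\<lambda>n. F (A n))"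
    unfolding disjoint_family_on_def by (metis inf_commute linorder_neqE_nat)
  then show ?thesis using F(1)[OF PA] by (intro exI[of _ "\<lambda>n. F (A n)"]) auto
qed

text \<open>
  On a set without a splitting into two positive parts, each of the sets \<open>{f > t}\<close> with rational \<open>t\<close> is either
  null or conull. Away from one null set, all values of \<open>f\<close> therefore lie in the same cut of the rationals.
\<close>

lemma constant_on_unsplittable:
  assumes A: "positive A" and f[measurable]: "f \<in> borel_measurable M"
    and uns: "\<And>B. B \<in> sets M \<Longrightarrow> \<not> (positive (A \<inter> B) \<and> positive (A - B))"
  shows "\<exists>c::real. AE x in M. x \<in> A \<longrightarrow> f x = c"
proof -
  have "\<exists>b. AE x in M. x \<in> A \<longrightarrow> (of_rat t < f x \<longleftrightarrow> b)" for t :: rat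
  proof -
    define B where "B = {x \<in> space M. of_rat t < f x}"
    have B: "B \<in> sets M" unfolding B_def by measurable
    have sets: "A \<inter> B \<in> sets M" "A - B \<in> sets M" using A B by (auto simp: positive_def)
    have "\<not> positive (A \<inter> B) \<or> \<not> positive (A - B)" using uns[OF B] by blast
    then have "(AE x in M. x \<notin> A \<inter> B) \<or> (AE x in M. x \<notin> A - B)"
      using positive_subset[OF A sets(1)] positive_subset[OF A sets(2)] by blast
    then show ?thesis
    proof
      assume "AE x in M. x \<notin> A \<inter> B"
      then have "AE x in M. x \<in> A \<longrightarrow> (of_rat t < f x \<longleftrightarrow> False)"
        using AE_space by eventually_elim (auto simp: B_def)
      then show ?thesis by blast
    next
      assume "AE x in M. x \<notin> A - B"
      then have "AE x in M. x \<in> A \<longrightarrow> (of_rat t < f x \<longleftrightarrow> True)"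
        using AE_space by eventually_elim (auto simp: B_def)
      then show ?thesis by blast
    qed
  qed
  then obtain b where "AE x in M. x \<in> A \<longrightarrow> (of_rat t < f x \<longleftrightarrow> b t)" for t :: rat by metis
  then have b: "AE x in M. \<forall>t::rat. x \<in> A \<longrightarrow> (of_rat t < f x \<longleftrightarrow> b t)"
    unfolding AE_all_countable by blast
  have "\<exists>x0\<in>A. \<forall>t::rat. of_rat t < f x0 \<longleftrightarrow> b t"
  proof (rule ccontr)
    assume "\<not> ?thesis"
    then have "AE x in M. x \<notin> A" using b by (auto elim!: eventually_mono)
    then show False using A by (simp add: positive_def)
  qed
  then obtain x0 where x0: "x0 \<in> A" "\<And>t::rat. of_rat t < f x0 \<longleftrightarrow> b t" by blast
  have "f x = f x0" if "\<And>t::rat. of_rat t < f x \<longleftrightarrow> b t" for x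
  proof (rule ccontr)
    assume "f x \<noteq> f x0"
    then consider "f x < f x0" | "f x0 < f x" by linarith
    then show False
    proof cases
      case 1
      then obtain t where "f x < of_rat t" "of_rat t < f x0" using of_rat_dense by blast
      then show False using that[of t] x0(2)[of t] by simp
    next
      case 2
      then obtain t where "f x0 < of_rat t" "of_rat t < f x" using of_rat_dense by blast
      then show False using that[of t] x0(2)[of t] by simp
    qed
  qed
  then have "AE x in M. x \<in> A \<longrightarrow> f x = f x0" using b by (auto elim!: eventually_mono)
  then show ?thesis by blast
qed

text \<open>
  A disjoint family of positive sets of maximal size consists of sets on which every function is
  constant, and no function of the space lives outside of their union. So the indicators of its
  members span the space.
\<close>

lemma finite_dimensional_if_not_splits:
  assumes "\<not> splits_into (space M) n"
  shows "\<not> infinite_dimensional TYPE('x)"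
proof -
  define Q where "Q n \<longleftrightarrow> splits_into (space M) n" for n
  have "Q 0" unfolding Q_def splits_into_def disjoint_positive_def by (intro exI[of _ "{}"] exI[of _ "\<lambda>_. {}"]) (auto simp: disjoint_family_on_def)
  then obtain m where m: "Q m" "\<not> Q (Suc m)"
    using assms unfolding Q_def[symmetric] by (metis nat_induct)
  obtain I D where D: "disjoint_positive (space M) I D" and card: "card I = m"
    using m(1) unfolding Q_def splits_into_def by blast
  have fin: "finite I" and pos: "\<And>i. i \<in> I \<Longrightarrow> positive (D i)" and disj: "disjoint_family_on D I"
    using D by (auto simp: disjoint_positive_def)
  obtain new where new: "new \<notin> I" using fin ex_new_if_finite[OF infinite_UNIV_nat] by blast
  have max: False if "disjoint_positive (space M) (insert new I) D'" for D'
    using disjoint_positive_splits[OF that, of "Suc m"] m(2) new fin card by (simp add: Q_def)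
  have sub: "A \<subseteq> space M" if "positive A" for A using that sets.sets_into_space by (auto simp: positive_def)
  have uns: "\<not> (positive (D i \<inter> B) \<and> positive (D i - B))" if i: "i \<in> I" for i B
  proof
    assume *: "positive (D i \<inter> B) \<and> positive (D i - B)"
    have "disjoint_positive (space M) (insert new I) (D(i := D i \<inter> B, new := D i - B))"
      unfolding disjoint_positive_def
    proof (intro conjI ballI)
      show "disjoint_family_on (D(i := D i \<inter> B, new := D i - B)) (insert new I)"
        using disj new i unfolding disjoint_family_on_def by (auto simp: fun_upd_def)
    qed (use fin pos new i * sub in \<open>auto split: if_splits\<close>)
    then show False by (rule max)
  qed
  have "x \<in> span ((\<lambda>i. T (indicator (D i))) ` I)" for x
  proof -
    obtain f where f: "f \<in> L" "T f = x" using T_onto by blast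
    note [measurable] = L_measurable[OF f(1)]
    have "\<exists>c. AE x in M. x \<in> D i \<longrightarrow> f x = c" if "i \<in> I" for i
      using that by (intro constant_on_unsplittable pos uns) measurable
    then obtain c where c: "\<And>i. i \<in> I \<Longrightarrow> AE x in M. x \<in> D i \<longrightarrow> f x = c i" by metis
    have ind: "(indicator (D i) :: 'a \<Rightarrow> real) \<in> L" if "i \<in> I" for i using pos[OF that] by (simp add: positive_def)
    have "AE x in M. x \<notin> (\<Union>i\<in>I. D i) \<longrightarrow> \<bar>f x\<bar> \<le> 1 / real (Suc k)" for k
    proof -
      define C where "C = {x \<in> space M. x \<notin> (\<Union>i\<in>I. D i) \<and> 1 / real (Suc k) < \<bar>f x\<bar>}"
      have UD: "(\<Union>i\<in>I. D i) \<in> sets M" using fin pos by (auto simp: positive_def)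
      then have C: "C \<in> sets M" unfolding C_def by measurable
      have "(indicator C :: 'a \<Rightarrow> real) \<in> L"
      proof (rule dominated_mem[OF scale_mem[OF f(1), of "real (Suc k)"]])
        show "AE x in M. \<bar>indicator C x\<bar> \<le> \<bar>real (Suc k) * f x\<bar>"
          by (intro AE_I2) (auto simp: C_def abs_mult field_simps split: split_indicator)
      qed (use C in auto)
      have "\<not> positive C"
      proof
        assume "positive C"
        then have "disjoint_positive (space M) (insert new I) (D(new := C))"
          using fin pos new sub disj unfolding disjoint_positive_def disjoint_family_on_def
          by (auto simp: C_def)
        then show False by (rule max)
      qed
      then have "AE x in M. x \<notin> C" using C \<open>indicator C \<in> L\<close> by (simp add: positive_def)
      then show ?thesis using AE_space by eventually_elim (auto simp: C_def)
    qed
    then have out: "AE x in M. \<forall>k. x \<notin> (\<Union>i\<in>I. D i) \<longrightarrow> \<bar>f x\<bar> \<le> 1 / real (Suc k)"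
      unfolding AE_all_countable by blast
    have inn: "AE x in M. \<forall>i\<in>I. x \<in> D i \<longrightarrow> f x = c i"
      using c fin by (simp add: AE_finite_all)
    have "AE x in M. f x = (\<Sum>i\<in>I. c i * indicator (D i) x)"
      using out inn
    proof eventually_elim
      case (elim x)
      show ?case
      proof (cases "\<exists>i\<in>I. x \<in> D i")
        case True
        then obtain i where i: "i \<in> I" "x \<in> D i" by blast
        have "(\<Sum>j\<in>I. c j * indicator (D j) x) = c i * indicator (D i) x"
          by (rule sum_disjoint_family[OF disj fin i]) auto
        then show ?thesis using elim(2) i by simp
      next
        case False
        then have "\<bar>f x\<bar> \<le> 1 / real (Suc k)" for k using elim(1) by auto
        then have "f x = 0"
          by (metis abs_le_zero_iff inverse_eq_divide not_less reals_Archimedean)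
        moreover have "(\<Sum>j\<in>I. c j * indicator (D j) x) = 0"
          using False by (intro sum.neutral) auto
        ultimately show ?thesis by simp
      qed
    qed
    moreover have "(\<lambda>x. \<Sum>i\<in>I. c i * indicator (D i) x) \<in> L"
      by (intro sum_mem scale_mem fin ind)
    ultimately have "x = T (\<lambda>x. \<Sum>i\<in>I. c i * indicator (D i) x)"
      using T_eq_iff[OF f(1)] f(2) by blast
    also have "\<dots> = (\<Sum>i\<in>I. c i *\<^sub>R T (indicator (D i)))"
      by (subst T_sum) (simp_all add: fin ind scale_mem T_scale)
    also have "\<dots> \<in> span ((\<lambda>i. T (indicator (D i))) ` I)"
      by (intro span_sum span_scale span_base) auto
    finally show ?thesis .
  qed
  then show ?thesis
    unfolding infinite_dimensional_def using fin by (auto intro!: exI[of _ "(\<lambda>i. T (indicator (D i))) ` I"])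
qed

subsection \<open>Coordinates\<close>

text \<open>Multiplication by the indicator of \<open>A\<close>, as an operator on the classes of functions.\<close>

definition restrict_to :: "'a set \<Rightarrow> 'x \<Rightarrow> 'x" where
  "restrict_to A x = T (\<lambda>\<omega>. indicator A \<omega> * (SOME f. f \<in> L \<and> T f = x) \<omega>)"

lemma indicator_times_mem:
  assumes "A \<in> sets M" "f \<in> L"
  shows "(\<lambda>\<omega>. indicator A \<omega> * f \<omega>) \<in> L" "N (\<lambda>\<omega>. indicator A \<omega> * f \<omega>) \<le> N f"
  using assms L_measurable[OF assms(2)]
  by (auto intro!: dominated_mem[OF assms(2)] dominated_norm[OF assms(2)] simp: abs_mult split: split_indicator)

lemma restrict_to_T:
  assumes A: "A \<in> sets M" and f: "f \<in> L"
  shows "restrict_to A (T f) = T (\<lambda>\<omega>. indicator A \<omega> * f \<omega>)"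
proof -
  define g where "g = (SOME g. g \<in> L \<and> T g = T f)"
  have g: "g \<in> L" "T g = T f" using someI[of "\<lambda>g. g \<in> L \<and> T g = T f" f] f by (auto simp: g_def)
  have "AE \<omega> in M. g \<omega> = f \<omega>" using T_eq_iff[OF g(1) f] g(2) by simp
  then have "AE \<omega> in M. indicator A \<omega> * g \<omega> = indicator A \<omega> * f \<omega>" by eventually_elim simp
  then show ?thesis
    unfolding restrict_to_def g_def[symmetric] by (subst T_eq_iff) (auto intro: indicator_times_mem A f g)
qed

lemma linear_restrict_to:
  assumes A: "A \<in> sets M"
  shows "linear (restrict_to A)"
proof (rule linearI)
  fix x y
  obtain f g where f: "f \<in> L" "T f = x" and g: "g \<in> L" "T g = y" using T_onto by meson
  have "restrict_to A (T (\<lambda>\<omega>. f \<omega> + g \<omega>)) = restrict_to A (T f) + restrict_to A (T g)"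
    using f(1) g(1) A by (simp add: restrict_to_T add_mem T_add[symmetric] indicator_times_mem distrib_left)
  then show "restrict_to A (x + y) = restrict_to A x + restrict_to A y" using f g by (simp add: T_add)
  fix c
  have "restrict_to A (T (\<lambda>\<omega>. c * f \<omega>)) = c *\<^sub>R restrict_to A (T f)"
    using f(1) A by (simp add: restrict_to_T scale_mem T_scale[symmetric] indicator_times_mem mult.left_commute)
  then show "restrict_to A (c *\<^sub>R x) = c *\<^sub>R restrict_to A x" using f by (simp add: T_scale)
qed

lemma norm_restrict_to: "A \<in> sets M \<Longrightarrow> norm (restrict_to A x) \<le> norm x"
  using T_onto[of x] indicator_times_mem by (auto simp: restrict_to_T norm_T)

lemma sum_norm_restrict_to:
  assumes p: "p \<noteq> \<infinity>" and I: "finite I" and A: "\<And>i. i \<in> I \<Longrightarrow> A i \<in> sets M" and disj: "disjoint_family_on A I"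
  shows "(\<Sum>i\<in>I. norm (restrict_to (A i) x) powr r) \<le> norm x powr r"
proof -
  obtain f where f: "f \<in> L" "T f = x" using T_onto by blast
  have int: "integrable M (\<lambda>\<omega>. \<bar>f \<omega>\<bar> powr r)" "\<And>i. i \<in> I \<Longrightarrow> integrable M (\<lambda>\<omega>. \<bar>indicator (A i) \<omega> * f \<omega>\<bar> powr r)"
    using f indicator_times_mem(1)[OF A f(1)] p by (auto simp: L_finite_iff)
  have "(\<Sum>i\<in>I. norm (restrict_to (A i) x) powr r) = (\<Sum>i\<in>I. (LINT \<omega>|M. \<bar>indicator (A i) \<omega> * f \<omega>\<bar> powr r))"
    using f(1) A by (intro sum.cong) (auto simp: f(2)[symmetric] restrict_to_T norm_T indicator_times_mem N_finite[OF p])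
  also have "\<dots> = (LINT \<omega>|M. (\<Sum>i\<in>I. \<bar>indicator (A i) \<omega> * f \<omega>\<bar> powr r))"
    using int by simp
  also have "\<dots> \<le> (LINT \<omega>|M. \<bar>f \<omega>\<bar> powr r)"
  proof (rule integral_mono)
    fix \<omega>
    show "(\<Sum>i\<in>I. \<bar>indicator (A i) \<omega> * f \<omega>\<bar> powr r) \<le> \<bar>f \<omega>\<bar> powr r"
    proof (cases "\<exists>i\<in>I. \<omega> \<in> A i")
      case True
      then obtain i where i: "i \<in> I" "\<omega> \<in> A i" by blast
      have "(\<Sum>j\<in>I. \<bar>indicator (A j) \<omega> * f \<omega>\<bar> powr r) = \<bar>indicator (A i) \<omega> * f \<omega>\<bar> powr r"
        by (rule sum_disjoint_family[OF disj I i]) auto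
      then show ?thesis using i by simp
    next
      case False
      then have "(\<Sum>j\<in>I. \<bar>indicator (A j) \<omega> * f \<omega>\<bar> powr r) = 0" by (intro sum.neutral) auto
      then show ?thesis by simp
    qed
  qed (use int in auto)
  also have "\<dots> = norm x powr r" by (simp add: f(2)[symmetric] norm_T f(1) N_finite[OF p])
  finally show ?thesis .
qed

lemma norm_sum_disjoint_le:
  assumes A: "\<And>i. i < n \<Longrightarrow> positive (A i)" and disj: "disjoint_family_on A {..<n}" and \<sigma>: "\<And>i. \<bar>\<sigma> i\<bar> = 1"
  shows "norm (\<Sum>i<n. \<sigma> i *\<^sub>R (T (indicator (A i)) /\<^sub>R N (indicator (A i)))) \<le> real n powr (1 / r)"
proof (cases "n = 0")
  case False
  define c where "c i = N (indicator (A i))" for i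
  have ind: "(indicator (A i) :: 'a \<Rightarrow> real) \<in> L" if "i < n" for i using A[OF that] by (simp add: positive_def)
  have c: "0 < c i" if "i < n" for i
  proof -
    have "\<not> (AE \<omega> in M. (indicator (A i) \<omega> :: real) = 0)"
      using A[OF that] by (simp add: positive_def indicator_eq_0_iff)
    then show ?thesis using N_eq_0_iff[OF ind[OF that]] N_nonneg[of "indicator (A i)"] by (auto simp: c_def less_le)
  qed
  define h where "h \<omega> = (\<Sum>i<n. (\<sigma> i / c i) * indicator (A i) \<omega>)" for \<omega>
  have h: "h \<in> L" unfolding h_def using ind by (intro sum_mem scale_mem) auto
  have Th: "(\<Sum>i<n. \<sigma> i *\<^sub>R (T (indicator (A i)) /\<^sub>R N (indicator (A i)))) = T h"
    unfolding h_def using ind by (subst T_sum) (auto simp: scale_mem T_scale c_def divide_inverse)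
  have h_val: "h \<omega> = \<sigma> i / c i" if "i < n" "\<omega> \<in> A i" for i \<omega>
  proof -
    have "h \<omega> = \<sigma> i / c i * indicator (A i) \<omega>"
      unfolding h_def using that by (intro sum_disjoint_family[OF disj]) auto
    then show ?thesis using that by simp
  qed
  have h_0: "h \<omega> = 0" if "\<And>i. i < n \<Longrightarrow> \<omega> \<notin> A i" for \<omega>
    unfolding h_def using that by (intro sum.neutral) auto
  have "N h \<le> real n powr (1 / r)"
  proof (cases "p = \<infinity>")
    case True
    have "1 \<le> c i" if "i < n" for i
    proof (rule ccontr)
      assume "\<not> 1 \<le> c i"
      have "AE \<omega> in M. \<omega> \<notin> A i"
        using AE_abs_le_N[OF True ind[OF that]]
        by eventually_elim (use \<open>\<not> 1 \<le> c i\<close> in \<open>auto simp: c_def split: split_indicator_asm\<close>)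
      then show False using A[OF that] by (simp add: positive_def)
    qed
    then have "\<bar>\<sigma> i / c i\<bar> \<le> 1" if "i < n" for i
      using that c[OF that] \<sigma>[of i] by (simp add: abs_divide)
    then have "\<bar>h \<omega>\<bar> \<le> 1" for \<omega>
      using h_0[of \<omega>] h_val[of _ \<omega>] by (cases "\<exists>i<n. \<omega> \<in> A i") auto
    then have "N h \<le> 1" using h by (intro N_infinite_le True) (auto simp: L_measurable)
    then show ?thesis using False True by simp
  next
    case p: False
    have r: "1 \<le> r" using p by (rule r_ge_1)
    have int: "integrable M (\<lambda>\<omega>. \<bar>indicator (A i) \<omega>\<bar> powr r)" if "i < n" for i
      using ind[OF that] p by (simp add: L_finite_iff)
    have "\<bar>h \<omega>\<bar> powr r = (\<Sum>i<n. (1 / c i powr r) * \<bar>indicator (A i) \<omega>\<bar> powr r)" for \<omega>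
    proof (cases "\<exists>i<n. \<omega> \<in> A i")
      case True
      then obtain i where i: "i < n" "\<omega> \<in> A i" by blast
      have "(\<Sum>j<n. (1 / c j powr r) * \<bar>indicator (A j) \<omega>\<bar> powr r) = (1 / c i powr r) * \<bar>indicator (A i) \<omega>\<bar> powr r"
        using i by (intro sum_disjoint_family[OF disj]) auto
      also have "\<dots> = \<bar>h \<omega>\<bar> powr r"
        using i c[OF i(1)] \<sigma>[of i] h_val[OF i] by (simp add: abs_divide powr_divide)
      finally show ?thesis by simp
    next
      case False
      then show ?thesis using h_0[of \<omega>] by (auto intro!: sum.neutral[symmetric])
    qed
    then have "N h powr r = (LINT \<omega>|M. (\<Sum>i<n. (1 / c i powr r) * \<bar>indicator (A i) \<omega>\<bar> powr r))"
      by (simp add: N_finite[OF p])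
    also have "\<dots> = (\<Sum>i<n. (1 / c i powr r) * (LINT \<omega>|M. \<bar>indicator (A i) \<omega>\<bar> powr r))"
      using int by (subst Bochner_Integration.integral_sum) auto
    also have "\<dots> = (\<Sum>i<n. 1)"
    proof (intro sum.cong refl)
      fix i assume "i \<in> {..<n}"
      moreover have "(LINT \<omega>|M. \<bar>indicator (A i) \<omega>\<bar> powr r) = c i powr r"
        unfolding c_def by (rule N_finite[OF p, symmetric])
      ultimately show "(1 / c i powr r) * (LINT \<omega>|M. \<bar>indicator (A i) \<omega>\<bar> powr r) = 1"
        using c[of i] by (simp only:) simp
    qed
    finally have "(N h powr r) powr (1 / r) = real n powr (1 / r)" by simp
    then show ?thesis using r N_nonneg[of h] by (simp add: powr_powr)
  qed
  then show ?thesis unfolding Th using h by (simp add: norm_T)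
qed simp

text \<open>
  The functionals come from the Hahn--Banach theorem rather than from integration, because for \<open>p = \<infinity>\<close> the
  sets may have infinite measure. Being bounded by the norm of the restriction to the set, they inherit
  biorthogonality and the \<open>\<ell>\<^sub>p\<close> bound from the disjointness of the sets. A pairing function arranges the sets in
  blocks.
\<close>

theorem coordinates_exist:
  assumes "infinite_dimensional TYPE('x)"
  obtains e :: "nat \<Rightarrow> nat \<Rightarrow> 'x" and \<xi> where "block_coordinates e \<xi>"
    and "p \<noteq> \<infinity> \<Longrightarrow> \<forall>k n x. (\<Sum>i<n. \<bar>\<xi> k i x\<bar> powr r) \<le> norm x powr r"
    and "\<And>k n \<sigma>. (\<forall>i. \<bar>\<sigma> i\<bar> = 1) \<Longrightarrow> norm (\<Sum>i<n. \<sigma> i *\<^sub>R e k i) \<le> real n powr (1 / r)"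
proof -
  obtain E :: "nat \<Rightarrow> 'a set" where E: "\<And>i. positive (E i)" and disj: "disjoint_family E"
    using finite_dimensional_if_not_splits assms disjoint_positive_sequence by metis
  have sets: "E i \<in> sets M" and ind: "(indicator (E i) :: 'a \<Rightarrow> real) \<in> L" for i
    using E by (auto simp: positive_def)
  have pos: "N (indicator (E i)) \<noteq> 0" for i
    using E[of i] N_eq_0_iff[OF ind, of i] by (simp add: positive_def indicator_eq_0_iff)
  define v where "v i = T (indicator (E i)) /\<^sub>R N (indicator (E i))" for i
  have nv: "norm (v i) = 1" for i using pos[of i] N_nonneg[of "indicator (E i)"] by (simp add: v_def norm_T ind)
  have rv: "restrict_to (E i) (v j) = (if i = j then v j else 0)" for i j
  proof -
    have "restrict_to (E i) (T (indicator (E j))) = (if i = j then T (indicator (E j)) else 0)"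
    proof -
      have "(\<lambda>\<omega>. indicator (E i) \<omega> * indicator (E j) \<omega>) = (if i = j then indicator (E j) else (\<lambda>_. 0 :: real))"
        using disj by (auto simp: disjoint_family_on_def fun_eq_iff split: split_indicator)
      then show ?thesis by (simp add: restrict_to_T sets ind T_zero)
    qed
    then show ?thesis by (simp add: v_def linear_scale[OF linear_restrict_to[OF sets]])
  qed
  have "\<exists>\<Lambda>. bounded_linear \<Lambda> \<and> \<Lambda> (v i) = (1::real) \<and> (\<forall>x. \<bar>\<Lambda> x\<bar> \<le> norm (restrict_to (E i) x))" for i
    by (intro norming_functional linear_restrict_to norm_restrict_to sets) (auto simp: rv nv)
  then obtain \<Lambda> where \<Lambda>: "\<And>i. bounded_linear (\<Lambda> i)" "\<And>i. \<Lambda> i (v i) = (1::real)"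
    "\<And>i x. \<bar>\<Lambda> i x\<bar> \<le> norm (restrict_to (E i) x)" by metis
  have \<Lambda>0: "\<Lambda> i (v j) = 0" if "i \<noteq> j" for i j using \<Lambda>(3)[of i "v j"] that by (simp add: rv)
  define e where "e k i = v (prod_encode (k, i))" for k i
  define \<xi> where "\<xi> k i = \<Lambda> (prod_encode (k, i))" for k i
  have disj': "disjoint_family_on (\<lambda>i. E (prod_encode (k, i))) I" for k I
    using disj by (auto simp: disjoint_family_on_def prod_encode_eq)
  show thesis
  proof (rule that[of e \<xi>])
    show "block_coordinates e \<xi>"
    proof (rule block_coordinates.intro)
      show "bounded_linear (\<xi> k i)" for k i unfolding \<xi>_def by (rule \<Lambda>(1))
      show "\<xi> k i (e l j) = (if k = l \<and> i = j then 1 else 0)" for k i l j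
        by (auto simp: \<xi>_def e_def \<Lambda>(2) \<Lambda>0 prod_encode_eq)
      show "\<bar>\<xi> k i x\<bar> \<le> norm x" for k i x
        unfolding \<xi>_def by (rule order_trans[OF \<Lambda>(3) norm_restrict_to[OF sets]])
      show "norm (e k i) \<le> 1" for k i by (simp add: e_def nv)
    qed
    show "\<forall>k n x. (\<Sum>i<n. \<bar>\<xi> k i x\<bar> powr r) \<le> norm x powr r" if p: "p \<noteq> \<infinity>"
    proof (intro allI)
      fix k n x
      have "(\<Sum>i<n. \<bar>\<xi> k i x\<bar> powr r) \<le> (\<Sum>i<n. norm (restrict_to (E (prod_encode (k, i))) x) powr r)"
        unfolding \<xi>_def using r_ge_1[OF p] by (intro sum_mono powr_mono2 \<Lambda>(3)) auto
      also have "\<dots> \<le> norm x powr r" by (intro sum_norm_restrict_to p disj' sets) auto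
      finally show "(\<Sum>i<n. \<bar>\<xi> k i x\<bar> powr r) \<le> norm x powr r" .
    qed
    show "norm (\<Sum>i<n. \<sigma> i *\<^sub>R e k i) \<le> real n powr (1 / r)" if "\<forall>i. \<bar>\<sigma> i\<bar> = 1" for k n \<sigma>
      unfolding e_def v_def using that by (intro norm_sum_disjoint_le E disj') auto
  qed
qed

end

section \<open>Quadratic forms on $L_p$ for $p \geq 2$\<close>

subsection \<open>Approximation by finitely valued functions\<close>

text \<open>
  Cap the absolute value at \<open>k\<close>, then round towards \<open>0\<close> to a multiple of \<open>1 / k\<close>.
\<close>

definition discretize :: "nat \<Rightarrow> real \<Rightarrow> real" where
  "discretize k t = sgn t * (of_int \<lfloor>real k * min \<bar>t\<bar> (real k)\<rfloor> / real k)"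

lemma discretize_measurable [measurable]: "discretize k \<in> borel_measurable borel"
  unfolding discretize_def[abs_def] by measurable

lemma finite_range_discretize: "finite (range (discretize k))"
proof -
  have "discretize k t \<in> (\<lambda>(s, m). s * (of_int m / real k)) ` ({- 1, 0, 1} \<times> {0..int (k * k)})" for t
  proof -
    have "real k * min \<bar>t\<bar> (real k) \<le> real k * real k" by (intro mult_left_mono) auto
    then have "\<lfloor>real k * min \<bar>t\<bar> (real k)\<rfloor> \<in> {0..int (k * k)}" by (auto simp: floor_le_iff)
    moreover have "sgn t \<in> {- 1, 0, 1}" by (auto simp: sgn_if)
    ultimately show ?thesis
      unfolding discretize_def by (intro image_eqI[of _ _ "(sgn t, \<lfloor>real k * min \<bar>t\<bar> (real k)\<rfloor>)"]) auto
  qed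
  then have "range (discretize k) \<subseteq> (\<lambda>(s, m). s * (of_int m / real k)) ` ({- 1, 0, 1} \<times> {0..int (k * k)})"
    by blast
  then show ?thesis by (rule finite_subset) auto
qed

lemma discretize_zero: "discretize k 0 = 0"
  by (simp add: discretize_def)

lemma abs_discretize_le: "\<bar>discretize k t\<bar> \<le> \<bar>t\<bar>"
  and abs_discretize_diff_le: "\<bar>discretize k t - t\<bar> \<le> \<bar>t\<bar>"
  and discretize_near: "\<bar>t\<bar> \<le> real k \<Longrightarrow> 0 < k \<Longrightarrow> \<bar>discretize k t - t\<bar> \<le> 1 / real k"
proof -
  define u where "u = of_int \<lfloor>real k * min \<bar>t\<bar> (real k)\<rfloor> / real k"
  have u0: "0 \<le> u" by (simp add: u_def)
  have ut: "u \<le> \<bar>t\<bar>"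
  proof (cases "k = 0")
    case False
    have "of_int \<lfloor>real k * min \<bar>t\<bar> (real k)\<rfloor> \<le> real k * min \<bar>t\<bar> (real k)" by (rule of_int_floor_le)
    then have "u \<le> real k * min \<bar>t\<bar> (real k) / real k" unfolding u_def by (intro divide_right_mono) auto
    then have "u \<le> min \<bar>t\<bar> (real k)" using False by simp
    then show ?thesis by simp
  qed (simp add: u_def)
  have d: "discretize k t = sgn t * u" by (simp add: discretize_def u_def)
  have dt: "\<bar>discretize k t - t\<bar> = \<bar>t\<bar> - u"
    using ut u0 by (cases "t > 0"; cases "t = 0") (auto simp: d sgn_if u_def discretize_zero)
  show "\<bar>discretize k t\<bar> \<le> \<bar>t\<bar>" using ut u0 by (simp add: d abs_mult abs_sgn_eq)
  show "\<bar>discretize k t - t\<bar> \<le> \<bar>t\<bar>" using dt u0 by simp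
  assume k: "\<bar>t\<bar> \<le> real k" "0 < k"
  have "real k * \<bar>t\<bar> < of_int \<lfloor>real k * \<bar>t\<bar>\<rfloor> + 1" by linarith
  then have "\<bar>t\<bar> < u + 1 / real k" using k by (simp add: u_def field_simps)
  then show "\<bar>discretize k t - t\<bar> \<le> 1 / real k" using dt by simp
qed

lemma (in Lp_space) discretize_mem: "f \<in> L \<Longrightarrow> (\<lambda>\<omega>. discretize k (f \<omega>)) \<in> L"
  using L_measurable[of f] by (auto intro: dominated_mem simp: abs_discretize_le)

lemma (in Lp_space) T_discretize_tendsto:
  assumes f: "f \<in> L"
  shows "(\<lambda>k. T (\<lambda>\<omega>. discretize k (f \<omega>))) \<longlonglongrightarrow> T f"
proof -
  note [measurable] = L_measurable[OF f]
  define g where "g k \<omega> = discretize k (f \<omega>) - f \<omega>" for k \<omega>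
  have g: "g k \<in> L" for k unfolding g_def by (intro diff_mem discretize_mem f)
  have gm: "g k \<in> borel_measurable M" for k using g by (rule L_measurable)
  have "(\<lambda>k. N (g k)) \<longlonglongrightarrow> 0"
  proof (cases "p = \<infinity>")
    case True
    have "\<forall>\<^sub>F k in sequentially. N (g k) \<le> 1 / real k"
      using eventually_ge_at_top[of "max 1 (nat \<lceil>N f\<rceil>)"]
    proof eventually_elim
      case (elim k)
      then have k: "0 < k" "N f \<le> real k" by auto
      have "AE \<omega> in M. \<bar>g k \<omega>\<bar> \<le> 1 / real k"
        using AE_abs_le_N[OF True f]
        by eventually_elim (use k in \<open>auto simp: g_def intro!: discretize_near\<close>)
      then show ?case by (intro N_infinite_le True gm) auto
    qed
    moreover have "(\<lambda>k. 1 / real k) \<longlonglongrightarrow> 0" by (rule lim_1_over_n)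
    ultimately show ?thesis
      by (intro tendsto_sandwich[of "\<lambda>_. 0" "\<lambda>k. N (g k)" sequentially "\<lambda>k. 1 / real k"]) (auto simp: N_nonneg)
  next
    case False
    have r: "1 \<le> r" using False by (rule r_ge_1)
    have "(\<lambda>k. LINT \<omega>|M. \<bar>g k \<omega>\<bar> powr r) \<longlonglongrightarrow> (LINT \<omega>|M. 0)"
    proof (rule integral_dominated_convergence)
      show "integrable M (\<lambda>\<omega>. \<bar>f \<omega>\<bar> powr r)" using f False by (simp add: L_finite_iff)
      show "(\<lambda>\<omega>. \<bar>g k \<omega>\<bar> powr r) \<in> borel_measurable M" for k using gm[of k] by measurable
      show "AE \<omega> in M. norm (\<bar>g k \<omega>\<bar> powr r) \<le> \<bar>f \<omega>\<bar> powr r" for k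
        using r by (intro AE_I2) (auto simp: g_def intro!: powr_mono2 abs_discretize_diff_le)
      show "AE \<omega> in M. (\<lambda>k. \<bar>g k \<omega>\<bar> powr r) \<longlonglongrightarrow> 0"
      proof (intro AE_I2)
        fix \<omega>
        have "\<forall>\<^sub>F k in sequentially. \<bar>g k \<omega>\<bar> \<le> 1 / real k"
          using eventually_ge_at_top[of "max 1 (nat \<lceil>\<bar>f \<omega>\<bar>\<rceil>)"]
        proof eventually_elim
          case (elim k)
          then have k: "0 < k" "\<bar>f \<omega>\<bar> \<le> real k" by auto
          then show ?case by (auto simp: g_def intro!: discretize_near)
        qed
        then have "(\<lambda>k. \<bar>g k \<omega>\<bar>) \<longlonglongrightarrow> 0"
          using lim_1_over_n
          by (intro tendsto_sandwich[of "\<lambda>_. 0" "\<lambda>k. \<bar>g k \<omega>\<bar>" sequentially "\<lambda>k. 1 / real k"]) auto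
        then have "(\<lambda>k. \<bar>g k \<omega>\<bar> powr r) \<longlonglongrightarrow> 0 powr r"
          using r by (intro tendsto_powr') auto
        then show "(\<lambda>k. \<bar>g k \<omega>\<bar> powr r) \<longlonglongrightarrow> 0" by simp
      qed
    qed auto
    then have "(\<lambda>k. (LINT \<omega>|M. \<bar>g k \<omega>\<bar> powr r) powr (1 / r)) \<longlonglongrightarrow> 0 powr (1 / r)"
      using r by (intro tendsto_powr') (auto simp: Bochner_Integration.integral_nonneg)
    then show ?thesis using False by (simp add: Lp_norm_def)
  qed
  moreover have "norm (T (\<lambda>\<omega>. discretize k (f \<omega>)) - T f) = N (g k)" for k
    using g[of k] f unfolding g_def by (simp add: T_diff[symmetric] discretize_mem norm_T)
  ultimately have "(\<lambda>k. T (\<lambda>\<omega>. discretize k (f \<omega>)) - T f) \<longlonglongrightarrow> 0"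
    by (subst tendsto_norm_zero_iff[symmetric]) simp
  then show ?thesis by (rule LIM_zero_cancel)
qed

subsection \<open>Square functions of finite families\<close>

definition square_sum :: "('a \<Rightarrow> real) list \<Rightarrow> 'a \<Rightarrow> real" where
  "square_sum fs \<omega> = (\<Sum>f\<leftarrow>fs. (f \<omega>)\<^sup>2)"

lemma square_sum_simps [simp]:
  "square_sum [] \<omega> = 0"
  "square_sum (f # fs) \<omega> = (f \<omega>)\<^sup>2 + square_sum fs \<omega>"
  "square_sum (fs @ gs) \<omega> = square_sum fs \<omega> + square_sum gs \<omega>"
  by (simp_all add: square_sum_def)

lemma square_sum_nonneg: "0 \<le> square_sum fs \<omega>"
  by (induction fs) auto

context Lp_space
begin

lemma sqrt_square_sum_mem: "set fs \<subseteq> L \<Longrightarrow> (\<lambda>\<omega>. sqrt (square_sum fs \<omega>)) \<in> L"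
proof (induction fs)
  case (Cons f fs)
  then have "(\<lambda>\<omega>. sqrt ((f \<omega>)\<^sup>2 + (sqrt (square_sum fs \<omega>))\<^sup>2)) \<in> L"
    by (intro sqrt_sum_squares_mem) auto
  then show ?case by (simp add: square_sum_nonneg)
qed (simp add: zero_mem)

context
  fixes b :: "'x \<Rightarrow> 'x \<Rightarrow> real" and C :: real
  assumes b: "bounded_bilinear b" and C: "C > 0" and b_bound: "\<And>x y. \<bar>b x y\<bar> \<le> C * norm x * norm y"
begin

interpretation b: bounded_bilinear b by (rule b)

text \<open>
  Finitely many finitely valued functions are constant on the members of a finite partition.
  On the functions adapted to this partition the form is given by a matrix, and Grothendieck's
  inequality applies to it.
\<close>

lemma grothendieck_finite_valued:
  assumes gs: "set gs \<subseteq> L" and fin: "\<And>g. g \<in> set gs \<Longrightarrow> finite (range g)"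
  shows "\<bar>\<Sum>g\<leftarrow>gs. b (T g) (T g)\<bar> \<le> 1000 * C * (N (\<lambda>\<omega>. sqrt (square_sum gs \<omega>)))\<^sup>2"
proof -
  define n where "n = length gs"
  define G where "G \<omega> = map (\<lambda>g. g \<omega>) gs" for \<omega>
  define J where "J = G ` space M - {replicate n 0}"
  define A where "A v = {\<omega> \<in> space M. G \<omega> = v}" for v
  have mem: "gs ! i \<in> L" if "i < n" for i using gs that by (auto simp: n_def)
  have G_nth: "G \<omega> ! i = (gs ! i) \<omega>" if "i < n" for i \<omega> using that by (simp add: G_def n_def)
  have len: "length (G \<omega>) = n" for \<omega> by (simp add: G_def n_def)
  have finJ: "finite J"
  proof -
    have sub: "range G \<subseteq> {v. set v \<subseteq> (\<Union>g\<in>set gs. range g) \<and> length v = n}"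
      by (auto simp: G_def n_def) blast
    have "finite (\<Union>g\<in>set gs. range g)" using fin by auto
    then have "finite (range G)" by (rule finite_subset[OF sub finite_lists_length_eq])
    then have "finite (G ` space M)" by (rule finite_subset[rotated]) auto
    then show ?thesis by (simp add: J_def)
  qed
  have A_sets: "A v \<in> sets M" for v
  proof (cases "length v = n")
    case True
    have "A v = {\<omega> \<in> space M. \<forall>i\<in>{..<n}. (gs ! i) \<omega> = v ! i}"
      using True by (auto simp: A_def list_eq_iff_nth_eq len G_nth)
    also have "\<dots> \<in> sets M"
    proof (intro sets.sets_Collect_finite_All)
      fix i assume "i \<in> {..<n}"
      then have [measurable]: "gs ! i \<in> borel_measurable M" using mem L_measurable by auto
      show "{\<omega> \<in> space M. (gs ! i) \<omega> = v ! i} \<in> sets M" by measurable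
    qed auto
    finally show ?thesis .
  next
    case False
    then have "A v = {}" by (auto simp: A_def len)
    then show ?thesis by simp
  qed
  have ind: "(indicator (A v) :: 'a \<Rightarrow> real) \<in> L" if "v \<in> J" for v
  proof -
    have "length v = n" "v \<noteq> replicate n 0" using that by (auto simp: J_def len)
    then obtain i where i: "i < n" "v ! i \<noteq> 0" by (auto simp: list_eq_iff_nth_eq)
    show ?thesis
    proof (rule dominated_mem[OF scale_mem[OF mem[OF i(1)], of "1 / (v ! i)"]])
      have "\<bar>indicator (A v) \<omega>\<bar> \<le> \<bar>1 / (v ! i) * (gs ! i) \<omega>\<bar>" for \<omega>
        using i G_nth[OF i(1), of \<omega>] by (auto simp: A_def split: split_indicator)
      then show "AE \<omega> in M. \<bar>indicator (A v) \<omega>\<bar> \<le> \<bar>1 / (v ! i) * (gs ! i) \<omega>\<bar>" by simp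
    qed (intro borel_measurable_indicator A_sets)
  qed
  define E where "E a \<omega> = (\<Sum>v\<in>J. a v * indicator (A v) \<omega>)" for a :: "real list \<Rightarrow> real" and \<omega>
  have E_mem: "E a \<in> L" for a unfolding E_def by (intro sum_mem scale_mem ind finJ)
  have T_E: "T (E a) = (\<Sum>v\<in>J. a v *\<^sub>R T (indicator (A v)))" for a
    unfolding E_def by (subst T_sum) (simp_all add: finJ scale_mem ind T_scale)
  have E_val: "E a \<omega> = (if G \<omega> \<in> J then a (G \<omega>) else 0)" if "\<omega> \<in> space M" for a \<omega>
  proof -
    have "E a \<omega> = (\<Sum>v\<in>J. if v = G \<omega> then a v else 0)"
      unfolding E_def using that by (intro sum.cong) (auto simp: A_def)
    then show ?thesis using finJ by simp
  qed
  define B where "B v w = b (T (indicator (A v))) (T (indicator (A w))) / C" for v w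
  define nm where "nm a = N (E a)" for a
  have form: "(\<Sum>v\<in>J. \<Sum>w\<in>J. B v w * a v * c w) = b (T (E a)) (T (E c)) / C" for a c
    unfolding T_E B_def
    by (subst sum.swap) (simp add: b.sum_left b.sum_right b.scaleR_left b.scaleR_right sum_divide_distrib sum_distrib_left mult_ac)
  interpret F: lattice_form J B nm
  proof
    show "finite J" by (rule finJ)
    fix a a' :: "real list \<Rightarrow> real" and c :: real
    show "nm a \<le> nm a'" if le: "\<And>v. v \<in> J \<Longrightarrow> \<bar>a v\<bar> \<le> \<bar>a' v\<bar>"
      unfolding nm_def
      by (intro dominated_norm[OF E_mem L_measurable[OF E_mem]] AE_I2) (auto simp: E_val le)
    have "E (\<lambda>v. c * a v) = (\<lambda>\<omega>. c * E a \<omega>)" by (simp add: fun_eq_iff E_def sum_distrib_left mult.assoc)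
    then show "nm (\<lambda>v. c * a v) = \<bar>c\<bar> * nm a" by (simp add: nm_def N_scale E_mem)
    show "0 \<le> nm a" by (simp add: nm_def N_nonneg)
    have "\<bar>b (T (E a)) (T (E a'))\<bar> \<le> C * (nm a * nm a')"
      using b_bound[of "T (E a)" "T (E a')"] by (simp add: nm_def norm_T E_mem mult.assoc)
    then show "\<bar>\<Sum>v\<in>J. \<Sum>w\<in>J. B v w * a v * a' w\<bar> \<le> nm a * nm a'"
      unfolding form using C by (simp add: field_simps)
  qed
  define as :: "(real list \<Rightarrow> real) list" where "as = map (\<lambda>i v. v ! i) [0..<n]"
  have T_nth: "T (E (\<lambda>v. v ! i)) = T (gs ! i)" if "i < n" for i
  proof -
    have "AE \<omega> in M. E (\<lambda>v. v ! i) \<omega> = (gs ! i) \<omega>"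
    proof (rule AE_I2)
      fix \<omega> assume \<omega>: "\<omega> \<in> space M"
      show "E (\<lambda>v. v ! i) \<omega> = (gs ! i) \<omega>"
      proof (cases "G \<omega> \<in> J")
        case True then show ?thesis using \<omega> that by (simp add: E_val G_nth)
      next
        case False
        then have "G \<omega> = replicate n 0" using \<omega> by (auto simp: J_def)
        then show ?thesis using \<omega> that False G_nth[OF that, of \<omega>] by (simp add: E_val)
      qed
    qed
    then show ?thesis using T_eq_iff[OF E_mem mem[OF that]] by blast
  qed
  have "(\<Sum>a\<leftarrow>as. F.q a) = (\<Sum>i\<leftarrow>[0..<n]. b (T (gs ! i)) (T (gs ! i)) / C)"
    unfolding as_def map_map o_def F.q_def form by (intro arg_cong[where f = sum_list] map_cong) (auto simp: T_nth)
  also have "\<dots> = (\<Sum>g\<leftarrow>map (\<lambda>i. gs ! i) [0..<n]. b (T g) (T g) / C)" by (simp only: map_map o_def)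
  also have "map (\<lambda>i. gs ! i) [0..<n] = gs" by (simp add: n_def map_nth)
  also have "(\<Sum>g\<leftarrow>gs. b (T g) (T g) / C) = (\<Sum>g\<leftarrow>gs. b (T g) (T g)) / C"
    by (induction gs) (auto simp: add_divide_distrib)
  finally have "\<bar>(\<Sum>g\<leftarrow>gs. b (T g) (T g)) / C\<bar> \<le> 1000 * (nm (square_function as))\<^sup>2"
    using F.grothendieck[of as] by simp
  moreover have "nm (square_function as) \<le> N (\<lambda>\<omega>. sqrt (square_sum gs \<omega>))"
    unfolding nm_def
  proof (rule dominated_norm[OF sqrt_square_sum_mem[OF gs] L_measurable[OF E_mem]], rule AE_I2)
    fix \<omega> assume \<omega>: "\<omega> \<in> space M"
    have "(\<Sum>a\<leftarrow>as. (a (G \<omega>))\<^sup>2) = (\<Sum>v\<leftarrow>map (\<lambda>i. G \<omega> ! i) [0..<n]. v\<^sup>2)"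
      by (simp only: as_def map_map o_def)
    also have "map (\<lambda>i. G \<omega> ! i) [0..<n] = G \<omega>" using map_nth[of "G \<omega>"] by (simp add: len)
    also have "(\<Sum>v\<leftarrow>G \<omega>. v\<^sup>2) = square_sum gs \<omega>" by (simp add: G_def square_sum_def o_def)
    finally show "\<bar>E (square_function as) \<omega>\<bar> \<le> \<bar>sqrt (square_sum gs \<omega>)\<bar>"
      using \<omega> by (simp add: E_val square_function_def square_sum_nonneg)
  qed
  then have "(nm (square_function as))\<^sup>2 \<le> (N (\<lambda>\<omega>. sqrt (square_sum gs \<omega>)))\<^sup>2"
    by (intro power_mono F.nm_nonneg)
  ultimately have "\<bar>\<Sum>g\<leftarrow>gs. b (T g) (T g)\<bar> / C \<le> 1000 * (N (\<lambda>\<omega>. sqrt (square_sum gs \<omega>)))\<^sup>2"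
    using C by (simp add: abs_divide)
  then show ?thesis using C by (simp add: field_simps)
qed

text \<open>
  Discretizing decreases absolute values, so the bound for the discretized functions
  already holds with the square function of the original family.
\<close>

lemma grothendieck_Lp:
  assumes fs: "set fs \<subseteq> L"
  shows "\<bar>\<Sum>f\<leftarrow>fs. b (T f) (T f)\<bar> \<le> 1000 * C * (N (\<lambda>\<omega>. sqrt (square_sum fs \<omega>)))\<^sup>2"
proof -
  define gs where "gs k = map (\<lambda>f \<omega>. discretize k (f \<omega>)) fs" for k
  have gs: "set (gs k) \<subseteq> L" for k using fs by (auto simp: gs_def discretize_mem)
  have "\<bar>\<Sum>g\<leftarrow>gs k. b (T g) (T g)\<bar> \<le> 1000 * C * (N (\<lambda>\<omega>. sqrt (square_sum fs \<omega>)))\<^sup>2" for k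
  proof -
    have "\<bar>\<Sum>g\<leftarrow>gs k. b (T g) (T g)\<bar> \<le> 1000 * C * (N (\<lambda>\<omega>. sqrt (square_sum (gs k) \<omega>)))\<^sup>2"
      by (rule grothendieck_finite_valued[OF gs])
        (auto simp: gs_def intro: finite_subset[OF _ finite_range_discretize[of k]])
    also have "\<dots> \<le> 1000 * C * (N (\<lambda>\<omega>. sqrt (square_sum fs \<omega>)))\<^sup>2"
    proof (intro mult_left_mono power_mono N_nonneg
        dominated_norm[OF sqrt_square_sum_mem[OF fs] L_measurable[OF sqrt_square_sum_mem[OF gs]]] AE_I2)
      fix \<omega>
      have "square_sum (gs k) \<omega> \<le> square_sum fs \<omega>"
        unfolding square_sum_def gs_def map_map o_def
        by (intro sum_list_mono) (simp add: abs_discretize_le abs_le_square_iff[symmetric])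
      then show "\<bar>sqrt (square_sum (gs k) \<omega>)\<bar> \<le> \<bar>sqrt (square_sum fs \<omega>)\<bar>"
        by (simp add: square_sum_nonneg)
    qed (use C in auto)
    finally show ?thesis .
  qed
  moreover have "(\<lambda>k. \<Sum>g\<leftarrow>gs k. b (T g) (T g)) \<longlonglongrightarrow> (\<Sum>f\<leftarrow>fs. b (T f) (T f))"
    unfolding gs_def map_map o_def using fs
    by (induction fs) (auto intro!: tendsto_add b.tendsto T_discretize_tendsto)
  then have "(\<lambda>k. \<bar>\<Sum>g\<leftarrow>gs k. b (T g) (T g)\<bar>) \<longlonglongrightarrow> \<bar>\<Sum>f\<leftarrow>fs. b (T f) (T f)\<bar>"
    by (rule tendsto_rabs)
  ultimately show ?thesis by (intro LIMSEQ_le_const2) auto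
qed

end

end

subsection \<open>Separation\<close>

instantiation "fun" :: (type, real_vector) real_vector
begin

definition scaleR_fun :: "real \<Rightarrow> ('a \<Rightarrow> 'b) \<Rightarrow> 'a \<Rightarrow> 'b" where
  "scaleR_fun c f = (\<lambda>x. c *\<^sub>R f x)"

instance
  by standard (simp_all add: scaleR_fun_def fun_eq_iff scaleR_add_right scaleR_add_left)

end

lemma scaleR_fun_apply [simp]: "(c *\<^sub>R f) x = c *\<^sub>R f x"
  by (simp add: scaleR_fun_def)

context Lp_space
begin

text \<open>
  The space \<open>L\<^sub>p\<^sub>/\<^sub>2\<close>, and the norm of the positive part of a function there. Expressing both by square roots
  in \<open>L\<^sub>p\<close> covers finite and infinite \<open>p\<close> at the same time.
\<close>

definition L_half :: "('a \<Rightarrow> real) set" where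
  "L_half = {h \<in> borel_measurable M. (\<lambda>\<omega>. sqrt \<bar>h \<omega>\<bar>) \<in> L}"

definition pos_norm :: "('a \<Rightarrow> real) \<Rightarrow> real" where
  "pos_norm h = (N (\<lambda>\<omega>. sqrt (max 0 (h \<omega>))))\<^sup>2"

lemma L_half_dominated:
  assumes "f \<in> L" "h \<in> borel_measurable M" "\<And>\<omega>. \<bar>h \<omega>\<bar> \<le> (f \<omega>)\<^sup>2"
  shows "h \<in> L_half"
proof -
  have "sqrt \<bar>h \<omega>\<bar> \<le> \<bar>f \<omega>\<bar>" for \<omega> using real_sqrt_le_mono[OF assms(3)[of \<omega>]] by simp
  then have "(\<lambda>\<omega>. sqrt \<bar>h \<omega>\<bar>) \<in> L"
    using assms(2) by (intro dominated_mem[OF assms(1)]) auto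
  then show ?thesis using assms(2) by (simp add: L_half_def)
qed

lemma L_half_add: "h \<in> L_half \<Longrightarrow> k \<in> L_half \<Longrightarrow> h + k \<in> L_half"
  by (rule L_half_dominated[OF sqrt_sum_squares_mem, of "\<lambda>\<omega>. sqrt \<bar>h \<omega>\<bar>" "\<lambda>\<omega>. sqrt \<bar>k \<omega>\<bar>"])
    (auto simp: L_half_def plus_fun_def)

lemma L_half_scale: "h \<in> L_half \<Longrightarrow> c *\<^sub>R h \<in> L_half"
  by (rule L_half_dominated[OF scale_mem, of "\<lambda>\<omega>. sqrt \<bar>h \<omega>\<bar>" _ "sqrt \<bar>c\<bar>"])
    (auto simp: L_half_def scaleR_fun_def power_mult_distrib abs_mult)

lemma subspace_L_half: "subspace L_half"
proof (rule subspaceI)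
  show "0 \<in> L_half" by (simp add: L_half_def zero_fun_def zero_mem)
qed (auto intro: L_half_add L_half_scale)

lemma L_half_minus: "h \<in> L_half \<Longrightarrow> - h \<in> L_half"
  using L_half_scale[of h "- 1"] by simp

lemma L_half_product:
  assumes "f \<in> L" "g \<in> L"
  shows "(\<lambda>\<omega>. f \<omega> * g \<omega>) \<in> L_half"
proof (rule L_half_dominated[OF sqrt_sum_squares_mem[OF assms]])
  show "(\<lambda>\<omega>. f \<omega> * g \<omega>) \<in> borel_measurable M"
    using assms[THEN L_measurable] by measurable
  fix \<omega>
  have "2 * \<bar>f \<omega> * g \<omega>\<bar> \<le> (f \<omega>)\<^sup>2 + (g \<omega>)\<^sup>2"
    using sum_squares_bound[of "\<bar>f \<omega>\<bar>" "\<bar>g \<omega>\<bar>"] by (simp add: abs_mult mult.assoc)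
  moreover have "0 \<le> \<bar>f \<omega> * g \<omega>\<bar>" by simp
  ultimately show "\<bar>f \<omega> * g \<omega>\<bar> \<le> (sqrt ((f \<omega>)\<^sup>2 + (g \<omega>)\<^sup>2))\<^sup>2" by (simp del: abs_ge_zero)
qed

lemma square_sum_L_half: "set fs \<subseteq> L \<Longrightarrow> square_sum fs \<in> L_half"
proof (induction fs)
  case Nil
  have "square_sum [] = (0 :: 'a \<Rightarrow> real)" by (simp add: fun_eq_iff)
  then show ?case using subspace_0[OF subspace_L_half] by metis
next
  case (Cons f fs)
  have eq: "square_sum (f # fs) = (\<lambda>\<omega>. f \<omega> * f \<omega>) + square_sum fs"
    by (simp add: fun_eq_iff power2_eq_square)
  show ?case unfolding eq using Cons by (intro L_half_add L_half_product) auto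
qed

lemma positive_part_mem: "h \<in> L_half \<Longrightarrow> (\<lambda>\<omega>. sqrt (max 0 (h \<omega>))) \<in> L"
  by (rule dominated_mem[of "\<lambda>\<omega>. sqrt \<bar>h \<omega>\<bar>"]) (auto simp: L_half_def)

lemma pos_norm_le_0: "h \<in> L_half \<Longrightarrow> AE \<omega> in M. h \<omega> \<le> 0 \<Longrightarrow> pos_norm h = 0"
proof -
  assume *: "h \<in> L_half" "AE \<omega> in M. h \<omega> \<le> 0"
  have "AE \<omega> in M. sqrt (max 0 (h \<omega>)) = 0" using *(2) by eventually_elim auto
  then show ?thesis using N_eq_0_iff[OF positive_part_mem[OF *(1)]] by (simp add: pos_norm_def)
qed

lemma pos_norm_scale:
  assumes "h \<in> L_half" "0 \<le> c"
  shows "pos_norm (c *\<^sub>R h) = c * pos_norm h"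
proof -
  have "(\<lambda>\<omega>. sqrt (max 0 ((c *\<^sub>R h) \<omega>))) = (\<lambda>\<omega>. sqrt c * sqrt (max 0 (h \<omega>)))"
  proof
    fix \<omega>
    have "max 0 (c * h \<omega>) = c * max 0 (h \<omega>)"
      using assms(2) by (auto simp: max_def mult_le_0_iff zero_le_mult_iff)
    then show "sqrt (max 0 ((c *\<^sub>R h) \<omega>)) = sqrt c * sqrt (max 0 (h \<omega>))" by (simp add: real_sqrt_mult)
  qed
  then show ?thesis
    using assms(2) by (simp add: pos_norm_def N_scale positive_part_mem[OF assms(1)] power_mult_distrib)
qed

lemma pos_norm_square_sum: "pos_norm (square_sum fs) = (N (\<lambda>\<omega>. sqrt (square_sum fs \<omega>)))\<^sup>2"
  by (simp add: pos_norm_def max_absorb2 square_sum_nonneg)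

lemma pos_norm_add:
  assumes p: "2 \<le> p" and h: "h \<in> L_half" and k: "k \<in> L_half"
  shows "pos_norm (h + k) \<le> pos_norm h + pos_norm k"
proof -
  define f g where "f \<omega> = sqrt (max 0 (h \<omega>))" and "g \<omega> = sqrt (max 0 (k \<omega>))" for \<omega>
  have fg: "f \<in> L" "g \<in> L" using h k by (simp_all add: f_def[abs_def] g_def[abs_def] positive_part_mem)
  define s where "s \<omega> = sqrt ((f \<omega>)\<^sup>2 + (g \<omega>)\<^sup>2)" for \<omega>
  have s: "s \<in> L" unfolding s_def by (rule sqrt_sum_squares_mem[OF fg])
  have "N (\<lambda>\<omega>. sqrt (max 0 ((h + k) \<omega>))) \<le> N s"
  proof (rule dominated_norm[OF s L_measurable[OF positive_part_mem[OF L_half_add[OF h k]]]])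
    have "\<bar>sqrt (max 0 ((h + k) \<omega>))\<bar> \<le> \<bar>s \<omega>\<bar>" for \<omega> by (auto simp: s_def f_def g_def)
    then show "AE \<omega> in M. \<bar>sqrt (max 0 ((h + k) \<omega>))\<bar> \<le> \<bar>s \<omega>\<bar>" by simp
  qed
  then have "pos_norm (h + k) \<le> (N s)\<^sup>2" unfolding pos_norm_def by (intro power_mono N_nonneg)
  also have "\<dots> \<le> (N f)\<^sup>2 + (N g)\<^sup>2"
  proof (cases "p = \<infinity>")
    case True
    have "N s \<le> sqrt ((N f)\<^sup>2 + (N g)\<^sup>2)"
    proof (rule N_infinite_le[OF True L_measurable[OF s]])
      show "AE \<omega> in M. \<bar>s \<omega>\<bar> \<le> sqrt ((N f)\<^sup>2 + (N g)\<^sup>2)"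
        using AE_abs_le_N[OF True fg(1)] AE_abs_le_N[OF True fg(2)]
      proof eventually_elim
        case (elim \<omega>)
        then have "(f \<omega>)\<^sup>2 + (g \<omega>)\<^sup>2 \<le> (N f)\<^sup>2 + (N g)\<^sup>2"
          by (intro add_mono) (simp_all add: abs_le_square_iff[symmetric] N_nonneg)
        then show ?case by (simp add: s_def)
      qed
    qed simp
    then have "(N s)\<^sup>2 \<le> (sqrt ((N f)\<^sup>2 + (N g)\<^sup>2))\<^sup>2" by (intro power_mono N_nonneg)
    then show ?thesis by simp
  next
    case False
    then show ?thesis unfolding s_def using p by (intro N_sqrt_sum_squares_le fg) (auto simp: compare_p)
  qed
  also have "\<dots> = pos_norm h + pos_norm k" by (simp add: pos_norm_def f_def[abs_def] g_def[abs_def])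
  finally show ?thesis .
qed

text \<open>
  By Grothendieck's inequality, \<open>S\<close> below is a finite sublinear functional on \<open>L\<^sub>p\<^sub>/\<^sub>2\<close>; here
  \<open>p \<ge> 2\<close> makes \<open>pos_norm\<close> subadditive. A linear functional \<open>\<Lambda> \<le> S\<close> is positive and bounded, and the
  one-element family \<open>[f]\<close> shows that \<open>\<Lambda> (f\<^sup>2)\<close> dominates the given form at \<open>f\<close>.
\<close>

lemma dominating_functional:
  assumes p: "2 \<le> p" and b: "bounded_bilinear b"
  shows "\<exists>\<Lambda> K. linear \<Lambda> \<and> 0 \<le> K \<and> (\<forall>h\<in>L_half. \<Lambda> h \<le> K * pos_norm h) \<and>
    (\<forall>f\<in>L. b (T f) (T f) \<le> \<Lambda> (\<lambda>\<omega>. f \<omega> * f \<omega>))"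
proof -
  interpret b: bounded_bilinear b by (rule b)
  obtain C where C: "C > 0" "\<And>x y. norm (b x y) \<le> norm x * norm y * C" using b.pos_bounded by blast
  have Cb: "\<bar>b x y\<bar> \<le> C * norm x * norm y" for x y using C(2)[of x y] by (simp add: mult_ac)
  define K where "K = 1000 * C"
  have K: "0 \<le> K" using C by (simp add: K_def)
  define Q where "Q fs = (\<Sum>f\<leftarrow>fs. b (T f) (T f))" for fs
  have QK: "Q fs \<le> K * pos_norm (square_sum fs)" if "set fs \<subseteq> L" for fs
    using grothendieck_Lp[OF b C(1) Cb that] by (simp add: Q_def K_def pos_norm_square_sum)
  define D where "D h = (\<lambda>fs. K * pos_norm (h + square_sum fs) - Q fs) ` {fs. set fs \<subseteq> L}" for h
  define S where "S h = Inf (D h)" for h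
  have low: "- (K * pos_norm (- h)) \<le> K * pos_norm (h + square_sum fs) - Q fs"
    if h: "h \<in> L_half" and fs: "set fs \<subseteq> L" for h fs
  proof -
    have "pos_norm ((h + square_sum fs) + (- h)) \<le> pos_norm (h + square_sum fs) + pos_norm (- h)"
      by (intro pos_norm_add p L_half_add h square_sum_L_half fs L_half_minus)
    then have "K * pos_norm (square_sum fs) \<le> K * pos_norm (h + square_sum fs) + K * pos_norm (- h)"
      using K by (simp add: mult_left_mono flip: distrib_left)
    then show ?thesis using QK[OF fs] by linarith
  qed
  have bdd: "bdd_below (D h)" if "h \<in> L_half" for h
    unfolding D_def by (rule bdd_belowI2) (use low[OF that] in auto)
  have S_le: "S h \<le> K * pos_norm (h + square_sum fs) - Q fs" if "h \<in> L_half" "set fs \<subseteq> L" for h fs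
    unfolding S_def using that by (intro cInf_lower[OF _ bdd]) (auto simp: D_def)
  have ge_S: "c \<le> S h" if "\<And>fs. set fs \<subseteq> L \<Longrightarrow> c \<le> K * pos_norm (h + square_sum fs) - Q fs" for c h
    unfolding S_def using that by (intro cInf_greatest) (auto simp: D_def intro: exI[of _ "[]"])
  have "\<exists>\<Lambda>. linear \<Lambda> \<and> (\<forall>h\<in>L_half. \<Lambda> h \<le> S h)"
  proof (rule hahn_banach_subspace[OF subspace_L_half])
    fix h k assume h: "h \<in> L_half" and k: "k \<in> L_half"
    have "S (h + k) - (K * pos_norm (k + square_sum gs) - Q gs) \<le> K * pos_norm (h + square_sum fs) - Q fs"
      if fs: "set fs \<subseteq> L" and gs: "set gs \<subseteq> L" for fs gs
    proof -
      have "S (h + k) \<le> K * pos_norm ((h + k) + square_sum (fs @ gs)) - Q (fs @ gs)"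
        using h k fs gs by (intro S_le L_half_add) auto
      also have "(h + k) + square_sum (fs @ gs) = (h + square_sum fs) + (k + square_sum gs)"
        by (simp add: fun_eq_iff)
      also have "K * pos_norm \<dots> \<le> K * (pos_norm (h + square_sum fs) + pos_norm (k + square_sum gs))"
        by (intro mult_left_mono pos_norm_add p L_half_add h k square_sum_L_half fs gs K)
      finally have "S (h + k) \<le> K * pos_norm (h + square_sum fs) + K * pos_norm (k + square_sum gs) - Q (fs @ gs)"
        by (simp only: distrib_left)
      moreover have "Q (fs @ gs) = Q fs + Q gs" by (simp add: Q_def)
      ultimately show ?thesis by linarith
    qed
    then have "S (h + k) - (K * pos_norm (k + square_sum gs) - Q gs) \<le> S h" if "set gs \<subseteq> L" for gs
      using that by (intro ge_S)
    then have "S (h + k) - S h \<le> K * pos_norm (k + square_sum gs) - Q gs" if "set gs \<subseteq> L" for gs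
      using that by (smt (verit, best))
    then have "S (h + k) - S h \<le> S k" by (intro ge_S)
    then show "S (h + k) \<le> S h + S k" by simp
  next
    fix c :: real and h assume c: "0 < c" and h: "h \<in> L_half"
    have "S (c *\<^sub>R h) / c \<le> K * pos_norm (h + square_sum fs) - Q fs" if fs: "set fs \<subseteq> L" for fs
    proof -
      define gs where "gs = map (\<lambda>f \<omega>. sqrt c * f \<omega>) fs"
      have gs: "set gs \<subseteq> L" using fs by (auto simp: gs_def intro: scale_mem)
      have "square_sum gs = c *\<^sub>R square_sum fs"
        using c by (simp add: fun_eq_iff gs_def square_sum_def o_def power_mult_distrib sum_list_const_mult)
      moreover have "Q gs = c * Q fs"
        unfolding Q_def gs_def using fs c
        by (induction fs) (auto simp: T_scale b.scaleR_left b.scaleR_right distrib_left mult.assoc[symmetric])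
      ultimately have "S (c *\<^sub>R h) \<le> K * pos_norm (c *\<^sub>R (h + square_sum fs)) - c * Q fs"
        using S_le[OF L_half_scale[OF h] gs, of c] by (simp add: scaleR_add_right)
      also have "pos_norm (c *\<^sub>R (h + square_sum fs)) = c * pos_norm (h + square_sum fs)"
        using c by (intro pos_norm_scale L_half_add h square_sum_L_half fs) auto
      finally have "S (c *\<^sub>R h) \<le> (K * pos_norm (h + square_sum fs) - Q fs) * c"
        by (simp only: left_diff_distrib right_diff_distrib mult_ac)
      then show ?thesis by (simp only: pos_divide_le_eq[OF c])
    qed
    then have "S (c *\<^sub>R h) / c \<le> S h" by (intro ge_S)
    then show "S (c *\<^sub>R h) \<le> c * S h" by (simp only: pos_divide_le_eq[OF c] mult.commute)
  qed
  then obtain \<Lambda> where \<Lambda>: "linear \<Lambda>" "\<And>h. h \<in> L_half \<Longrightarrow> \<Lambda> h \<le> S h" by blast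
  have "\<Lambda> h \<le> K * pos_norm h" if "h \<in> L_half" for h
  proof -
    have "h + square_sum [] = h" by (simp add: fun_eq_iff)
    then show ?thesis using \<Lambda>(2)[OF that] S_le[OF that, of "[]"] by (simp add: Q_def)
  qed
  moreover have "b (T f) (T f) \<le> \<Lambda> (\<lambda>\<omega>. f \<omega> * f \<omega>)" if f: "f \<in> L" for f
  proof -
    define h where "h = (\<lambda>\<omega>. f \<omega> * f \<omega>)"
    have h: "h \<in> L_half" unfolding h_def by (rule L_half_product[OF f f])
    have "- h + square_sum [f] = 0" by (simp add: fun_eq_iff h_def power2_eq_square)
    moreover have "pos_norm 0 = 0"
      using pos_norm_le_0[OF subspace_0[OF subspace_L_half]] by simp
    ultimately have "\<Lambda> (- h) \<le> - b (T f) (T f)"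
      using \<Lambda>(2)[OF L_half_minus[OF h]] S_le[OF L_half_minus[OF h], of "[f]"] f by (simp add: Q_def)
    then show ?thesis by (simp add: linear_neg[OF \<Lambda>(1)] h_def)
  qed
  ultimately show ?thesis using \<Lambda>(1) K by blast
qed

text \<open>
  A positive functional does not distinguish functions that agree almost everywhere, so
  \<open>(f, g) \<mapsto> \<Lambda> (f g)\<close> is a form on the classes of functions.
\<close>

theorem property_D_if_ge_2:
  assumes p: "2 \<le> p"
  shows "property_D TYPE('x)"
  unfolding property_D_def
proof (intro allI impI)
  fix q :: "'x \<Rightarrow> real" assume "continuous_quadratic_form q"
  then obtain b where b: "bounded_bilinear b" and q: "\<And>x. q x = b x x"
    unfolding continuous_quadratic_form_def by blast
  interpret b: bounded_bilinear b by (rule b)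
  obtain \<Lambda> K where \<Lambda>: "linear \<Lambda>" and K: "0 \<le> K"
    and \<Lambda>_le: "\<And>h. h \<in> L_half \<Longrightarrow> \<Lambda> h \<le> K * pos_norm h"
    and \<Lambda>_ge: "\<And>f. f \<in> L \<Longrightarrow> b (T f) (T f) \<le> \<Lambda> (\<lambda>\<omega>. f \<omega> * f \<omega>)"
    using dominating_functional[OF p b] by blast
  have \<Lambda>_nonneg: "0 \<le> \<Lambda> h" if "h \<in> L_half" "AE \<omega> in M. 0 \<le> h \<omega>" for h
    using \<Lambda>_le[OF L_half_minus[OF that(1)]] pos_norm_le_0[OF L_half_minus[OF that(1)]] that(2)
    by (simp add: linear_neg[OF \<Lambda>])
  have \<Lambda>_cong: "\<Lambda> h = \<Lambda> k" if "h \<in> L_half" "k \<in> L_half" "AE \<omega> in M. h \<omega> = k \<omega>" for h k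
  proof -
    have "h - k \<in> L_half" "k - h \<in> L_half"
      using that subspace_diff[OF subspace_L_half] by auto
    moreover have "AE \<omega> in M. 0 \<le> (h - k) \<omega>" "AE \<omega> in M. 0 \<le> (k - h) \<omega>"
      using that(3) by (eventually_elim, simp)+
    ultimately have "0 \<le> \<Lambda> (h - k)" "0 \<le> \<Lambda> (k - h)" using \<Lambda>_nonneg by auto
    then show ?thesis by (simp add: linear_diff[OF \<Lambda>])
  qed
  define rep where "rep x = (SOME f. f \<in> L \<and> T f = x)" for x
  have rep: "rep x \<in> L" "T (rep x) = x" for x
    using someI_ex[of "\<lambda>f. f \<in> L \<and> T f = x"] T_onto[of x] by (auto simp: rep_def)
  define a where "a x y = \<Lambda> (\<lambda>\<omega>. rep x \<omega> * rep y \<omega>)" for x y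
  have a_T: "a (T f) (T g) = \<Lambda> (\<lambda>\<omega>. f \<omega> * g \<omega>)" if "f \<in> L" "g \<in> L" for f g
    unfolding a_def
  proof (rule \<Lambda>_cong)
    have "AE \<omega> in M. rep (T f) \<omega> = f \<omega>" "AE \<omega> in M. rep (T g) \<omega> = g \<omega>"
      using T_eq_iff[OF rep(1) that(1)] T_eq_iff[OF rep(1) that(2)] rep(2) by auto
    then show "AE \<omega> in M. rep (T f) \<omega> * rep (T g) \<omega> = f \<omega> * g \<omega>" by eventually_elim simp
  qed (intro L_half_product rep that)+
  have a_commute: "a x y = a y x" for x y by (simp add: a_def mult.commute)
  have a_add: "a (x + x') y = a x y + a x' y" for x x' y
  proof -
    have "a (T (\<lambda>\<omega>. rep x \<omega> + rep x' \<omega>)) (T (rep y)) = \<Lambda> ((\<lambda>\<omega>. rep x \<omega> * rep y \<omega>) + (\<lambda>\<omega>. rep x' \<omega> * rep y \<omega>))"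
      by (subst a_T) (auto simp: add_mem rep plus_fun_def distrib_right)
    then show ?thesis by (simp add: linear_add[OF \<Lambda>] T_add rep a_def)
  qed
  have a_scale: "a (c *\<^sub>R x) y = c * a x y" for c x y
  proof -
    have "a (T (\<lambda>\<omega>. c * rep x \<omega>)) (T (rep y)) = \<Lambda> (c *\<^sub>R (\<lambda>\<omega>. rep x \<omega> * rep y \<omega>))"
      by (subst a_T) (auto simp: scale_mem rep scaleR_fun_def mult.assoc)
    then show ?thesis by (simp add: linear_scale[OF \<Lambda>] T_scale rep a_def)
  qed
  have a_add': "a x (y + y') = a x y + a x y'" for x y y' using a_add[of y y' x] by (simp add: a_commute)
  have a_scale': "a x (c *\<^sub>R y) = c * a x y" for c x y using a_scale[of c y x] by (simp add: a_commute)
  have a_nonneg: "0 \<le> a x x" for x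
    unfolding a_def by (intro \<Lambda>_nonneg L_half_product rep) simp
  have a_le: "a x x \<le> K * (norm x)\<^sup>2" for x
  proof -
    have "square_sum [rep x] = (\<lambda>\<omega>. rep x \<omega> * rep x \<omega>)" by (simp add: fun_eq_iff power2_eq_square)
    moreover have "pos_norm (square_sum [rep x]) = (norm x)\<^sup>2"
    proof -
      have "N (\<lambda>\<omega>. sqrt (square_sum [rep x] \<omega>)) = N (rep x)"
        using rep(1)[of x] sqrt_square_sum_mem[of "[rep x]"] by (intro N_cong) auto
      then show ?thesis unfolding pos_norm_square_sum using norm_T[OF rep(1)[of x]] rep(2)[of x] by simp
    qed
    ultimately show ?thesis
      unfolding a_def using \<Lambda>_le[OF L_half_product[OF rep(1) rep(1)], of x x] by metis
  qed
  have a_bound2: "\<bar>a x y\<bar> \<le> K * ((norm x)\<^sup>2 + (norm y)\<^sup>2) / 2" for x y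
  proof -
    have "a (x + y) (x + y) = a x x + 2 * a x y + a y y"
      by (simp add: a_add a_add' a_commute[of y x])
    moreover have "a (x + (- 1) *\<^sub>R y) (x + (- 1) *\<^sub>R y) = a x x - 2 * a x y + a y y"
      by (simp only: a_add a_add' a_scale a_scale' a_commute[of y x]) simp
    ultimately have "2 * \<bar>a x y\<bar> \<le> a x x + a y y"
      using a_nonneg[of "x + y"] a_nonneg[of "x + (- 1) *\<^sub>R y"] by linarith
    then show ?thesis using a_le[of x] a_le[of y] by (simp add: distrib_left)
  qed
  have a_zero: "a 0 y = 0" "a x 0 = 0" for x y
    using a_scale[of 0 0 y] a_scale'[of x 0 0] by auto
  have a_bound: "\<bar>a x y\<bar> \<le> norm x * norm y * K" for x y
  proof (cases "x = 0 \<or> y = 0")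
    case False
    have "a x y = norm x * norm y * a (x /\<^sub>R norm x) (y /\<^sub>R norm y)"
      using False by (simp add: a_scale a_scale' field_simps)
    moreover have "\<bar>a (x /\<^sub>R norm x) (y /\<^sub>R norm y)\<bar> \<le> K"
      using a_bound2[of "x /\<^sub>R norm x" "y /\<^sub>R norm y"] False by simp
    ultimately show ?thesis by (simp add: abs_mult mult_left_mono)
  qed (auto simp: a_zero)
  have a: "bounded_bilinear a"
    by (rule bounded_bilinear.intro) (use a_bound in \<open>auto simp: a_add a_add' a_scale a_scale'\<close>)
  obtain C where C: "\<And>x y. norm (b x y) \<le> norm x * norm y * C" using b.bounded by blast
  have "bounded_bilinear (\<lambda>x y. a x y - b x y)"
  proof (rule bounded_bilinear.intro)
    show "\<exists>K. \<forall>x y. norm (a x y - b x y) \<le> norm x * norm y * K"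
    proof (intro exI[of _ "K + C"] allI)
      fix x y
      show "norm (a x y - b x y) \<le> norm x * norm y * (K + C)"
        using norm_triangle_ineq4[of "a x y" "b x y"] a_bound[of x y] C[of x y] by (simp add: distrib_left)
    qed
  qed (auto simp: a_add a_add' a_scale a_scale' b.add_left b.add_right b.scaleR_left b.scaleR_right right_diff_distrib)
  then have "continuous_quadratic_form (\<lambda>x. a x x - q x)"
    unfolding continuous_quadratic_form_def q by (intro exI[of _ "\<lambda>x y. a x y - b x y"]) auto
  moreover have "0 \<le> a x x - q x" for x
    using \<Lambda>_ge[OF rep(1)[of x]] by (simp add: q a_def rep(2))
  moreover have "continuous_quadratic_form (\<lambda>x. a x x)"
    unfolding continuous_quadratic_form_def using a by auto
  ultimately show "delta_semidefinite q"
    unfolding delta_semidefinite_def using a_nonneg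
    by (intro exI[of _ "\<lambda>x. a x x"] exI[of _ "\<lambda>x. a x x - q x"]) auto
qed

end

section \<open>The classification\<close>

theorem theorem3p3:
  fixes p :: ennreal
    and M :: "'a measure"
    and T :: "('a \<Rightarrow> real) \<Rightarrow> 'x::banach"
  assumes "1 \<le> p"
    and "is_Lp_space p M T"
    and "infinite_dimensional TYPE('x)"
  shows "(property_D TYPE('x) \<longleftrightarrow> 2 \<le> p) \<and>
         (property_Cdc TYPE('x) \<longleftrightarrow> 1 < p \<and> p \<le> 2) \<and>
         (property_dc TYPE('x) \<longleftrightarrow> 1 < p)"
proof -
  interpret Lp_space p M T
    using assms(1,2) by (rule Lp_space.intro)
  show ?thesis
  proof (rule coordinates_exist[OF assms(3)])
    fix e :: "nat \<Rightarrow> nat \<Rightarrow> 'x" and \<xi>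
    assume coordinates: "block_coordinates e \<xi>"
      and sum: "p \<noteq> \<infinity> \<Longrightarrow> \<forall>k n x. (\<Sum>i<n. \<bar>\<xi> k i x\<bar> powr enn2real p) \<le> norm x powr enn2real p"
      and flat: "\<And>k n \<sigma>. (\<forall>i. \<bar>\<sigma> i\<bar> = 1) \<Longrightarrow> norm (\<Sum>i<n. \<sigma> i *\<^sub>R e k i) \<le> real n powr (1 / enn2real p)"
    interpret block_coordinates e \<xi> by (rule coordinates)
    have not_D: "\<not> property_D TYPE('x)" if "\<not> 2 \<le> p"
    proof -
      have p: "p \<noteq> \<infinity>" using that by auto
      show ?thesis
      proof (rule not_property_D)
        show "1 \<le> enn2real p" using p by (rule r_ge_1)
        show "enn2real p < 2" using that p by (simp add: compare_p)
        show "(\<Sum>i<n. \<bar>\<xi> k i x\<bar> powr enn2real p) \<le> norm x powr enn2real p" for k n x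
          using sum[OF p] by blast
      qed
    qed
    have not_dc: "\<not> property_dc TYPE('x)" if "\<not> 1 < p"
    proof (rule not_property_dc)
      have "p = 1" using that assms(1) by auto
      then show "(\<Sum>i<n. \<bar>\<xi> k i x\<bar>) \<le> norm x" for k n x using sum by simp
    qed
    have not_Cdc: "\<not> property_Cdc TYPE('x)" if "\<not> p \<le> 2"
    proof (rule not_property_Cdc)
      show "0 \<le> 1 / enn2real p" by simp
      (* For infinite p the exponent is 1 / 0 = 0, as it should be: the norm of a sum of
         disjoint normalized functions is their maximum. *)
      show "1 / enn2real p < 1 / 2"
      proof (cases "p = \<infinity>")
        case False
        then have "2 < enn2real p" using that by (simp add: compare_p)
        then show ?thesis by simp
      qed simp
      show "norm (\<Sum>i<n. \<sigma> i *\<^sub>R e k i) \<le> real n powr (1 / enn2real p)" if "\<forall>i. \<bar>\<sigma> i\<bar> = 1" for k n \<sigma>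
        using that by (rule flat)
    qed
    have "property_D TYPE('x) \<longleftrightarrow> 2 \<le> p" using not_D property_D_if_ge_2 by blast
    moreover have Cdc: "property_Cdc TYPE('x) \<longleftrightarrow> 1 < p \<and> p \<le> 2"
      using not_Cdc not_dc property_Cdc_if_between property_Cdc_imp_property_dc[where 'x = 'x] by blast
    moreover have "property_dc TYPE('x)" if "1 < p"
    proof (cases "p \<le> 2")
      case True
      then show ?thesis using that Cdc by (intro property_Cdc_imp_property_dc) auto
    next
      case False
      then show ?thesis by (intro property_D_imp_property_dc property_D_if_ge_2) auto
    qed
    ultimately show ?thesis using not_dc by blast
  qed
qed

end
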